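(* Let $g\ge0$, $k\ge1$, and let $\sigma$ be the involution $g\mapsto\mathscr{J}\,{}^tg^{-1}\mathscr{J}^{-1}$ of $\mathrm{GL}_2$ over $\mathbb{C}$, with $\mathscr{J}=\begin{pmatrix}0&1\\-1&0\end{pmatrix}$. For $1\le j\le2k$ let $C_j\subset\mathrm{GL}_2\sigma$ be the $\mathrm{GL}_2$-conjugacy class of $\mathrm{diag}(a_j,a_j^{-1})\sigma$ in $\mathrm{GL}_2\rtimes\langle\sigma\rangle$, where $a_j\in\mathbb{C}^*$, $a_j^2\ne-1$, and let $C_j'\subset\mathrm{SL}_2$ be the conjugacy class of $\mathrm{diag}(a_j,a_j^{-1})$. Put $\mathcal{C}=(C_j)_j$, $\mathcal{C}'=(C_j')_j$. Then there is an isomorphism of varieties $$\big(\mathrm{Ch}^+_{\mathcal{C}'}\sqcup\mathrm{Ch}^-_{\mathcal{C}'}\big)\times\mathbb{G}_m^{2k-2}\;\cong\;\mathrm{Ch}_{\mathcal{C}}.$$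
   Context: The quotients below are categorical (GIT) quotients by simultaneous conjugation by $\mathrm{GL}_2$. $\mathrm{Ch}_{\mathcal{C}}$ is the quotient of $\{(A_i,B_i)_{1\le i\le g},(X_j)_{1\le j\le2k}\in\mathrm{GL}_2^{2g}\times\prod_jC_j\mid\prod_i[A_i,B_i]\prod_jX_j=1\}$, the product being taken in $\mathrm{GL}_2\rtimes\langle\sigma\rangle$. $\mathrm{Ch}^{\pm}_{\mathcal{C}'}$ is the quotient of $\{(A_i,B_i)_{1\le i\le g},(X'_j)_{1\le j\le2k}\in\mathrm{GL}_2^{2g}\times\prod_jC'_j\mid\prod_i[A_i,B_i]\prod_jX'_j=\pm1\}$. *)

theory Defs
  imports "HOL-Analysis.Analysis" "HOL-Algebra.Group"
begin

section \<open>Affine varieties over the complex numbers\<close>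

text \<open>
  A (reduced, possibly reducible or empty) affine variety over the complex numbers is represented
  by its set of closed points together with its ring of regular functions. Regular functions are
  extensional (\<^term>\<open>undefined\<close> off the set of points), so that equality of regular functions is
  equality of HOL functions. An affine variety is determined by these data, and a map between two
  affine varieties is a morphism exactly if it pulls regular functions back to regular functions.
\<close>

record 'a variety =
  points :: "'a set"
  regular :: "('a \<Rightarrow> complex) set"

definition morphism :: "'a variety \<Rightarrow> 'b variety \<Rightarrow> ('a \<Rightarrow> 'b) \<Rightarrow> bool" where
  "morphism V W \<phi> \<longleftrightarrow>
     \<phi> \<in> points V \<rightarrow> points W \<and>
     (\<forall>f \<in> regular W. restrict (f \<circ> \<phi>) (points V) \<in> regular V)"

definition isomorphic_varieties :: "'a variety \<Rightarrow> 'b variety \<Rightarrow> bool" where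
  "isomorphic_varieties V W \<longleftrightarrow>
     (\<exists>\<phi> \<psi>. morphism V W \<phi> \<and> morphism W V \<psi> \<and>
        (\<forall>x \<in> points V. \<psi> (\<phi> x) = x) \<and> (\<forall>y \<in> points W. \<phi> (\<psi> y) = y))"

inductive_set generated_algebra :: "('a \<Rightarrow> complex) set \<Rightarrow> ('a \<Rightarrow> complex) set"
  for S where
  const: "(\<lambda>_. c) \<in> generated_algebra S"
| gen: "f \<in> S \<Longrightarrow> f \<in> generated_algebra S"
| add: "f \<in> generated_algebra S \<Longrightarrow> h \<in> generated_algebra S \<Longrightarrow>
          (\<lambda>x. f x + h x) \<in> generated_algebra S"
| mult: "f \<in> generated_algebra S \<Longrightarrow> h \<in> generated_algebra S \<Longrightarrow>
          (\<lambda>x. f x * h x) \<in> generated_algebra S"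

text \<open>
  For a Zariski closed subset \<open>X\<close> of an affine variety whose coordinate ring is generated by the
  functions in \<open>S\<close>, this is \<open>X\<close> with its structure of a closed subvariety.
\<close>

definition variety_on :: "'a set \<Rightarrow> ('a \<Rightarrow> complex) set \<Rightarrow> 'a variety" where
  "variety_on X S = \<lparr>points = X, regular = (\<lambda>f. restrict f X) ` generated_algebra S\<rparr>"

definition product_variety :: "'a variety \<Rightarrow> 'b variety \<Rightarrow> ('a \<times> 'b) variety" where
  "product_variety V W =
     variety_on (points V \<times> points W)
       ({f \<circ> fst |f. f \<in> regular V} \<union> {f \<circ> snd |f. f \<in> regular W})"

definition disjoint_union :: "'a variety \<Rightarrow> 'b variety \<Rightarrow> ('a + 'b) variety" where
  "disjoint_union V W =
     \<lparr>points = points V <+> points W,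
      regular = {f \<in> extensional (points V <+> points W).
        restrict (f \<circ> Inl) (points V) \<in> regular V \<and>
        restrict (f \<circ> Inr) (points W) \<in> regular W}\<rparr>"

text \<open>The torus \<open>\<bbbG>\<^sub>m\<^sup>n\<close>.\<close>

definition torus :: "nat \<Rightarrow> (nat \<Rightarrow> complex) variety" where
  "torus n =
     variety_on ({1..n} \<rightarrow>\<^sub>E - {0})
       ({\<lambda>z. z i |i. i \<in> {1..n}} \<union> {\<lambda>z. inverse (z i) |i. i \<in> {1..n}})"


section \<open>Categorical quotients\<close>

definition invariants :: "'g set \<Rightarrow> ('g \<Rightarrow> 'a \<Rightarrow> 'a) \<Rightarrow> 'a variety \<Rightarrow> ('a \<Rightarrow> complex) set" where
  "invariants G act V =
     {f \<in> regular V. \<forall>h \<in> G. \<forall>x \<in> points V. f (act h x) = f x}"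

definition algebra_characters ::
  "'a set \<Rightarrow> ('a \<Rightarrow> complex) set \<Rightarrow> (('a \<Rightarrow> complex) \<Rightarrow> complex) set" where
  "algebra_characters X R =
     {\<theta> \<in> extensional R.
        (\<forall>c. \<theta> (\<lambda>x\<in>X. c) = c) \<and>
        (\<forall>f \<in> R. \<forall>h \<in> R. \<theta> (\<lambda>x\<in>X. f x + h x) = \<theta> f + \<theta> h) \<and>
        (\<forall>f \<in> R. \<forall>h \<in> R. \<theta> (\<lambda>x\<in>X. f x * h x) = \<theta> f * \<theta> h)}"

text \<open>
  The categorical quotient of an affine variety by a reductive group is the spectrum of the
  algebra of invariant regular functions. Its closed points are the homomorphisms of algebras from
  the invariants to the complex numbers, and its regular functions are the evaluations at
  invariants.
\<close>

definition git_quotient ::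
  "'g set \<Rightarrow> ('g \<Rightarrow> 'a \<Rightarrow> 'a) \<Rightarrow> 'a variety \<Rightarrow> (('a \<Rightarrow> complex) \<Rightarrow> complex) variety" where
  "git_quotient G act V =
     (let R = invariants G act V; P = algebra_characters (points V) R
      in \<lparr>points = P, regular = {\<lambda>\<theta>\<in>P. \<theta> f |f. f \<in> R}\<rparr>)"


section \<open>The groups\<close>

type_synonym mat2 = "complex^2^2"

definition GL2 :: "mat2 monoid" where
  "GL2 = \<lparr>carrier = {M. invertible M}, monoid.mult = (**), one = mat 1\<rparr>"

definition SL2 :: "mat2 set" where
  "SL2 = {M. det M = 1}"

definition diag2 :: "complex \<Rightarrow> complex \<Rightarrow> mat2" where
  "diag2 a b = vector [vector [a, 0], vector [0, b]]"

definition J2 :: mat2 where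
  "J2 = vector [vector [0, 1], vector [-1, 0]]"

definition sigma_GL2 :: "mat2 \<Rightarrow> mat2" where
  "sigma_GL2 M = J2 ** transpose (matrix_inv M) ** matrix_inv J2"

text \<open>
  The semidirect product of \<^term>\<open>GL2\<close> with the group of order two generated by
  \<^term>\<open>sigma_GL2\<close>: the pair \<open>(M, False)\<close> stands for \<open>M\<close> and \<open>(M, True)\<close> for \<open>M \<sigma>\<close>.
\<close>

definition GL2_sigma :: "(mat2 \<times> bool) monoid" where
  "GL2_sigma =
     \<lparr>carrier = carrier GL2 \<times> UNIV,
      monoid.mult = (\<lambda>(M, e) (N, f). (M ** (if e then sigma_GL2 N else N), e \<noteq> f)),
      one = (mat 1, False)\<rparr>"

definition embed :: "mat2 \<Rightarrow> mat2 \<times> bool" where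
  "embed M = (M, False)"

definition sigma_elt :: "mat2 \<times> bool" where
  "sigma_elt = (mat 1, True)"

definition conjugate :: "('h, 'm) monoid_scheme \<Rightarrow> 'h \<Rightarrow> 'h \<Rightarrow> 'h" where
  "conjugate H h x = h \<otimes>\<^bsub>H\<^esub> x \<otimes>\<^bsub>H\<^esub> inv\<^bsub>H\<^esub> h"

definition commutator :: "('h, 'm) monoid_scheme \<Rightarrow> 'h \<Rightarrow> 'h \<Rightarrow> 'h" where
  "commutator H x y = x \<otimes>\<^bsub>H\<^esub> y \<otimes>\<^bsub>H\<^esub> inv\<^bsub>H\<^esub> x \<otimes>\<^bsub>H\<^esub> inv\<^bsub>H\<^esub> y"

text \<open>The ordered product \<open>x\<^sub>1 x\<^sub>2 \<dots> x\<^sub>n\<close>.\<close>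

definition ordered_prod :: "('h, 'm) monoid_scheme \<Rightarrow> nat \<Rightarrow> (nat \<Rightarrow> 'h) \<Rightarrow> 'h" where
  "ordered_prod H n x = foldr (\<lambda>i y. x i \<otimes>\<^bsub>H\<^esub> y) [1..<Suc n] \<one>\<^bsub>H\<^esub>"

definition class_sigma :: "complex \<Rightarrow> (mat2 \<times> bool) set" where
  "class_sigma a =
     {conjugate GL2_sigma (embed h) (embed (diag2 a (inverse a)) \<otimes>\<^bsub>GL2_sigma\<^esub> sigma_elt) |h.
        h \<in> carrier GL2}"

definition class_SL2 :: "complex \<Rightarrow> mat2 set" where
  "class_SL2 a = {conjugate GL2 h (diag2 a (inverse a)) |h. h \<in> SL2}"

text \<open>
  Generators of the coordinate rings of \<^term>\<open>GL2\<close> and of \<^term>\<open>GL2_sigma\<close>. The latter group is, as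
  a variety, the disjoint union of two copies of the former.
\<close>

definition coords_GL2 :: "(mat2 \<Rightarrow> complex) set" where
  "coords_GL2 = {\<lambda>M. M $ r $ s |r s. True} \<union> {\<lambda>M. inverse (det M)}"

definition coords_GL2_sigma :: "(mat2 \<times> bool \<Rightarrow> complex) set" where
  "coords_GL2_sigma = {c \<circ> fst |c. c \<in> coords_GL2} \<union> {\<lambda>x. of_bool (snd x)}"


section \<open>Representation varieties and character varieties\<close>

text \<open>
  Below \<open>H\<close> is one of the groups \<^term>\<open>GL2\<close>, \<^term>\<open>GL2_sigma\<close>, and \<open>\<iota>\<close> is the inclusion of
  \<^term>\<open>GL2\<close> into \<open>H\<close>. A point is a triple \<open>(A, B, X)\<close> of extensional families, with
  \<open>A\<^sub>i, B\<^sub>i\<close> in \<^term>\<open>GL2\<close> for \<open>1 \<le> i \<le> g\<close> and \<open>X\<^sub>j\<close> in \<open>H\<close> for \<open>1 \<le> j \<le> n\<close>.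
\<close>

type_synonym 'h tuple = "(nat \<Rightarrow> mat2) \<times> (nat \<Rightarrow> mat2) \<times> (nat \<Rightarrow> 'h)"

definition rep_points ::
  "'h monoid \<Rightarrow> (mat2 \<Rightarrow> 'h) \<Rightarrow> nat \<Rightarrow> nat \<Rightarrow> (nat \<Rightarrow> 'h set) \<Rightarrow> 'h \<Rightarrow> 'h tuple set" where
  "rep_points H \<iota> g n C z =
     {(A, B, X). A \<in> {1..g} \<rightarrow>\<^sub>E carrier GL2 \<and> B \<in> {1..g} \<rightarrow>\<^sub>E carrier GL2 \<and>
        X \<in> (\<Pi>\<^sub>E j\<in>{1..n}. C j) \<and>
        ordered_prod H g (\<lambda>i. commutator H (\<iota> (A i)) (\<iota> (B i))) \<otimes>\<^bsub>H\<^esub> ordered_prod H n X = z}"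

definition tuple_coords :: "('h \<Rightarrow> complex) set \<Rightarrow> nat \<Rightarrow> nat \<Rightarrow> ('h tuple \<Rightarrow> complex) set" where
  "tuple_coords S g n =
     {\<lambda>(A, B, X). c (A i) |c i. c \<in> coords_GL2 \<and> i \<in> {1..g}} \<union>
     {\<lambda>(A, B, X). c (B i) |c i. c \<in> coords_GL2 \<and> i \<in> {1..g}} \<union>
     {\<lambda>(A, B, X). c (X j) |c j. c \<in> S \<and> j \<in> {1..n}}"

definition simultaneous_conj ::
  "'h monoid \<Rightarrow> (mat2 \<Rightarrow> 'h) \<Rightarrow> nat \<Rightarrow> nat \<Rightarrow> mat2 \<Rightarrow> 'h tuple \<Rightarrow> 'h tuple" where
  "simultaneous_conj H \<iota> g n h =
     (\<lambda>(A, B, X). (\<lambda>i\<in>{1..g}. conjugate GL2 h (A i), \<lambda>i\<in>{1..g}. conjugate GL2 h (B i),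
                   \<lambda>j\<in>{1..n}. conjugate H (\<iota> h) (X j)))"

definition char_variety ::
  "'h monoid \<Rightarrow> (mat2 \<Rightarrow> 'h) \<Rightarrow> ('h \<Rightarrow> complex) set \<Rightarrow> nat \<Rightarrow> nat \<Rightarrow> (nat \<Rightarrow> 'h set) \<Rightarrow> 'h \<Rightarrow>
     (('h tuple \<Rightarrow> complex) \<Rightarrow> complex) variety" where
  "char_variety H \<iota> S g n C z =
     git_quotient (carrier GL2) (simultaneous_conj H \<iota> g n)
       (variety_on (rep_points H \<iota> g n C z) (tuple_coords S g n))"

definition Ch ::
  "nat \<Rightarrow> nat \<Rightarrow> (nat \<Rightarrow> (mat2 \<times> bool) set) \<Rightarrow> (((mat2 \<times> bool) tuple \<Rightarrow> complex) \<Rightarrow> complex) variety" where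
  "Ch g k C = char_variety GL2_sigma embed coords_GL2_sigma g (2 * k) C \<one>\<^bsub>GL2_sigma\<^esub>"

definition Ch_plus ::
  "nat \<Rightarrow> nat \<Rightarrow> (nat \<Rightarrow> mat2 set) \<Rightarrow> ((mat2 tuple \<Rightarrow> complex) \<Rightarrow> complex) variety" where
  "Ch_plus g k C' = char_variety GL2 (\<lambda>M. M) coords_GL2 g (2 * k) C' (mat 1)"

definition Ch_minus ::
  "nat \<Rightarrow> nat \<Rightarrow> (nat \<Rightarrow> mat2 set) \<Rightarrow> ((mat2 tuple \<Rightarrow> complex) \<Rightarrow> complex) variety" where
  "Ch_minus g k C' = char_variety GL2 (\<lambda>M. M) coords_GL2 g (2 * k) C' (- mat 1)"


section \<open>Basic properties of the groups\<close>

lemma GL2_simps [simp]: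
  "carrier GL2 = {M. invertible M}" "x \<otimes>\<^bsub>GL2\<^esub> y = x ** y" "\<one>\<^bsub>GL2\<^esub> = mat 1"
  by (simp_all add: GL2_def)

lemma invertible_mat_1 [simp]: "invertible (mat 1 :: mat2)"
  by (simp add: invertible_det_nz)

lemma matrix_inv_mult:
  "invertible (M::mat2) \<Longrightarrow> M ** matrix_inv M = mat 1"
  "invertible (M::mat2) \<Longrightarrow> matrix_inv M ** M = mat 1"
  unfolding matrix_inv_def invertible_def
  by (metis (mono_tags, lifting) someI_ex)+

lemma matrix_inv_invertible: "invertible (M::mat2) \<Longrightarrow> invertible (matrix_inv M)"
  using matrix_inv_mult by (auto simp: invertible_def)

lemma group_GL2: "group GL2"
proof (rule groupI)
  fix x assume "x \<in> carrier GL2"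
  then show "\<exists>y\<in>carrier GL2. y \<otimes>\<^bsub>GL2\<^esub> x = \<one>\<^bsub>GL2\<^esub>"
    by (intro bexI[of _ "matrix_inv x"]) (auto simp: matrix_inv_mult matrix_inv_invertible)
qed (auto simp: invertible_mult matrix_mul_assoc)

lemma inv_GL2: "invertible M \<Longrightarrow> inv\<^bsub>GL2\<^esub> M = matrix_inv M"
  by (rule group.inv_equality[OF group_GL2])
     (auto simp: matrix_inv_mult matrix_inv_invertible)

lemma matrix_inv_unique2: "(A::mat2) ** B = mat 1 \<Longrightarrow> matrix_inv A = B"
  by (metis invertible_right_inverse matrix_inv_mult(2) matrix_mul_assoc matrix_mul_lid
      matrix_mul_rid)

lemma matrix_inv_2:
  assumes "invertible (M::mat2)"
  shows "matrix_inv M =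
    vector [vector [M $ 2 $ 2 / det M, - (M $ 1 $ 2) / det M],
            vector [- (M $ 2 $ 1) / det M, M $ 1 $ 1 / det M]]"
proof (rule matrix_inv_unique2)
  have "det M \<noteq> 0" using assms by (simp add: invertible_det_nz)
  then show "M ** vector [vector [M $ 2 $ 2 / det M, - (M $ 1 $ 2) / det M],
            vector [- (M $ 2 $ 1) / det M, M $ 1 $ 1 / det M]] = mat 1"
    by (simp add: vec_eq_iff forall_2 matrix_matrix_mult_def sum_2 mat_def
        add_divide_distrib[symmetric] diff_divide_distrib[symmetric])
       (simp add: det_2 algebra_simps)
qed

lemma matrix_inv_J2: "matrix_inv J2 = - J2"
  by (rule matrix_inv_unique2)
     (simp add: J2_def vec_eq_iff forall_2 matrix_matrix_mult_def sum_2 mat_def)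

lemma sigma_entries:
  assumes "invertible M"
  shows "sigma_GL2 M $ r $ s = M $ r $ s / det M"
proof -
  have "\<forall>r s. sigma_GL2 M $ r $ s = M $ r $ s / det M"
    unfolding sigma_GL2_def matrix_inv_J2 matrix_inv_2[OF assms]
    by (simp add: J2_def forall_2 matrix_matrix_mult_def sum_2 transpose_def)
  then show ?thesis by blast
qed

lemma det_sigma:
  assumes "invertible M"
  shows "det (sigma_GL2 M) = 1 / det M"
proof -
  have "det (sigma_GL2 M) = det M / (det M * det M)"
    using assms by (simp add: det_2 sigma_entries diff_divide_distrib)
  then show ?thesis using assms by (simp add: invertible_det_nz)
qed

lemma sigma_mult:
  "invertible M \<Longrightarrow> invertible N \<Longrightarrow> sigma_GL2 (M ** N) = sigma_GL2 M ** sigma_GL2 N"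
  by (subst vec_eq_iff)
     (simp add: vec_eq_iff sigma_entries invertible_mult det_mul,
      simp add: matrix_matrix_mult_def sigma_entries sum_divide_distrib)

lemma sigma_mat_1 [simp]: "sigma_GL2 (mat 1) = mat 1"
  by (simp add: vec_eq_iff sigma_entries)

lemma invertible_sigma: "invertible M \<Longrightarrow> invertible (sigma_GL2 M)"
  by (simp add: invertible_det_nz det_sigma)

lemma sigma_sigma: "invertible M \<Longrightarrow> sigma_GL2 (sigma_GL2 M) = M"
  by (simp add: vec_eq_iff sigma_entries invertible_sigma det_sigma invertible_det_nz)

lemma GL2_sigma_simps [simp]:
  "carrier GL2_sigma = {M. invertible M} \<times> UNIV"
  "(M, e) \<otimes>\<^bsub>GL2_sigma\<^esub> (N, f) = (M ** (if e then sigma_GL2 N else N), e \<noteq> f)"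
  "\<one>\<^bsub>GL2_sigma\<^esub> = (mat 1, False)"
  by (simp_all add: GL2_sigma_def)

lemma group_GL2_sigma: "group GL2_sigma"
proof (rule groupI)
  fix x assume x: "x \<in> carrier GL2_sigma"
  obtain M e where [simp]: "x = (M, e)" by fastforce
  have M: "invertible M" using x by simp
  have "sigma_GL2 (matrix_inv M) ** sigma_GL2 M = mat 1"
    using sigma_mult[OF matrix_inv_invertible[OF M] M]
    by (simp add: matrix_inv_mult[OF M])
  then show "\<exists>y\<in>carrier GL2_sigma. y \<otimes>\<^bsub>GL2_sigma\<^esub> x = \<one>\<^bsub>GL2_sigma\<^esub>"
    using M
    by (intro bexI[of _ "(if e then sigma_GL2 (matrix_inv M) else matrix_inv M, e)"])
       (auto simp: matrix_inv_mult matrix_inv_invertible invertible_sigma)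
qed (auto simp: invertible_mult matrix_mul_assoc sigma_mult invertible_sigma sigma_sigma)

lemma embed_hom: "embed \<in> hom GL2 GL2_sigma"
  by (auto simp: hom_def embed_def invertible_mult)

lemma conjugate_sigma_elt:
  "invertible M \<Longrightarrow> conjugate GL2_sigma sigma_elt (embed M) = embed (sigma_GL2 M)"
proof -
  have "inv\<^bsub>GL2_sigma\<^esub> sigma_elt = sigma_elt"
    by (rule group.inv_equality[OF group_GL2_sigma])
       (auto simp: sigma_elt_def)
  then show "conjugate GL2_sigma sigma_elt (embed M) = embed (sigma_GL2 M)"
    by (auto simp: conjugate_def embed_def sigma_elt_def vec_eq_iff sigma_entries)
qed

end

theory Submission
  imports Defs
begin

text \<open>
  On \<^term>\<open>GL2\<close> the involution is \<open>M \<mapsto> det(M)\<^sup>-\<^sup>1 M\<close>. Hence \<open>C\<^sub>j\<close> consists of the elements \<open>\<lambda> Y \<sigma>\<close> with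
  \<open>\<lambda> \<noteq> 0\<close> and \<open>Y\<close> in \<open>C'\<^sub>j\<close>; since \<open>a\<^sub>j + a\<^sub>j\<^sup>-\<^sup>1 \<noteq> 0\<close>, the trace recovers \<open>\<lambda>\<close>. Moving the \<open>\<sigma>\<close>'s to the right, the
  defining relation becomes \<open>\<lambda>\<^sub>1 \<lambda>\<^sub>2\<^sup>-\<^sup>1 \<cdots> \<lambda>\<^sub>2\<^sub>k\<^sup>-\<^sup>1 \<Prod>[A\<^sub>i, B\<^sub>i] \<Prod>Y\<^sub>j = 1\<close>, and taking determinants forces both the
  scalar and the matrix factor to be the same sign. Conjugation by \<open>h\<close> multiplies each \<open>\<lambda>\<^sub>j\<close> by
  \<open>det h\<close>, so that scalar matrices normalize \<open>\<lambda>\<^sub>1 = 1\<close>; the ratios \<open>\<lambda>\<^sub>j\<^sub>+\<^sub>1 / \<lambda>\<^sub>1\<close> with \<open>j \<le> 2k - 2\<close> are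
  invariant coordinates on a torus, and \<open>\<lambda>\<^sub>2\<^sub>k\<close> is determined by them and the sign.
\<close>

section \<open>Algebras of functions and their characters\<close>

text \<open>The points of the quotients are characters of algebras of invariants, so matching orbits
  is not enough: the isomorphism has to be read off invariant functions. Write V and W for the
  representation varieties with and without \<sigma>, both signs together in W, and T for the torus.
  The slice \<open>\<lambda>\<^sub>1 = 1\<close> is the image of a section from W x T to V, but a
  point of V is moved there by a square root of \<open>\<lambda>\<^sub>1\<^sup>-\<^sup>1\<close>
  chosen pointwise, so V itself is not identified with W x T. An invariant function sees only the
  orbit, hence is determined on the slice. What has to be shown is that there it is a finite sum of
  products p(w) q(z) with p invariant. Its sections at fixed z are invariant, and an elimination on
  finite-rank functions produces the factors p from such sections; this does the work of averaging
  over the group. The factor T consists of points while the quotients consist of characters, so each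
  character of the coordinate ring of T has to be evaluation at a point. The two signs are separated
  by the regular idempotent (1 + sign) / 2, which cuts the spectrum of the invariants of W into two
  pieces.\<close>

definition function_algebra :: "'a set \<Rightarrow> ('a \<Rightarrow> complex) set \<Rightarrow> bool" where
  "function_algebra X R \<longleftrightarrow>
     R \<subseteq> extensional X \<and> (\<forall>c. (\<lambda>x\<in>X. c) \<in> R) \<and>
     (\<forall>f\<in>R. \<forall>h\<in>R. (\<lambda>x\<in>X. f x + h x) \<in> R) \<and>
     (\<forall>f\<in>R. \<forall>h\<in>R. (\<lambda>x\<in>X. f x * h x) \<in> R)"

context
  fixes X :: "'a set" and R :: "('a \<Rightarrow> complex) set"
  assumes alg: "function_algebra X R"
begin

lemma function_algebra_restrict: "f \<in> R \<Longrightarrow> restrict f X = f"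
  using alg by (auto simp: function_algebra_def intro: extensional_restrict)

lemma function_algebra_const: "(\<lambda>x\<in>X. c) \<in> R"
  using alg by (auto simp: function_algebra_def)

text \<open>\<open>F\<close> and \<open>H\<close> are arbitrary and only their restrictions lie in
  \<open>R\<close>; thus closure applies directly to pointwise formulas, without tracking the
  default value off \<open>X\<close>.\<close>

lemma function_algebra_add:
  assumes "restrict F X \<in> R" "restrict H X \<in> R"
  shows "(\<lambda>x\<in>X. F x + H x) \<in> R"
proof -
  have "(\<lambda>x\<in>X. restrict F X x + restrict H X x) \<in> R"
    using alg assms unfolding function_algebra_def by blast
  then show ?thesis by (simp cong: restrict_cong)
qed

lemma function_algebra_mult:
  assumes "restrict F X \<in> R" "restrict H X \<in> R"
  shows "(\<lambda>x\<in>X. F x * H x) \<in> R"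
proof -
  have "(\<lambda>x\<in>X. restrict F X x * restrict H X x) \<in> R"
    using alg assms unfolding function_algebra_def by blast
  then show ?thesis by (simp cong: restrict_cong)
qed

lemma function_algebra_scale: "restrict F X \<in> R \<Longrightarrow> (\<lambda>x\<in>X. c * F x) \<in> R"
  by (rule function_algebra_mult[OF function_algebra_const])

lemma function_algebra_uminus: "restrict F X \<in> R \<Longrightarrow> (\<lambda>x\<in>X. - F x) \<in> R"
  using function_algebra_scale[of F "-1"] by simp

lemma function_algebra_diff:
  "restrict F X \<in> R \<Longrightarrow> restrict H X \<in> R \<Longrightarrow> (\<lambda>x\<in>X. F x - H x) \<in> R"
  using function_algebra_add[OF _ function_algebra_uminus, of F H] by simp

lemma function_algebra_prod:
  "(\<And>i. i \<in> I \<Longrightarrow> restrict (F i) X \<in> R) \<Longrightarrow> (\<lambda>x\<in>X. \<Prod>i\<in>I. F i x) \<in> R"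
  by (induction I rule: infinite_finite_induct)
     (auto intro: function_algebra_const function_algebra_mult)

lemma function_algebra_sum_list:
  "(\<And>i. i \<in> set l \<Longrightarrow> restrict (F i) X \<in> R) \<Longrightarrow> (\<lambda>x\<in>X. \<Sum>i\<leftarrow>l. F i x) \<in> R"
  by (induction l) (auto intro: function_algebra_const function_algebra_add)

text \<open>The functions whose pullback along \<open>\<phi>\<close> lies in \<open>R\<close>
  contain the constants and are closed under sums and products, so generators suffice.\<close>

lemma generated_algebra_subset:
  assumes "F \<in> generated_algebra S" and "\<phi> \<in> X \<rightarrow> Y"
    and "\<And>f. f \<in> S \<Longrightarrow> (\<lambda>x\<in>X. f (\<phi> x)) \<in> R"
  shows "(\<lambda>x\<in>X. F (\<phi> x)) \<in> R"
  using assms(1)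
  by induction
     (rule function_algebra_const assms(3) function_algebra_add function_algebra_mult; assumption)+

context
  fixes \<theta>
  assumes char: "\<theta> \<in> algebra_characters X R"
begin

lemma character_const: "\<theta> (\<lambda>x\<in>X. c) = c"
  using char by (auto simp: algebra_characters_def)

lemma character_add:
  assumes "restrict F X \<in> R" "restrict H X \<in> R"
  shows "\<theta> (\<lambda>x\<in>X. F x + H x) = \<theta> (restrict F X) + \<theta> (restrict H X)"
proof -
  have "\<theta> (\<lambda>x\<in>X. restrict F X x + restrict H X x) = \<theta> (restrict F X) + \<theta> (restrict H X)"
    using char assms unfolding algebra_characters_def by blast
  then show ?thesis by (simp cong: restrict_cong)
qed

lemma character_mult:
  assumes "restrict F X \<in> R" "restrict H X \<in> R"
  shows "\<theta> (\<lambda>x\<in>X. F x * H x) = \<theta> (restrict F X) * \<theta> (restrict H X)"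
proof -
  have "\<theta> (\<lambda>x\<in>X. restrict F X x * restrict H X x) = \<theta> (restrict F X) * \<theta> (restrict H X)"
    using char assms unfolding algebra_characters_def by blast
  then show ?thesis by (simp cong: restrict_cong)
qed

lemma character_sum_list:
  "(\<And>i. i \<in> set l \<Longrightarrow> restrict (F i) X \<in> R) \<Longrightarrow>
   \<theta> (\<lambda>x\<in>X. \<Sum>i\<leftarrow>l. F i x) = (\<Sum>i\<leftarrow>l. \<theta> (restrict (F i) X))"
  by (induction l) (simp_all add: character_const character_add function_algebra_sum_list)

end

end

text \<open>Functoriality of the spectrum: the character is composed with the pullback homomorphism
  from \<open>R\<close> to \<open>Q\<close>. Only \<open>pb\<close> is asked of
  \<open>\<phi>\<close> besides mapping points; with algebras of invariants this also covers maps
  that are not equivariant.\<close>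

lemma character_pullback:
  assumes alg: "function_algebra X R" and Y: "function_algebra Y Q"
    and \<theta>: "\<theta> \<in> algebra_characters Y Q" and \<phi>: "\<phi> \<in> Y \<rightarrow> X"
    and pb: "\<And>f. f \<in> R \<Longrightarrow> (\<lambda>y\<in>Y. f (\<phi> y)) \<in> Q"
  shows "(\<lambda>f\<in>R. \<theta> (\<lambda>y\<in>Y. f (\<phi> y))) \<in> algebra_characters X R"
proof -
  \<comment> \<open>Pulling back a function that is extensional on \<open>X\<close> leaves a test
    for \<open>\<phi> y \<in> X\<close>, which always succeeds on \<open>Y\<close>.\<close>
  have eq: "(\<lambda>y\<in>Y. if \<phi> y \<in> X then F y else undefined) = restrict F Y" for F :: "'b \<Rightarrow> complex"
    using \<phi> by (auto intro!: restrict_ext)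
  have R: "(\<lambda>x\<in>X. f x + h x) \<in> R" "(\<lambda>x\<in>X. f x * h x) \<in> R" if "f \<in> R" "h \<in> R" for f h
    using that alg by (auto simp: function_algebra_def)
  show ?thesis
    unfolding algebra_characters_def
    by (auto simp: function_algebra_const[OF alg] eq R character_const[OF Y \<theta>]
        character_add[OF Y \<theta>] character_mult[OF Y \<theta>] pb)
qed

lemma character_extensional: "\<theta> \<in> algebra_characters X R \<Longrightarrow> \<theta> \<in> extensional R"
  by (simp add: algebra_characters_def)

text \<open>Since the points are characters, the sum or product of two evaluations is the evaluation
  at the sum or product.\<close>

lemma function_algebra_evaluations:
  assumes "function_algebra X R"
  shows "function_algebra (algebra_characters X R)
    {\<lambda>\<theta>\<in>algebra_characters X R. \<theta> f |f. f \<in> R}"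
proof -
  let ?P = "algebra_characters X R"
  note r = function_algebra_restrict[OF assms]
  have "\<exists>h. (\<lambda>\<theta>\<in>?P. c) = (\<lambda>\<theta>\<in>?P. \<theta> h) \<and> h \<in> R" for c
    by (rule exI[of _ "\<lambda>x\<in>X. c"])
       (auto intro!: restrict_ext simp: character_const[OF assms] function_algebra_const[OF assms])
  moreover have "\<exists>h. (\<lambda>\<theta>\<in>?P. (\<lambda>\<theta>\<in>?P. \<theta> f1) \<theta> + (\<lambda>\<theta>\<in>?P. \<theta> f2) \<theta>) = (\<lambda>\<theta>\<in>?P. \<theta> h) \<and> h \<in> R"
    if "f1 \<in> R" "f2 \<in> R" for f1 f2
    using that
    by (intro exI[of _ "\<lambda>x\<in>X. f1 x + f2 x"])
       (auto intro!: restrict_ext simp: character_add[OF assms] function_algebra_add[OF assms] r)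
  moreover have "\<exists>h. (\<lambda>\<theta>\<in>?P. (\<lambda>\<theta>\<in>?P. \<theta> f1) \<theta> * (\<lambda>\<theta>\<in>?P. \<theta> f2) \<theta>) = (\<lambda>\<theta>\<in>?P. \<theta> h) \<and> h \<in> R"
    if "f1 \<in> R" "f2 \<in> R" for f1 f2
    using that
    by (intro exI[of _ "\<lambda>x\<in>X. f1 x * f2 x"])
       (auto intro!: restrict_ext simp: character_mult[OF assms] function_algebra_mult[OF assms] r)
  ultimately show ?thesis unfolding function_algebra_def by auto
qed


section \<open>Varieties and morphisms\<close>

abbreviation variety_algebra :: "'a variety \<Rightarrow> bool" where
  "variety_algebra V \<equiv> function_algebra (points V) (regular V)"

lemma points_variety_on [simp]: "points (variety_on X S) = X"
  by (simp add: variety_on_def)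

lemma regular_variety_on: "F \<in> generated_algebra S \<Longrightarrow> restrict F X \<in> regular (variety_on X S)"
  by (simp add: variety_on_def)

lemma regular_variety_onE:
  assumes "f \<in> regular (variety_on X S)"
  obtains F where "F \<in> generated_algebra S" "f = restrict F X"
  using assms by (auto simp: variety_on_def)

lemma variety_algebra_variety_on: "variety_algebra (variety_on X S)"
proof -
  have "(\<lambda>x\<in>X. f x + h x) \<in> regular (variety_on X S) \<and>
      (\<lambda>x\<in>X. f x * h x) \<in> regular (variety_on X S)"
    if f: "f \<in> regular (variety_on X S)" and h: "h \<in> regular (variety_on X S)" for f h
  proof -
    obtain F where F: "F \<in> generated_algebra S" "f = restrict F X"
      using f by (rule regular_variety_onE)
    obtain H where H: "H \<in> generated_algebra S" "h = restrict H X"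
      using h by (rule regular_variety_onE)
    have "(\<lambda>x\<in>X. f x + h x) = (\<lambda>x\<in>X. F x + H x)" "(\<lambda>x\<in>X. f x * h x) = (\<lambda>x\<in>X. F x * H x)"
      by (simp_all add: F(2) H(2) cong: restrict_cong)
    with generated_algebra.add[OF F(1) H(1)] generated_algebra.mult[OF F(1) H(1)]
    show ?thesis by (metis regular_variety_on)
  qed
  moreover have "(\<lambda>x\<in>X. c) \<in> regular (variety_on X S)" for c
    by (rule regular_variety_on[OF generated_algebra.const])
  ultimately show ?thesis
    unfolding function_algebra_def by (auto simp: variety_on_def)
qed

lemma variety_algebra_product: "variety_algebra (product_variety V W)"
  unfolding product_variety_def by (rule variety_algebra_variety_on)

lemma points_product [simp]: "points (product_variety V W) = points V \<times> points W"
  by (simp add: product_variety_def)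

lemma regular_product_fst:
  "f \<in> regular V \<Longrightarrow> (\<lambda>x\<in>points V \<times> points W. f (fst x)) \<in> regular (product_variety V W)"
  unfolding product_variety_def
  by (rule regular_variety_on, rule generated_algebra.gen) (auto simp: comp_def)

lemma regular_product_snd:
  "f \<in> regular W \<Longrightarrow> (\<lambda>x\<in>points V \<times> points W. f (snd x)) \<in> regular (product_variety V W)"
  unfolding product_variety_def
  by (rule regular_variety_on, rule generated_algebra.gen) (auto simp: comp_def)

lemma morphismI:
  assumes "\<And>x. x \<in> points V \<Longrightarrow> \<phi> x \<in> points W"
    and "\<And>f. f \<in> regular W \<Longrightarrow> (\<lambda>x\<in>points V. f (\<phi> x)) \<in> regular V"
  shows "morphism V W \<phi>"
  using assms by (auto simp: morphism_def comp_def)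

lemma morphism_points: "morphism V W \<phi> \<Longrightarrow> x \<in> points V \<Longrightarrow> \<phi> x \<in> points W"
  by (auto simp: morphism_def)

lemma morphism_regular:
  "morphism V W \<phi> \<Longrightarrow> f \<in> regular W \<Longrightarrow> (\<lambda>x\<in>points V. f (\<phi> x)) \<in> regular V"
  by (auto simp: morphism_def comp_def)

lemma morphism_variety_onI:
  assumes V: "variety_algebra V"
    and \<phi>: "\<And>x. x \<in> points V \<Longrightarrow> \<phi> x \<in> Y"
    and S: "\<And>f. f \<in> S \<Longrightarrow> (\<lambda>x\<in>points V. f (\<phi> x)) \<in> regular V"
  shows "morphism V (variety_on Y S) \<phi>"
proof (rule morphismI)
  fix f assume "f \<in> regular (variety_on Y S)"
  then obtain F where F: "F \<in> generated_algebra S" "f = restrict F Y"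
    by (rule regular_variety_onE)
  have "(\<lambda>x\<in>points V. f (\<phi> x)) = (\<lambda>x\<in>points V. F (\<phi> x))"
    using \<phi> by (auto simp: F(2) intro!: restrict_ext)
  also have "\<dots> \<in> regular V"
    using generated_algebra_subset[OF V F(1), of \<phi> Y] \<phi> S by auto
  finally show "(\<lambda>x\<in>points V. f (\<phi> x)) \<in> regular V" .
qed (use \<phi> in simp)

lemma morphism_productI:
  assumes "variety_algebra V" "morphism V W1 \<phi>1" "morphism V W2 \<phi>2"
  shows "morphism V (product_variety W1 W2) (\<lambda>x. (\<phi>1 x, \<phi>2 x))"
  unfolding product_variety_def
  by (rule morphism_variety_onI[OF assms(1)])
     (auto intro: morphism_points[OF assms(2)] morphism_points[OF assms(3)]
       morphism_regular[OF assms(2)] morphism_regular[OF assms(3)])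

lemma morphism_comp:
  assumes "morphism U V \<phi>" "morphism V W \<psi>"
  shows "morphism U W (\<lambda>x. \<psi> (\<phi> x))"
proof (rule morphismI)
  fix f assume "f \<in> regular W"
  then have "(\<lambda>x\<in>points U. (\<lambda>y\<in>points V. f (\<psi> y)) (\<phi> x)) \<in> regular U"
    by (intro morphism_regular[OF assms(1)] morphism_regular[OF assms(2)])
  also have "(\<lambda>x\<in>points U. (\<lambda>y\<in>points V. f (\<psi> y)) (\<phi> x)) = (\<lambda>x\<in>points U. f (\<psi> (\<phi> x)))"
    by (auto intro!: restrict_ext simp: morphism_points[OF assms(1)])
  finally show "(\<lambda>x\<in>points U. f (\<psi> (\<phi> x))) \<in> regular U" .
qed (auto intro: morphism_points assms)

lemma morphism_fst: "morphism (product_variety V W) V fst"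
  by (rule morphismI) (auto intro: regular_product_fst)

lemma morphism_snd: "morphism (product_variety V W) W snd"
  by (rule morphismI) (auto intro: regular_product_snd)

lemma isomorphic_varietiesI:
  assumes "morphism V W \<phi>" "morphism W V \<psi>"
    and "\<And>x. x \<in> points V \<Longrightarrow> \<psi> (\<phi> x) = x" "\<And>y. y \<in> points W \<Longrightarrow> \<phi> (\<psi> y) = y"
  shows "isomorphic_varieties V W"
  using assms unfolding isomorphic_varieties_def by blast

lemma isomorphic_varieties_trans:
  assumes "isomorphic_varieties U V" "isomorphic_varieties V W"
  shows "isomorphic_varieties U W"
proof -
  obtain \<phi> \<psi> where 1: "morphism U V \<phi>" "morphism V U \<psi>"
    "\<forall>x\<in>points U. \<psi> (\<phi> x) = x" "\<forall>y\<in>points V. \<phi> (\<psi> y) = y"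
    using assms(1) unfolding isomorphic_varieties_def by blast
  obtain \<phi>' \<psi>' where 2: "morphism V W \<phi>'" "morphism W V \<psi>'"
    "\<forall>x\<in>points V. \<psi>' (\<phi>' x) = x" "\<forall>y\<in>points W. \<phi>' (\<psi>' y) = y"
    using assms(2) unfolding isomorphic_varieties_def by blast
  show ?thesis
    by (rule isomorphic_varietiesI[OF morphism_comp[OF 1(1) 2(1)] morphism_comp[OF 2(2) 1(2)]])
       (simp_all add: 1 2 morphism_points[OF 1(1)] morphism_points[OF 2(2)])
qed

lemma isomorphic_product_variety:
  assumes "isomorphic_varieties V W"
  shows "isomorphic_varieties (product_variety V T) (product_variety W T)"
proof -
  obtain \<phi> \<psi> where 1: "morphism V W \<phi>" "morphism W V \<psi>"
    "\<forall>x\<in>points V. \<psi> (\<phi> x) = x" "\<forall>y\<in>points W. \<phi> (\<psi> y) = y"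
    using assms unfolding isomorphic_varieties_def by blast
  have "morphism (product_variety V T) (product_variety W T) (\<lambda>x. (\<phi> (fst x), snd x))"
    by (intro morphism_productI variety_algebra_product morphism_comp[OF morphism_fst 1(1)]
        morphism_snd)
  moreover have "morphism (product_variety W T) (product_variety V T) (\<lambda>x. (\<psi> (fst x), snd x))"
    by (intro morphism_productI variety_algebra_product morphism_comp[OF morphism_fst 1(2)]
        morphism_snd)
  ultimately show ?thesis
    by (rule isomorphic_varietiesI) (use 1 in auto)
qed

section \<open>Products and quotients\<close>

text \<open>The coordinate ring of a product is spanned by products of functions of one variable:
  generators have rank one, and sums and products of finite-rank functions have finite rank.\<close>

lemma regular_product_finite_rank:
  assumes "f \<in> regular (product_variety V W)" "variety_algebra V" "variety_algebra W"
  shows "\<exists>l. set l \<subseteq> regular V \<times> regular W \<and>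
    (\<forall>x\<in>points V. \<forall>y\<in>points W. f (x, y) = (\<Sum>(p, q)\<leftarrow>l. p x * q y))"
proof -
  obtain F where F: "F \<in> generated_algebra
      ({f \<circ> fst |f. f \<in> regular V} \<union> {f \<circ> snd |f. f \<in> regular W})"
    and f: "f = restrict F (points V \<times> points W)"
    using assms(1) unfolding product_variety_def by (rule regular_variety_onE)
  note V = function_algebra_const[OF assms(2)] function_algebra_mult[OF assms(2)]
    function_algebra_restrict[OF assms(2)]
  note W = function_algebra_const[OF assms(3)] function_algebra_mult[OF assms(3)]
    function_algebra_restrict[OF assms(3)]
  have "\<exists>l. set l \<subseteq> regular V \<times> regular W \<and>
    (\<forall>x\<in>points V. \<forall>y\<in>points W. F (x, y) = (\<Sum>(p, q)\<leftarrow>l. p x * q y))"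
    using F
  proof induction
    case (const c)
    show ?case
      by (rule exI[of _ "[(\<lambda>x\<in>points V. c, \<lambda>y\<in>points W. 1)]"]) (simp add: V W)
  next
    case (gen h)
    then consider p where "p \<in> regular V" "h = p \<circ> fst" | q where "q \<in> regular W" "h = q \<circ> snd"
      by blast
    then show ?case
    proof cases
      case 1
      then show ?thesis
        by (intro exI[of _ "[(p, \<lambda>y\<in>points W. 1)]"]) (simp add: W)
    next
      case 2
      then show ?thesis
        by (intro exI[of _ "[(\<lambda>x\<in>points V. 1, q)]"]) (simp add: V)
    qed
  next
    case (add f h)
    then obtain l m where "set l \<subseteq> regular V \<times> regular W" "set m \<subseteq> regular V \<times> regular W"
      "\<forall>x\<in>points V. \<forall>y\<in>points W. f (x, y) = (\<Sum>(p, q)\<leftarrow>l. p x * q y)"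
      "\<forall>x\<in>points V. \<forall>y\<in>points W. h (x, y) = (\<Sum>(p, q)\<leftarrow>m. p x * q y)"
      by blast
    then show ?case by (intro exI[of _ "l @ m"]) simp
  next
    case (mult f h)
    then obtain l m where l: "set l \<subseteq> regular V \<times> regular W" and m: "set m \<subseteq> regular V \<times> regular W"
      and eq: "\<forall>x\<in>points V. \<forall>y\<in>points W. f (x, y) = (\<Sum>(p, q)\<leftarrow>l. p x * q y)"
      "\<forall>x\<in>points V. \<forall>y\<in>points W. h (x, y) = (\<Sum>(p, q)\<leftarrow>m. p x * q y)"
      by blast
    \<comment> \<open>All pairs of terms of the two lists are multiplied factor by factor; by
      distributivity the concatenated list represents the product.\<close>
    define mul where "mul = (\<lambda>(p, q) (p', q').
      ((\<lambda>x\<in>points V. p x * p' x :: complex), (\<lambda>y\<in>points W. q y * q' y :: complex)))"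
    have row: "(\<Sum>(p, q)\<leftarrow>map (mul a) m. p x * q y) = fst a x * snd a y * (\<Sum>(p, q)\<leftarrow>m. p x * q y)"
      if "x \<in> points V" "y \<in> points W" for a x y
      using that by (induction m) (auto simp: mul_def case_prod_unfold algebra_simps)
    have "(\<Sum>(p, q)\<leftarrow>concat (map (\<lambda>a. map (mul a) m) l). p x * q y) =
        (\<Sum>(p, q)\<leftarrow>l. p x * q y) * (\<Sum>(p, q)\<leftarrow>m. p x * q y)"
      if "x \<in> points V" "y \<in> points W" for x y
      using that by (induction l) (auto simp: row algebra_simps simp del: map_map)
    moreover have "set (concat (map (\<lambda>a. map (mul a) m) l)) \<subseteq> regular V \<times> regular W"
      using l m by (fastforce simp: mul_def V W)
    ultimately show ?case
      using eq by (intro exI[of _ "concat (map (\<lambda>a. map (mul a) m) l)"]) simp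
  qed
  then show ?thesis by (simp add: f)
qed

text \<open>
  If \<open>F\<close> has finite rank and a function \<open>q\<^sub>0\<close> from its decomposition does not vanish at \<open>y\<^sub>0\<close>, then
  subtracting \<open>F x y\<^sub>0 * q\<^sub>0 y / q\<^sub>0 y\<^sub>0\<close> eliminates \<open>q\<^sub>0\<close>. Hence the left factors can be taken to be
  combinations of sections \<open>F _ y\<close>.
\<close>

lemma finite_rank_sections:
  assumes I: "function_algebra X I" and Q: "function_algebra Y Q"
    and "set (map snd l) \<subseteq> Q"
    and "\<And>x y. x \<in> X \<Longrightarrow> y \<in> Y \<Longrightarrow> F x y = (\<Sum>(p, q)\<leftarrow>l. p x * q y)"
    and "\<And>y. y \<in> Y \<Longrightarrow> (\<lambda>x\<in>X. F x y) \<in> I"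
  shows "\<exists>l. set l \<subseteq> I \<times> Q \<and> (\<forall>x\<in>X. \<forall>y\<in>Y. F x y = (\<Sum>(p, q)\<leftarrow>l. p x * q y))"
  using assms(3-)
proof (induction "length l" arbitrary: l F)
  case 0
  then show ?case by (intro exI[of _ "[]"]) simp
next
  case (Suc n)
  then obtain p0 q0 l1 where l: "l = (p0, q0) # l1" by (cases l) auto
  have q0: "q0 \<in> Q" and l1: "set (map snd l1) \<subseteq> Q" and n: "n = length l1"
    using Suc.prems(1) Suc.hyps(2) by (auto simp: l)
  note rQ = function_algebra_restrict[OF Q]
  show ?case
  proof (cases "\<exists>y0\<in>Y. q0 y0 \<noteq> 0")
    case False
    then show ?thesis
      by (intro Suc.hyps(1)[OF n l1] Suc.prems(3)) (simp_all add: Suc.prems(2) l)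
  next
    case True
    then obtain y0 where y0: "y0 \<in> Y" "q0 y0 \<noteq> 0" by blast
    define r where "r = (\<lambda>y\<in>Y. inverse (q0 y0) * q0 y)"
    have r: "r \<in> Q" "r y0 = 1"
      using y0 function_algebra_scale[OF Q, of q0] q0 by (simp_all add: r_def rQ)
    define G where "G = (\<lambda>x y. F x y - r y * F x y0)"
    \<comment> \<open>In \<open>G\<close> each \<open>p\<close> gets the coefficient
      \<open>q y - q y0 * r y\<close>. For \<open>q0\<close> it vanishes because
      \<open>q0 y = q0 y0 * r y\<close>, so \<open>G\<close> needs one term less, and its sections
      are still combinations of sections of \<open>F\<close>.\<close>
    define red where "red = (\<lambda>(p :: 'a \<Rightarrow> complex, q). (p, \<lambda>y\<in>Y. q y - q y0 * r y))"
    have "n = length (map red l1)" by (simp add: n)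
    moreover have "set (map snd (map red l1)) \<subseteq> Q"
      using l1 by (fastforce simp: red_def rQ r intro!: function_algebra_diff[OF Q]
          function_algebra_scale[OF Q])
    moreover have "G x y = (\<Sum>(p, q)\<leftarrow>map red l1. p x * q y)" if "x \<in> X" "y \<in> Y" for x y
    proof -
      have "(\<Sum>(p, q)\<leftarrow>map red l1. p x * q y) =
          (\<Sum>(p, q)\<leftarrow>l1. p x * q y) - r y * (\<Sum>(p, q)\<leftarrow>l1. p x * q y0)"
        using that y0 by (induction l1) (auto simp: red_def algebra_simps)
      moreover have "q0 y = q0 y0 * r y" using that y0 by (simp add: r_def)
      ultimately show ?thesis
        using that y0 by (simp add: G_def Suc.prems(2) l algebra_simps)
    qed
    moreover have "(\<lambda>x\<in>X. G x y) \<in> I" if "y \<in> Y" for y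
      unfolding G_def using that y0
      by (intro function_algebra_diff[OF I] function_algebra_scale[OF I] Suc.prems(3))
    ultimately obtain l' where l': "set l' \<subseteq> I \<times> Q"
      "\<forall>x\<in>X. \<forall>y\<in>Y. G x y = (\<Sum>(p, q)\<leftarrow>l'. p x * q y)"
      using Suc.hyps(1) by blast
    have "F x y = (\<Sum>(p, q)\<leftarrow>((\<lambda>x\<in>X. F x y0), r) # l'. p x * q y)" if "x \<in> X" "y \<in> Y" for x y
      using l'(2) that by (simp add: G_def algebra_simps)
    then show ?thesis
      using l'(1) r Suc.prems(3)[OF y0(1)] by (intro exI[of _ "((\<lambda>x\<in>X. F x y0), r) # l'"]) simp
  qed
qed

text \<open>The last clause says that \<open>T\<close> is its own maximal spectrum: characters are
  evaluations, and functions separate points. It has to be imposed because a \<open>variety\<close>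
  is an arbitrary pair of points and functions; it turns characters pulled back to \<open>T\<close>
  into points.\<close>

definition affine_variety :: "'a variety \<Rightarrow> bool" where
  "affine_variety T \<longleftrightarrow> variety_algebra T \<and>
     (\<forall>\<theta> \<in> algebra_characters (points T) (regular T).
        \<exists>!z. z \<in> points T \<and> (\<forall>q \<in> regular T. \<theta> q = q z))"

lemma points_git_quotient [simp]:
  "points (git_quotient G act V) = algebra_characters (points V) (invariants G act V)"
  by (simp add: git_quotient_def Let_def)

lemma regular_git_quotient:
  "regular (git_quotient G act V) = {\<lambda>\<theta>\<in>points (git_quotient G act V). \<theta> f |f. f \<in> invariants G act V}"
  by (simp add: git_quotient_def Let_def)

lemma invariantsI:
  assumes "restrict F (points V) \<in> regular V"
    and "\<And>h x. h \<in> G \<Longrightarrow> x \<in> points V \<Longrightarrow> act h x \<in> points V"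
    and "\<And>h x. h \<in> G \<Longrightarrow> x \<in> points V \<Longrightarrow> F (act h x) = F x"
  shows "restrict F (points V) \<in> invariants G act V"
  using assms by (simp add: invariants_def)

lemma function_algebra_invariants:
  assumes V: "variety_algebra V"
    and act: "\<And>h x. h \<in> G \<Longrightarrow> x \<in> points V \<Longrightarrow> act h x \<in> points V"
  shows "function_algebra (points V) (invariants G act V)"
proof -
  note r = function_algebra_restrict[OF V]
  show ?thesis
    unfolding function_algebra_def
  proof (intro conjI allI ballI)
    show "invariants G act V \<subseteq> extensional (points V)"
      using V by (auto simp: invariants_def function_algebra_def)
  qed (rule invariantsI[OF _ act], rule function_algebra_const[OF V] function_algebra_add[OF V]
      function_algebra_mult[OF V]; simp add: invariants_def r)+
qed

lemma variety_algebra_git_quotient: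
  assumes "variety_algebra V"
    and "\<And>h x. h \<in> G \<Longrightarrow> x \<in> points V \<Longrightarrow> act h x \<in> points V"
  shows "variety_algebra (git_quotient G act V)"
  unfolding regular_git_quotient points_git_quotient
  by (rule function_algebra_evaluations[OF function_algebra_invariants[OF assms]])

lemma morphism_const:
  "variety_algebra V \<Longrightarrow> z \<in> points T \<Longrightarrow> morphism V T (\<lambda>_. z)"
  by (rule morphismI) (simp_all add: function_algebra_const)

lemma morphism_id: "variety_algebra V \<Longrightarrow> morphism V V (\<lambda>x. x)"
  by (rule morphismI) (simp_all add: function_algebra_restrict)

lemma function_algebra_invariants_variety_on:
  "(\<And>h x. h \<in> G \<Longrightarrow> x \<in> X \<Longrightarrow> act h x \<in> X) \<Longrightarrow>
    function_algebra X (invariants G act (variety_on X S))"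
  using function_algebra_invariants[OF variety_algebra_variety_on] by (metis points_variety_on)

text \<open>
  The hypotheses say that, up to replacing points by points of the same orbit, \<open>V\<close> is \<open>W \<times> T\<close> with
  trivial action on \<open>T\<close>.
\<close>

lemma git_quotient_isomorphic_product:
  assumes V: "variety_algebra V" and W: "variety_algebra W" and T: "affine_variety T"
    and actV: "\<And>h x. h \<in> G \<Longrightarrow> x \<in> points V \<Longrightarrow> actV h x \<in> points V"
    and actW: "\<And>h x. h \<in> G \<Longrightarrow> x \<in> points W \<Longrightarrow> actW h x \<in> points W"
    and \<pi>: "morphism V W \<pi>" and \<zeta>: "morphism V T \<zeta>" and s: "morphism (product_variety W T) V s"
    and \<pi>s: "\<And>w z. w \<in> points W \<Longrightarrow> z \<in> points T \<Longrightarrow> \<pi> (s (w, z)) = w"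
    and \<zeta>s: "\<And>w z. w \<in> points W \<Longrightarrow> z \<in> points T \<Longrightarrow> \<zeta> (s (w, z)) = z"
    and \<pi>_act: "\<And>h x. h \<in> G \<Longrightarrow> x \<in> points V \<Longrightarrow> \<pi> (actV h x) = actW h (\<pi> x)"
    and \<zeta>_act: "\<And>h x. h \<in> G \<Longrightarrow> x \<in> points V \<Longrightarrow> \<zeta> (actV h x) = \<zeta> x"
    and orbit: "\<And>x. x \<in> points V \<Longrightarrow> \<exists>h\<in>G. actV h x = s (\<pi> x, \<zeta> x)"
  shows "isomorphic_varieties (product_variety (git_quotient G actW W) T) (git_quotient G actV V)"
proof -
  define RV RW where "RV = invariants G actV V" and "RW = invariants G actW W"
  have RV: "function_algebra (points V) RV" and RW: "function_algebra (points W) RW"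
    unfolding RV_def RW_def using V W actV actW by (auto intro!: function_algebra_invariants)
  have T': "variety_algebra T" using T by (simp add: affine_variety_def)
  note rV = function_algebra_restrict[OF RV] and rW = function_algebra_restrict[OF RW]
    and rT = function_algebra_restrict[OF T']
  have \<pi>p: "\<pi> x \<in> points W" and \<zeta>p: "\<zeta> x \<in> points T" if "x \<in> points V" for x
    using that \<pi> \<zeta> by (auto intro: morphism_points)
  have sp: "s (w, z) \<in> points V" if "w \<in> points W" "z \<in> points T" for w z
    using morphism_points[OF s] that by simp
  \<comment> \<open>The only use of \<open>orbit\<close>. Values of an invariant function are
    compared, so the group element may depend on \<open>x\<close> in any way.\<close>
  have f_s: "f (s (\<pi> x, \<zeta> x)) = f x" if f: "f \<in> RV" and x: "x \<in> points V" for f x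
  proof -
    obtain h where h: "h \<in> G" "actV h x = s (\<pi> x, \<zeta> x)" using orbit[OF x] by blast
    have "f (actV h x) = f x" using f x h(1) by (auto simp: RV_def invariants_def)
    then show ?thesis by (simp add: h(2))
  qed
  \<comment> \<open>The map \<open>s\<close> need not be equivariant. But
    \<open>actV h (s (w, z))\<close> projects to \<open>(actW h w, z)\<close>, hence lies in the
    orbit of \<open>s (actW h w, z)\<close>, and \<open>f\<close> cannot tell the two apart.\<close>
  have sec: "(\<lambda>w\<in>points W. f (s (w, z))) \<in> RW" if f: "f \<in> RV" and z: "z \<in> points T" for f z
    unfolding RW_def
  proof (rule invariantsI[OF _ actW])
    have "morphism W V (\<lambda>w. s (w, z))"
      by (intro morphism_comp[OF _ s] morphism_productI W morphism_id morphism_const z)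
    then show "(\<lambda>w\<in>points W. f (s (w, z))) \<in> regular W"
      by (rule morphism_regular) (use f in \<open>simp add: RV_def invariants_def\<close>)
    fix h w assume h: "h \<in> G" and w: "w \<in> points W"
    have "f (s (actW h w, z)) = f (actV h (s (w, z)))"
      using f_s[OF f actV[OF h sp[OF w z]]] h w z by (simp add: \<pi>_act \<zeta>_act sp \<pi>s \<zeta>s)
    also have "\<dots> = f (s (w, z))"
      using f h sp[OF w z] by (auto simp: RV_def invariants_def)
    finally show "f (s (actW h w, z)) = f (s (w, z))" .
  qed
  have pull\<pi>: "(\<lambda>x\<in>points V. p (\<pi> x)) \<in> RV" if "p \<in> RW" for p
    unfolding RV_def using that
    by (intro invariantsI[OF _ actV])
       (auto simp: RW_def invariants_def \<pi>_act \<pi>p intro: morphism_regular[OF \<pi>])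
  have pull\<zeta>: "(\<lambda>x\<in>points V. q (\<zeta> x)) \<in> RV" if "q \<in> regular T" for q
    unfolding RV_def using that
    by (intro invariantsI[OF _ actV]) (auto simp: \<zeta>_act intro: morphism_regular[OF \<zeta>])
  \<comment> \<open>Finite rank first gives left factors that are merely regular; rewriting them
    through the sections at fixed \<open>z\<close> makes them invariant.\<close>
  have dec: "\<exists>l. set l \<subseteq> RW \<times> regular T \<and>
      (\<forall>w\<in>points W. \<forall>z\<in>points T. f (s (w, z)) = (\<Sum>(p, q)\<leftarrow>l. p w * q z))" if f: "f \<in> RV" for f
  proof -
    have "(\<lambda>x\<in>points (product_variety W T). f (s x)) \<in> regular (product_variety W T)"
      by (rule morphism_regular[OF s]) (use f in \<open>simp add: RV_def invariants_def\<close>)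
    from regular_product_finite_rank[OF this W T'] obtain l where
      l: "set l \<subseteq> regular W \<times> regular T"
        "\<forall>w\<in>points W. \<forall>z\<in>points T. f (s (w, z)) = (\<Sum>(p, q)\<leftarrow>l. p w * q z)"
      by auto
    show ?thesis
      by (rule finite_rank_sections[OF RW T', of l]) (use l sec[OF f] in auto)
  qed
  define PV PW where "PV = algebra_characters (points V) RV" and "PW = algebra_characters (points W) RW"
  \<comment> \<open>\<open>\<phi>\<close> pulls back along \<open>s\<close> with \<open>z\<close>
    held fixed. In the other direction a character is pulled back along \<open>\<pi>\<close> and
    along \<open>\<zeta>\<close>, and \<open>zz\<close> names the point of \<open>T\<close> that
    represents the second pullback.\<close>
  define \<phi> where "\<phi> = (\<lambda>(\<theta> :: ('b \<Rightarrow> complex) \<Rightarrow> complex, z). \<lambda>f\<in>RV. \<theta> (\<lambda>w\<in>points W. f (s (w, z))))"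
  define zz where "zz = (\<lambda>\<Theta> :: ('a \<Rightarrow> complex) \<Rightarrow> complex. THE z. z \<in> points T \<and> (\<forall>q\<in>regular T. \<Theta> (\<lambda>x\<in>points V. q (\<zeta> x)) = q z))"
  define \<psi>1 where "\<psi>1 = (\<lambda>\<Theta> :: ('a \<Rightarrow> complex) \<Rightarrow> complex. \<lambda>p\<in>RW. \<Theta> (\<lambda>x\<in>points V. p (\<pi> x)))"
  have \<phi>p: "\<phi> (\<theta>, z) \<in> PV" if "\<theta> \<in> PW" "z \<in> points T" for \<theta> z
    unfolding \<phi>_def PV_def prod.case
    by (rule character_pullback[OF RV RW]) (use that sec sp in \<open>auto simp: PW_def\<close>)
  have \<psi>1p: "\<psi>1 \<Theta> \<in> PW" if "\<Theta> \<in> PV" for \<Theta>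
    unfolding \<psi>1_def PW_def
    by (rule character_pullback[OF RW RV]) (use that pull\<pi> \<pi>p in \<open>auto simp: PV_def\<close>)
  have ex1: "\<exists>!z. z \<in> points T \<and> (\<forall>q\<in>regular T. \<Theta> (\<lambda>x\<in>points V. q (\<zeta> x)) = q z)"
    if "\<Theta> \<in> PV" for \<Theta>
  proof -
    have "(\<lambda>q\<in>regular T. \<Theta> (\<lambda>x\<in>points V. q (\<zeta> x))) \<in> algebra_characters (points T) (regular T)"
      by (rule character_pullback[OF T' RV]) (use that pull\<zeta> \<zeta>p in \<open>auto simp: PV_def\<close>)
    then show ?thesis using T unfolding affine_variety_def by fastforce
  qed
  have zz: "zz \<Theta> \<in> points T" "q \<in> regular T \<Longrightarrow> \<Theta> (\<lambda>x\<in>points V. q (\<zeta> x)) = q (zz \<Theta>)"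
    if "\<Theta> \<in> PV" for \<Theta> q
    using theI'[OF ex1[OF that]] by (auto simp: zz_def)
  have zz_eq: "zz \<Theta> = z" if "\<Theta> \<in> PV" "z \<in> points T"
    "\<And>q. q \<in> regular T \<Longrightarrow> \<Theta> (\<lambda>x\<in>points V. q (\<zeta> x)) = q z" for \<Theta> z
    using ex1[OF that(1)] zz[OF that(1)] that(2,3) by blast
  \<comment> \<open>A decomposition of \<open>f\<close> splits the value into functions of
    \<open>\<theta>\<close> alone times functions of \<open>z\<close> alone, which is what makes
    \<open>\<phi>\<close> a morphism on the product.\<close>
  have \<phi>_sum: "\<phi> (\<theta>, z) f = (\<Sum>(p, q)\<leftarrow>l. \<theta> p * q z)"
    if "\<theta> \<in> PW" "z \<in> points T" "f \<in> RV" "set l \<subseteq> RW \<times> regular T"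
      "\<forall>w\<in>points W. \<forall>z\<in>points T. f (s (w, z)) = (\<Sum>(p, q)\<leftarrow>l. p w * q z)" for \<theta> z f l
  proof -
    have \<theta>: "\<theta> \<in> algebra_characters (points W) RW" using that by (simp add: PW_def)
    have "(\<lambda>w\<in>points W. f (s (w, z))) = (\<lambda>w\<in>points W. \<Sum>a\<leftarrow>l. snd a z * fst a w)"
      using that by (auto intro!: restrict_ext simp: case_prod_unfold mult.commute)
    then have "\<phi> (\<theta>, z) f = \<theta> (\<lambda>w\<in>points W. \<Sum>a\<leftarrow>l. snd a z * fst a w)"
      using that by (simp add: \<phi>_def)
    also have "\<dots> = (\<Sum>a\<leftarrow>l. \<theta> (\<lambda>w\<in>points W. snd a z * fst a w))"
      by (rule character_sum_list[OF RW \<theta>], rule function_algebra_scale[OF RW])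
         (use that in \<open>auto simp: rW\<close>)
    also have "\<dots> = (\<Sum>a\<leftarrow>l. \<theta> (fst a) * snd a z)"
    proof (rule arg_cong[where f = sum_list], rule map_cong[OF refl])
      fix a assume "a \<in> set l"
      then have a: "fst a \<in> RW" using that by auto
      then show "\<theta> (\<lambda>w\<in>points W. snd a z * fst a w) = \<theta> (fst a) * snd a z"
        using character_mult[OF RW \<theta> function_algebra_const[OF RW], of "fst a" "snd a z"]
        by (simp add: rW character_const[OF RW \<theta>])
    qed
    finally show ?thesis by (simp add: case_prod_unfold)
  qed
  have pV: "points (git_quotient G actV V) = PV" and pW: "points (git_quotient G actW W) = PW"
    by (simp_all add: PV_def PW_def RV_def RW_def)
  have gW: "variety_algebra (git_quotient G actW W)"
    by (rule variety_algebra_git_quotient[OF W actW])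
  have gV: "variety_algebra (git_quotient G actV V)"
    by (rule variety_algebra_git_quotient[OF V actV])
  have regV: "\<exists>f\<in>RV. F = (\<lambda>\<theta>\<in>PV. \<theta> f)" if "F \<in> regular (git_quotient G actV V)" for F
    using that unfolding regular_git_quotient pV RV_def by auto
  have regW: "\<exists>f\<in>RW. F = (\<lambda>\<theta>\<in>PW. \<theta> f)" if "F \<in> regular (git_quotient G actW W)" for F
    using that unfolding regular_git_quotient pW RW_def by auto
  have regVI: "(\<lambda>\<theta>\<in>PV. \<theta> f) \<in> regular (git_quotient G actV V)" if "f \<in> RV" for f
    using that unfolding regular_git_quotient pV RV_def by auto
  have regWI: "(\<lambda>\<theta>\<in>PW. \<theta> f) \<in> regular (git_quotient G actW W)" if "f \<in> RW" for f
    using that unfolding regular_git_quotient pW RW_def by auto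
  let ?P = "product_variety (git_quotient G actW W) T"
  show ?thesis
  proof (rule isomorphic_varietiesI)
    show "morphism ?P (git_quotient G actV V) \<phi>"
    proof (rule morphismI)
      fix x assume "x \<in> points ?P"
      then show "\<phi> x \<in> points (git_quotient G actV V)"
        unfolding points_product pV pW by (auto intro: \<phi>p)
    next
      fix F assume "F \<in> regular (git_quotient G actV V)"
      then obtain f where f: "f \<in> RV" and F: "F = (\<lambda>\<theta>\<in>PV. \<theta> f)" using regV by blast
      obtain l where l: "set l \<subseteq> RW \<times> regular T"
        "\<forall>w\<in>points W. \<forall>z\<in>points T. f (s (w, z)) = (\<Sum>(p, q)\<leftarrow>l. p w * q z)"
        using dec[OF f] by blast
      have "(\<lambda>x\<in>points ?P. F (\<phi> x)) = (\<lambda>x\<in>points ?P. \<Sum>a\<leftarrow>l. (\<lambda>\<theta>\<in>PW. \<theta> (fst a)) (fst x) * snd a (snd x))"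
        unfolding points_product pV pW
        by (rule restrict_ext) (auto simp: F \<phi>p \<phi>_sum[OF _ _ f l] case_prod_unfold)
      also have "\<dots> \<in> regular ?P"
      proof (rule function_algebra_sum_list[OF variety_algebra_product],
          rule function_algebra_mult[OF variety_algebra_product])
        fix a assume "a \<in> set l"
        then have a: "fst a \<in> RW" "snd a \<in> regular T" using l(1) by auto
        show "(\<lambda>x\<in>points ?P. (\<lambda>\<theta>\<in>PW. \<theta> (fst a)) (fst x)) \<in> regular ?P"
          by (rule morphism_regular[OF morphism_fst regWI[OF a(1)]])
        show "(\<lambda>x\<in>points ?P. snd a (snd x)) \<in> regular ?P"
          by (rule morphism_regular[OF morphism_snd a(2)])
      qed
      finally show "(\<lambda>x\<in>points ?P. F (\<phi> x)) \<in> regular ?P" .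
    qed
    show "morphism (git_quotient G actV V) ?P (\<lambda>\<Theta>. (\<psi>1 \<Theta>, zz \<Theta>))"
    proof (rule morphism_productI[OF gV]; rule morphismI)
      fix \<Theta> assume "\<Theta> \<in> points (git_quotient G actV V)"
      then have "\<Theta> \<in> PV" by (simp only: pV)
      then show "\<psi>1 \<Theta> \<in> points (git_quotient G actW W)" "zz \<Theta> \<in> points T"
        unfolding pW by (auto intro: \<psi>1p zz)
    next
      fix F assume "F \<in> regular (git_quotient G actW W)"
      then obtain p where p: "p \<in> RW" and F: "F = (\<lambda>\<theta>\<in>PW. \<theta> p)" using regW by blast
      have "(\<lambda>x\<in>PV. F (\<psi>1 x)) = (\<lambda>\<Theta>\<in>PV. \<Theta> (\<lambda>x\<in>points V. p (\<pi> x)))"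
        by (rule restrict_ext) (simp add: F \<psi>1p, simp add: \<psi>1_def p)
      then show "(\<lambda>x\<in>points (git_quotient G actV V). F (\<psi>1 x)) \<in> regular (git_quotient G actV V)"
        unfolding pV using regVI[OF pull\<pi>[OF p]] by simp
    next
      fix q assume q: "q \<in> regular T"
      have "(\<lambda>x\<in>PV. q (zz x)) = (\<lambda>\<Theta>\<in>PV. \<Theta> (\<lambda>x\<in>points V. q (\<zeta> x)))"
        by (rule restrict_ext) (simp add: zz q)
      then show "(\<lambda>x\<in>points (git_quotient G actV V). q (zz x)) \<in> regular (git_quotient G actV V)"
        unfolding pV using regVI[OF pull\<zeta>[OF q]] by simp
    qed
  next
    fix x assume "x \<in> points ?P"
    then obtain \<theta> z where x: "x = (\<theta>, z)" and \<theta>: "\<theta> \<in> PW" and z: "z \<in> points T"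
      unfolding points_product pW by auto
    have \<theta>': "\<theta> \<in> algebra_characters (points W) RW" using \<theta> by (simp add: PW_def)
    have "\<psi>1 (\<phi> (\<theta>, z)) = \<theta>"
    proof (rule extensionalityI[of _ RW])
      show "\<theta> \<in> extensional RW" by (rule character_extensional[OF \<theta>'])
      fix p assume p: "p \<in> RW"
      have "\<psi>1 (\<phi> (\<theta>, z)) p = \<theta> (\<lambda>w\<in>points W. (\<lambda>x\<in>points V. p (\<pi> x)) (s (w, z)))"
        by (simp add: \<psi>1_def \<phi>_def p pull\<pi>)
      also have "(\<lambda>w\<in>points W. (\<lambda>x\<in>points V. p (\<pi> x)) (s (w, z))) = restrict p (points W)"
        by (rule restrict_ext) (simp add: sp z \<pi>s)
      finally show "\<psi>1 (\<phi> (\<theta>, z)) p = \<theta> p" by (simp add: rW p)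
    qed (simp add: \<psi>1_def)
    moreover have "zz (\<phi> (\<theta>, z)) = z"
    proof (rule zz_eq[OF \<phi>p[OF \<theta> z] z])
      fix q assume q: "q \<in> regular T"
      have "\<phi> (\<theta>, z) (\<lambda>x\<in>points V. q (\<zeta> x)) = \<theta> (\<lambda>w\<in>points W. (\<lambda>x\<in>points V. q (\<zeta> x)) (s (w, z)))"
        by (simp add: \<phi>_def pull\<zeta> q)
      also have "(\<lambda>w\<in>points W. (\<lambda>x\<in>points V. q (\<zeta> x)) (s (w, z))) = (\<lambda>w\<in>points W. q z)"
        by (rule restrict_ext) (simp add: sp z \<zeta>s)
      also have "\<theta> \<dots> = q z" by (rule character_const[OF RW \<theta>'])
      finally show "\<phi> (\<theta>, z) (\<lambda>x\<in>points V. q (\<zeta> x)) = q z" .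
    qed
    ultimately show "(\<psi>1 (\<phi> x), zz (\<phi> x)) = x" by (simp add: x)
  next
    fix \<Theta> assume "\<Theta> \<in> points (git_quotient G actV V)"
    then have \<Theta>: "\<Theta> \<in> PV" by (simp only: pV)
    then have \<Theta>': "\<Theta> \<in> algebra_characters (points V) RV" by (simp add: PV_def)
    \<comment> \<open>By \<open>dec\<close> and \<open>f_s\<close> every invariant is a sum of
      products of functions pulled back along \<open>\<pi>\<close> and \<open>\<zeta>\<close>, so
      \<open>\<Theta>\<close> is determined by its values on those.\<close>
    show "\<phi> (\<psi>1 \<Theta>, zz \<Theta>) = \<Theta>"
    proof (rule extensionalityI[of _ RV])
      show "\<Theta> \<in> extensional RV" by (rule character_extensional[OF \<Theta>'])
      fix f assume f: "f \<in> RV"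
      obtain l where l: "set l \<subseteq> RW \<times> regular T"
        "\<forall>w\<in>points W. \<forall>z\<in>points T. f (s (w, z)) = (\<Sum>(p, q)\<leftarrow>l. p w * q z)"
        using dec[OF f] by blast
      have "\<phi> (\<psi>1 \<Theta>, zz \<Theta>) f = (\<Sum>a\<leftarrow>l. \<psi>1 \<Theta> (fst a) * snd a (zz \<Theta>))"
        using \<phi>_sum[OF \<psi>1p[OF \<Theta>] zz(1)[OF \<Theta>] f l] by (simp add: case_prod_unfold)
      also have "\<dots> = (\<Sum>a\<leftarrow>l. \<Theta> (\<lambda>x\<in>points V. fst a (\<pi> x) * snd a (\<zeta> x)))"
      proof (rule arg_cong[where f = sum_list], rule map_cong[OF refl])
        fix a assume "a \<in> set l"
        then have a: "fst a \<in> RW" "snd a \<in> regular T" using l(1) by auto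
        show "\<psi>1 \<Theta> (fst a) * snd a (zz \<Theta>) = \<Theta> (\<lambda>x\<in>points V. fst a (\<pi> x) * snd a (\<zeta> x))"
          using character_mult[OF RV \<Theta>' pull\<pi>[OF a(1)] pull\<zeta>[OF a(2)]] a zz(2)[OF \<Theta> a(2)]
          by (simp add: \<psi>1_def)
      qed
      also have "\<dots> = \<Theta> (\<lambda>x\<in>points V. \<Sum>a\<leftarrow>l. fst a (\<pi> x) * snd a (\<zeta> x))"
        by (rule character_sum_list[OF RV \<Theta>', symmetric], rule function_algebra_mult[OF RV])
           (use l(1) in \<open>auto intro!: pull\<pi> pull\<zeta>\<close>)
      also have "(\<lambda>x\<in>points V. \<Sum>a\<leftarrow>l. fst a (\<pi> x) * snd a (\<zeta> x)) = restrict f (points V)"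
        using l(2) \<pi>p \<zeta>p f_s[OF f] by (intro restrict_ext) (simp add: case_prod_unfold)
      finally show "\<phi> (\<psi>1 \<Theta>, zz \<Theta>) f = \<Theta> f" by (simp add: rV f)
    qed (simp add: \<phi>_def)
  qed
qed

section \<open>Quotients of invariant open and closed pieces\<close>

text \<open>The indicator of \<open>X1\<close> is an idempotent e of \<open>R\<close>. Extension by
  zero identifies \<open>R1\<close> with the ideal e \<open>R\<close>, and restriction followed by
  extension is multiplication by e. A character with value 1 on e therefore induces a character of
  \<open>R1\<close>.\<close>

lemma git_quotient_clopen_component:
  fixes X1 X :: "'a set" and e :: "'a \<Rightarrow> complex"
  assumes acts: "\<forall>h\<in>G. \<forall>x\<in>X. act h x \<in> X \<and> (act h x \<in> X1 \<longleftrightarrow> x \<in> X1)"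
    and sub: "X1 \<subseteq> X" and e: "(\<lambda>x\<in>X. of_bool (x \<in> X1)) \<in> regular (variety_on X S)"
  defines "R \<equiv> invariants G act (variety_on X S)" and "R1 \<equiv> invariants G act (variety_on X1 S)"
  defines "ext0 \<equiv> \<lambda>p. \<lambda>x\<in>X. if x \<in> X1 then p x else 0"
  shows "(\<lambda>x\<in>X. of_bool (x \<in> X1)) \<in> R"
    and "\<And>f. f \<in> R \<Longrightarrow> restrict f X1 \<in> R1"
    and "\<And>p. p \<in> R1 \<Longrightarrow> ext0 p \<in> R"
    and "\<And>\<Theta>. \<Theta> \<in> algebra_characters X R \<Longrightarrow> \<Theta> (\<lambda>x\<in>X. of_bool (x \<in> X1)) = 1 \<Longrightarrow>
      (\<lambda>p\<in>R1. \<Theta> (ext0 p)) \<in> algebra_characters X1 R1"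
    and "\<And>\<Theta> f. \<Theta> \<in> algebra_characters X R \<Longrightarrow> f \<in> R \<Longrightarrow>
      \<Theta> (ext0 (restrict f X1)) = \<Theta> (\<lambda>x\<in>X. of_bool (x \<in> X1)) * \<Theta> f"
    and "\<And>\<Theta> p. \<Theta> \<in> algebra_characters X R \<Longrightarrow> p \<in> R1 \<Longrightarrow>
      \<Theta> (ext0 p) = \<Theta> (\<lambda>x\<in>X. of_bool (x \<in> X1)) * \<Theta> (ext0 p)"
proof -
  let ?e = "\<lambda>x\<in>X. of_bool (x \<in> X1) :: complex"
  have act: "act h x \<in> X" and act1: "act h x \<in> X1 \<longleftrightarrow> x \<in> X1" if "h \<in> G" "x \<in> X" for h x
    using acts that by blast+
  have act1': "act h x \<in> X1" if "h \<in> G" "x \<in> X1" for h x using act1 sub that by blast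
  have W: "function_algebra X (regular (variety_on X S))"
    using variety_algebra_variety_on[of X S] by simp
  have R: "function_algebra X R"
    unfolding R_def by (rule function_algebra_invariants_variety_on) (rule act)
  have R1: "function_algebra X1 R1"
    unfolding R1_def by (rule function_algebra_invariants_variety_on) (rule act1')
  note rR = function_algebra_restrict[OF R] and rR1 = function_algebra_restrict[OF R1]
  show eR: "?e \<in> R"
    using invariantsI[where F = "\<lambda>x. of_bool (x \<in> X1)" and V = "variety_on X S" and G = G and act = act] e act act1
    by (simp add: R_def)
  show res: "restrict f X1 \<in> R1" if f: "f \<in> R" for f
  proof -
    obtain F where F: "F \<in> generated_algebra S" "f = restrict F X"
      using f unfolding R_def invariants_def by (auto elim: regular_variety_onE)
    have "restrict f X1 = restrict F X1"
      using sub by (simp add: F(2) Int_absorb1)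
    then have "restrict f X1 \<in> regular (variety_on X1 S)"
      using regular_variety_on[OF F(1)] by simp
    then show ?thesis
      using invariantsI[where F = f and V = "variety_on X1 S" and G = G and act = act] f act1' sub
      by (auto simp: R1_def R_def invariants_def)
  qed
  show extR: "ext0 p \<in> R" if p: "p \<in> R1" for p
  proof -
    obtain F where F: "F \<in> generated_algebra S" "p = restrict F X1"
      using p unfolding R1_def invariants_def by (auto elim: regular_variety_onE)
    \<comment> \<open>\<open>F\<close> is built from the generators \<open>S\<close> common to both
      varieties, so it is defined on all of \<open>X\<close> and its product with the indicator is
      regular there.\<close>
    have "ext0 p = (\<lambda>x\<in>X. of_bool (x \<in> X1) * F x)"
      by (auto simp: ext0_def F(2) intro!: restrict_ext)
    also have "\<dots> \<in> regular (variety_on X S)"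
      by (rule function_algebra_mult[OF W e regular_variety_on[OF F(1)]])
    finally show ?thesis
      using invariantsI[where F = "\<lambda>x. if x \<in> X1 then p x else 0" and V = "variety_on X S" and G = G and act = act] p act act1
      by (auto simp: R_def R1_def invariants_def ext0_def)
  qed
  have split: "\<Theta> (ext0 f) = \<Theta> ?e * \<Theta> h"
    if "\<Theta> \<in> algebra_characters X R" "h \<in> R" "\<And>x. x \<in> X1 \<Longrightarrow> f x = h x" for \<Theta> f h
  proof -
    have "ext0 f = (\<lambda>x\<in>X. of_bool (x \<in> X1) * h x)"
      using that sub by (auto simp: ext0_def intro!: restrict_ext)
    then show ?thesis
      using character_mult[OF R that(1) eR, of h] that(2) by (simp add: rR)
  qed
  show "\<Theta> (ext0 (restrict f X1)) = \<Theta> ?e * \<Theta> f"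
    if "\<Theta> \<in> algebra_characters X R" "f \<in> R" for \<Theta> f
    using that by (intro split) auto
  show "\<Theta> (ext0 p) = \<Theta> ?e * \<Theta> (ext0 p)" if "\<Theta> \<in> algebra_characters X R" "p \<in> R1" for \<Theta> p
    using that sub by (intro split extR) (auto simp: ext0_def)
  show "(\<lambda>p\<in>R1. \<Theta> (ext0 p)) \<in> algebra_characters X1 R1"
    if \<Theta>: "\<Theta> \<in> algebra_characters X R" and 1: "\<Theta> ?e = 1" for \<Theta>
  proof -
    have "\<Theta> (ext0 (\<lambda>x\<in>X1. c)) = c" for c
    proof -
      have "\<Theta> (ext0 (\<lambda>x\<in>X1. c)) = \<Theta> ?e * \<Theta> (\<lambda>x\<in>X. c)"
        by (rule split[OF \<Theta> function_algebra_const[OF R]]) (use sub in auto)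
      also have "\<dots> = c" by (simp only: 1 character_const[OF R \<Theta>] mult_1)
      finally show ?thesis .
    qed
    moreover have "\<Theta> (ext0 (\<lambda>x\<in>X1. f x + h x)) = \<Theta> (ext0 f) + \<Theta> (ext0 h)"
      if "f \<in> R1" "h \<in> R1" for f h
    proof -
      have "\<Theta> (ext0 (\<lambda>x\<in>X1. f x + h x)) = \<Theta> (\<lambda>x\<in>X. ext0 f x + ext0 h x)"
        by (rule arg_cong[where f = \<Theta>]) (auto simp: ext0_def intro!: restrict_ext)
      then show ?thesis
        using character_add[OF R \<Theta>, of "ext0 f" "ext0 h"] that by (simp add: extR rR)
    qed
    moreover have "\<Theta> (ext0 (\<lambda>x\<in>X1. f x * h x)) = \<Theta> (ext0 f) * \<Theta> (ext0 h)"
      if "f \<in> R1" "h \<in> R1" for f h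
    proof -
      have "\<Theta> (ext0 (\<lambda>x\<in>X1. f x * h x)) = \<Theta> (\<lambda>x\<in>X. ext0 f x * ext0 h x)"
        by (rule arg_cong[where f = \<Theta>]) (auto simp: ext0_def intro!: restrict_ext)
      then show ?thesis
        using character_mult[OF R \<Theta>, of "ext0 f" "ext0 h"] that by (simp add: extR rR)
    qed
    ultimately show ?thesis
      unfolding algebra_characters_def
      using function_algebra_add[OF R1] function_algebra_mult[OF R1]
      by (simp add: function_algebra_const[OF R1] rR1)
  qed
qed

text \<open>Each character sends the idempotent \<open>e1\<close> to 0 or 1, and
  \<open>e2 = 1 - e1\<close> to the other value; this decides which of the two quotients it belongs
  to.\<close>

lemma git_quotient_clopen_decomposition:
  fixes X1 X2 :: "'a set"
  assumes act1: "\<And>h x. h \<in> G \<Longrightarrow> x \<in> X1 \<Longrightarrow> act h x \<in> X1"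
    and act2: "\<And>h x. h \<in> G \<Longrightarrow> x \<in> X2 \<Longrightarrow> act h x \<in> X2"
    and disj: "X1 \<inter> X2 = {}"
    and e: "(\<lambda>x\<in>X1 \<union> X2. of_bool (x \<in> X1)) \<in> regular (variety_on (X1 \<union> X2) S)"
  shows "isomorphic_varieties
    (disjoint_union (git_quotient G act (variety_on X1 S)) (git_quotient G act (variety_on X2 S)))
    (git_quotient G act (variety_on (X1 \<union> X2) S))"
proof -
  let ?X = "X1 \<union> X2"
  define R R1 R2 where "R = invariants G act (variety_on ?X S)"
    and "R1 = invariants G act (variety_on X1 S)" and "R2 = invariants G act (variety_on X2 S)"
  define e1 e2 where "e1 = (\<lambda>x\<in>?X. of_bool (x \<in> X1) :: complex)"
    and "e2 = (\<lambda>x\<in>?X. of_bool (x \<in> X2) :: complex)"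
  define E1 where "E1 p = (\<lambda>x\<in>?X. if x \<in> X1 then p x else (0 :: complex))" for p
  define E2 where "E2 p = (\<lambda>x\<in>?X. if x \<in> X2 then p x else (0 :: complex))" for p
  define P P1 P2 where "P = algebra_characters ?X R"
    and "P1 = algebra_characters X1 R1" and "P2 = algebra_characters X2 R2"
  have W: "function_algebra ?X (regular (variety_on ?X S))"
    using variety_algebra_variety_on[of ?X S] by simp
  have e2_eq: "e2 = (\<lambda>x\<in>?X. 1 - of_bool (x \<in> X1))"
    using disj by (auto simp: e2_def intro!: restrict_ext)
  have "e2 \<in> regular (variety_on ?X S)"
    unfolding e2_eq by (rule function_algebra_diff[OF W function_algebra_const[OF W] e])
  then have e': "(\<lambda>x\<in>?X. of_bool (x \<in> X2)) \<in> regular (variety_on ?X S)"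
    by (simp add: e2_def)
  have acts: "\<forall>h\<in>G. \<forall>x\<in>?X. act h x \<in> ?X \<and> (act h x \<in> X1 \<longleftrightarrow> x \<in> X1)"
    "\<forall>h\<in>G. \<forall>x\<in>?X. act h x \<in> ?X \<and> (act h x \<in> X2 \<longleftrightarrow> x \<in> X2)"
    using act1 act2 disj by blast+
  then have act: "act h x \<in> ?X" if "h \<in> G" "x \<in> ?X" for h x
    using that by blast
  note c1 = git_quotient_clopen_component[where S = S, OF acts(1) Un_upper1 e,
      folded R_def R1_def e1_def E1_def, folded P_def P1_def]
  note c2 = git_quotient_clopen_component[where S = S, OF acts(2) Un_upper2 e',
      folded R_def R2_def e2_def E2_def, folded P_def P2_def]
  have R: "function_algebra ?X R"
    unfolding R_def by (rule function_algebra_invariants_variety_on) (rule act)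
  have R1: "function_algebra X1 R1"
    unfolding R1_def by (rule function_algebra_invariants_variety_on) (rule act1)
  have R2: "function_algebra X2 R2"
    unfolding R2_def by (rule function_algebra_invariants_variety_on) (rule act2)
  note rR = function_algebra_restrict[OF R] and rR1 = function_algebra_restrict[OF R1]
    and rR2 = function_algebra_restrict[OF R2]
  have re1: "restrict e1 ?X = e1" by (rule rR[OF c1(1)])
  have alt: "(\<Theta> e1 = 1 \<and> \<Theta> e2 = 0) \<or> (\<Theta> e1 = 0 \<and> \<Theta> e2 = 1)" if "\<Theta> \<in> P" for \<Theta>
  proof -
    have \<Theta>: "\<Theta> \<in> algebra_characters ?X R" using that by (simp add: P_def)
    have "\<Theta> e2 = \<Theta> (\<lambda>x\<in>?X. 1 + (-1) * e1 x)"
      unfolding e2_eq by (rule arg_cong[where f = \<Theta>]) (auto simp: e1_def intro!: restrict_ext)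
    also have "\<dots> = \<Theta> (\<lambda>x\<in>?X. 1) + \<Theta> (\<lambda>x\<in>?X. (-1) * e1 x)"
      by (rule character_add[OF R \<Theta> function_algebra_const[OF R] function_algebra_scale[OF R]])
         (use c1(1) in \<open>simp only: rR\<close>)
    also have "\<Theta> (\<lambda>x\<in>?X. (-1) * e1 x) = \<Theta> (\<lambda>x\<in>?X. -1) * \<Theta> (restrict e1 ?X)"
      by (rule character_mult[OF R \<Theta> function_algebra_const[OF R]])
         (use c1(1) in \<open>simp only: rR\<close>)
    finally have "\<Theta> e2 = 1 - \<Theta> e1"
      by (simp only: character_const[OF R \<Theta>] re1) simp
    moreover have "\<Theta> e1 = \<Theta> (\<lambda>x\<in>?X. e1 x * e1 x)"
      by (rule arg_cong[where f = \<Theta>]) (auto simp: e1_def intro!: restrict_ext)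
    then have "\<Theta> e1 = \<Theta> e1 * \<Theta> e1"
      using character_mult[OF R \<Theta>, of e1 e1] c1(1) by (simp only: re1)
    ultimately show ?thesis by (auto simp: algebra_simps)
  qed
  define \<phi> where "\<phi> = case_sum (\<lambda>\<theta> :: ('a \<Rightarrow> complex) \<Rightarrow> complex. \<lambda>f\<in>R. \<theta> (restrict f X1)) (\<lambda>\<theta>. \<lambda>f\<in>R. \<theta> (restrict f X2))"
  define \<psi> where "\<psi> = (\<lambda>\<Theta> :: ('a \<Rightarrow> complex) \<Rightarrow> complex. if \<Theta> e1 = 1 then Inl (\<lambda>p\<in>R1. \<Theta> (E1 p)) else Inr (\<lambda>p\<in>R2. \<Theta> (E2 p)))"
  have \<phi>l: "\<phi> (Inl \<theta>) \<in> P" if "\<theta> \<in> P1" for \<theta>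
    unfolding \<phi>_def P_def sum.case
    using character_pullback[OF R R1, of \<theta> "\<lambda>x. x"] that c1(2) by (auto simp: P1_def)
  have \<phi>r: "\<phi> (Inr \<theta>) \<in> P" if "\<theta> \<in> P2" for \<theta>
    unfolding \<phi>_def P_def sum.case
    using character_pullback[OF R R2, of \<theta> "\<lambda>x. x"] that c2(2) by (auto simp: P2_def)
  let ?Q = "git_quotient G act (variety_on ?X S)"
  let ?Q1 = "git_quotient G act (variety_on X1 S)" and ?Q2 = "git_quotient G act (variety_on X2 S)"
  have pQ: "points ?Q = P" "points ?Q1 = P1" "points ?Q2 = P2"
    by (simp_all add: P_def P1_def P2_def R_def R1_def R2_def)
  have rQ: "regular ?Q = {\<lambda>\<theta>\<in>P. \<theta> f |f. f \<in> R}" "regular ?Q1 = {\<lambda>\<theta>\<in>P1. \<theta> f |f. f \<in> R1}"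
    "regular ?Q2 = {\<lambda>\<theta>\<in>P2. \<theta> f |f. f \<in> R2}"
    unfolding regular_git_quotient pQ R_def R1_def R2_def by (rule refl)+
  have D: "points (disjoint_union ?Q1 ?Q2) = P1 <+> P2"
    "regular (disjoint_union ?Q1 ?Q2) = {f \<in> extensional (P1 <+> P2).
        restrict (f \<circ> Inl) P1 \<in> regular ?Q1 \<and> restrict (f \<circ> Inr) P2 \<in> regular ?Q2}"
    by (simp_all only: disjoint_union_def pQ variety.simps)
  show ?thesis
  proof (rule isomorphic_varietiesI)
    show "morphism (disjoint_union ?Q1 ?Q2) ?Q \<phi>"
    proof (rule morphismI)
      fix x assume "x \<in> points (disjoint_union ?Q1 ?Q2)"
      then show "\<phi> x \<in> points ?Q" unfolding D pQ using \<phi>l \<phi>r by auto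
    next
      fix F assume "F \<in> regular ?Q"
      then obtain f where f: "f \<in> R" and F: "F = (\<lambda>\<theta>\<in>P. \<theta> f)" unfolding rQ by blast
      let ?h = "\<lambda>x\<in>P1 <+> P2. F (\<phi> x)"
      have "restrict (?h \<circ> Inl) P1 = (\<lambda>\<theta>\<in>P1. \<theta> (restrict f X1))"
        by (rule restrict_ext) (simp add: F \<phi>l InlI, simp add: \<phi>_def f)
      moreover have "restrict (?h \<circ> Inr) P2 = (\<lambda>\<theta>\<in>P2. \<theta> (restrict f X2))"
        by (rule restrict_ext) (simp add: F \<phi>r InrI, simp add: \<phi>_def f)
      ultimately show "(\<lambda>x\<in>points (disjoint_union ?Q1 ?Q2). F (\<phi> x)) \<in> regular (disjoint_union ?Q1 ?Q2)"
        unfolding D rQ using c1(2)[OF f] c2(2)[OF f] by auto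
    qed
    show "morphism ?Q (disjoint_union ?Q1 ?Q2) \<psi>"
    proof (rule morphismI)
      fix \<Theta> assume "\<Theta> \<in> points ?Q"
      then have \<Theta>: "\<Theta> \<in> P" unfolding pQ .
      then show "\<psi> \<Theta> \<in> points (disjoint_union ?Q1 ?Q2)"
        unfolding D using alt[OF \<Theta>] c1(4) c2(4) by (auto simp: \<psi>_def)
    next
      fix F assume "F \<in> regular (disjoint_union ?Q1 ?Q2)"
      then obtain p1 p2 where p: "p1 \<in> R1" "p2 \<in> R2"
        and F: "restrict (F \<circ> Inl) P1 = (\<lambda>\<theta>\<in>P1. \<theta> p1)" "restrict (F \<circ> Inr) P2 = (\<lambda>\<theta>\<in>P2. \<theta> p2)"
        unfolding D rQ by blast
      have F1: "F (Inl \<theta>) = \<theta> p1" if "\<theta> \<in> P1" for \<theta> using fun_cong[OF F(1), of \<theta>] that by simp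
      have F2: "F (Inr \<theta>) = \<theta> p2" if "\<theta> \<in> P2" for \<theta> using fun_cong[OF F(2), of \<theta>] that by simp
      \<comment> \<open>A pair of functions on the pieces is glued to the sum of their extensions by
        zero. Where \<open>\<Theta> e1 = 1\<close> the second summand is sent to a multiple of
        \<open>\<Theta> e2 = 0\<close>, and symmetrically.\<close>
      have "(\<lambda>\<Theta>\<in>P. F (\<psi> \<Theta>)) = (\<lambda>\<Theta>\<in>P. \<Theta> (\<lambda>x\<in>?X. E1 p1 x + E2 p2 x))"
      proof (rule restrict_ext)
        fix \<Theta> assume \<Theta>: "\<Theta> \<in> P"
        have "\<Theta> (\<lambda>x\<in>?X. E1 p1 x + E2 p2 x) = \<Theta> (E1 p1) + \<Theta> (E2 p2)"
          using character_add[OF R, of \<Theta> "E1 p1" "E2 p2"] \<Theta> c1(3)[OF p(1)] c2(3)[OF p(2)]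
          by (simp add: P_def rR)
        then show "F (\<psi> \<Theta>) = \<Theta> (\<lambda>x\<in>?X. E1 p1 x + E2 p2 x)"
          using alt[OF \<Theta>] c1(6)[OF \<Theta> p(1)] c2(6)[OF \<Theta> p(2)] c1(4)[OF \<Theta>] c2(4)[OF \<Theta>] p
          by (auto simp: \<psi>_def F1 F2)
      qed
      moreover have "(\<lambda>x\<in>?X. E1 p1 x + E2 p2 x) \<in> R"
        by (rule function_algebra_add[OF R]) (simp_all add: rR c1(3) c2(3) p)
      ultimately show "(\<lambda>\<Theta>\<in>points ?Q. F (\<psi> \<Theta>)) \<in> regular ?Q"
        unfolding pQ rQ by auto
    qed
  next
    fix x assume x: "x \<in> points (disjoint_union ?Q1 ?Q2)"
    have res: "restrict e1 X1 = (\<lambda>x\<in>X1. 1)" "restrict e1 X2 = (\<lambda>x\<in>X2. 0)"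
      "restrict (E1 p) X1 = restrict p X1" "restrict (E2 p) X2 = restrict p X2" for p
      using disj by (auto simp: e1_def E1_def E2_def intro!: restrict_ext)
    from x consider \<theta> where "x = Inl \<theta>" "\<theta> \<in> P1" | \<theta> where "x = Inr \<theta>" "\<theta> \<in> P2"
      unfolding D by blast
    then show "\<psi> (\<phi> x) = x"
    proof cases
      case 1
      then have \<theta>: "\<theta> \<in> algebra_characters X1 R1" by (simp add: P1_def)
      have "\<phi> x e1 = 1"
        using 1 by (simp add: \<phi>_def c1(1) res character_const[OF R1 \<theta>])
      moreover have "(\<lambda>p\<in>R1. \<phi> x (E1 p)) = \<theta>"
        by (rule extensionalityI[OF _ character_extensional[OF \<theta>]])
           (simp_all add: 1 \<phi>_def c1(3) res rR1)
      ultimately show ?thesis by (simp add: \<psi>_def 1)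
    next
      case 2
      then have \<theta>: "\<theta> \<in> algebra_characters X2 R2" by (simp add: P2_def)
      have "\<phi> x e1 = 0"
        using 2 by (simp add: \<phi>_def c1(1) res character_const[OF R2 \<theta>])
      moreover have "(\<lambda>p\<in>R2. \<phi> x (E2 p)) = \<theta>"
        by (rule extensionalityI[OF _ character_extensional[OF \<theta>]])
           (simp_all add: 2 \<phi>_def c2(3) res rR2)
      ultimately show ?thesis by (simp add: \<psi>_def 2)
    qed
  next
    fix \<Theta> assume "\<Theta> \<in> points ?Q"
    then have \<Theta>: "\<Theta> \<in> P" unfolding pQ .
    have ext: "\<Theta> \<in> extensional R" using \<Theta> by (simp add: P_def character_extensional)
    show "\<phi> (\<psi> \<Theta>) = \<Theta>"
    proof (rule extensionalityI[OF _ ext])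
      fix f assume f: "f \<in> R"
      show "\<phi> (\<psi> \<Theta>) f = \<Theta> f"
        using alt[OF \<Theta>] f
        by (auto simp: \<phi>_def \<psi>_def c1(2) c2(2) c1(5)[OF \<Theta> f] c2(5)[OF \<Theta> f])
    qed (auto simp: \<phi>_def split: sum.splits)
  qed
qed

section \<open>The torus\<close>

text \<open>A character is fixed by its values on the coordinates. The inverse coordinates are
  generators too, so these values are nonzero and form a point of the torus.\<close>

lemma affine_torus: "affine_variety (torus n)"
  unfolding affine_variety_def
proof (intro conjI ballI)
  define S where "S = {\<lambda>z :: nat \<Rightarrow> complex. z i |i. i \<in> {1..n}} \<union> {\<lambda>z. inverse (z i) |i. i \<in> {1..n}}"
  define Z where "Z = ({1..n} \<rightarrow>\<^sub>E - {0 :: complex})"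
  have torus: "torus n = variety_on Z S" by (simp add: torus_def S_def Z_def)
  show A: "variety_algebra (torus n)" unfolding torus_def by (rule variety_algebra_variety_on)
  fix \<theta> assume "\<theta> \<in> algebra_characters (points (torus n)) (regular (torus n))"
  then have \<theta>: "\<theta> \<in> algebra_characters Z (regular (variety_on Z S))" by (simp add: torus)
  have A: "function_algebra Z (regular (variety_on Z S))" using A by (simp add: torus)
  have reg: "restrict q Z \<in> regular (variety_on Z S)" if "q \<in> generated_algebra S" for q
    by (rule regular_variety_on[OF that])
  have S: "(\<lambda>z. z i) \<in> generated_algebra S" "(\<lambda>z. inverse (z i)) \<in> generated_algebra S"
    if "i \<in> {1..n}" for i
    using that by (auto simp: S_def intro!: generated_algebra.gen)
  define z where "z = (\<lambda>i\<in>{1..n}. \<theta> (\<lambda>z\<in>Z. z i))"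
  have zi: "z i = \<theta> (\<lambda>z\<in>Z. z i)" if "i \<in> {1..n}" for i
    using that by (simp only: z_def restrict_apply if_True)
  have inv: "z i * \<theta> (\<lambda>z\<in>Z. inverse (z i)) = 1" if i: "i \<in> {1..n}" for i
  proof -
    have "z i * \<theta> (\<lambda>z\<in>Z. inverse (z i)) = \<theta> (\<lambda>z\<in>Z. z i * inverse (z i))"
      using character_mult[OF A \<theta> reg[OF S(1)[OF i]] reg[OF S(2)[OF i]]] i by (simp add: z_def)
    also have "(\<lambda>z\<in>Z. z i * inverse (z i)) = (\<lambda>z\<in>Z. 1)"
      using i by (intro restrict_ext right_inverse) (auto simp: Z_def dest!: PiE_mem)
    also have "\<theta> \<dots> = 1" by (rule character_const[OF A \<theta>])
    finally show ?thesis .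
  qed
  have z: "z \<in> Z"
    unfolding Z_def
  proof (rule PiE_I)
    show "z i \<in> - {0}" if "i \<in> {1..n}" for i using inv[OF that] by auto
  qed (auto simp: z_def)
  have gen: "\<theta> (restrict q Z) = q z" if "q \<in> generated_algebra S" for q
    using that
  proof induction
    case (const c)
    show ?case by (rule character_const[OF A \<theta>])
  next
    case (gen f)
    then consider i where "i \<in> {1..n}" "f = (\<lambda>z. z i)" | i where "i \<in> {1..n}" "f = (\<lambda>z. inverse (z i))"
      by (auto simp: S_def)
    then show ?case
    proof cases
      case 1
      show ?thesis by (simp only: 1(2) zi[OF 1(1)])
    next
      case 2
      have "inverse (z i) = \<theta> (\<lambda>z\<in>Z. inverse (z i))"
        by (rule inverse_unique[OF inv[OF 2(1)]])
      then show ?thesis by (simp only: 2(2))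
    qed
  next
    case (add f h)
    then show ?case by (simp only: character_add[OF A \<theta> reg reg])
  next
    case (mult f h)
    then show ?case by (simp only: character_mult[OF A \<theta> reg reg])
  qed
  show "\<exists>!z. z \<in> points (torus n) \<and> (\<forall>q\<in>regular (torus n). \<theta> q = q z)"
    unfolding torus points_variety_on
  proof (rule ex1I[of _ z])
    show "z \<in> Z \<and> (\<forall>q\<in>regular (variety_on Z S). \<theta> q = q z)"
      using z by (auto simp: gen elim!: regular_variety_onE)
    fix z' assume z': "z' \<in> Z \<and> (\<forall>q\<in>regular (variety_on Z S). \<theta> q = q z')"
    show "z' = z"
    proof (rule PiE_ext[of _ "{1..n}" "\<lambda>_. - {0}"])
      show "z' \<in> {1..n} \<rightarrow>\<^sub>E - {0}" "z \<in> {1..n} \<rightarrow>\<^sub>E - {0}" using z z' by (auto simp: Z_def)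
      fix i assume i: "i \<in> {1..n}"
      have "\<theta> (\<lambda>z\<in>Z. z i) = (\<lambda>z\<in>Z. z i) z'"
        using z' reg[OF S(1)[OF i]] by blast
      then show "z' i = z i" using z' i by (simp add: z_def)
    qed
  qed
qed


section \<open>Scalar matrices and conjugacy classes\<close>

lemma mat_mult_entries: "(mat c ** M) $ i $ j = c * M $ i $ j" for M :: mat2
  using exhaust_2[of i] by (auto simp: matrix_matrix_mult_def sum_2 mat_def)

lemma mult_mat_entries: "(M ** mat c) $ i $ j = c * M $ i $ j" for M :: mat2
  using exhaust_2[of j] by (auto simp: matrix_matrix_mult_def sum_2 mat_def)

lemma mat_commute: "M ** mat c = mat c ** M" for M :: mat2
  by (simp add: vec_eq_iff mat_mult_entries mult_mat_entries)

lemma mult_mat_mult: "A ** (mat c ** B) = mat c ** (A ** B)" for A B :: mat2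
  by (simp add: matrix_mul_assoc mat_commute[of A c])

lemma mat_mult_mat: "mat c ** mat d = (mat (c * d) :: mat2)"
  by (simp add: vec_eq_iff mat_mult_entries) (simp add: mat_def)

lemma mat_mult_mat_assoc: "mat c ** (mat d ** M) = mat (c * d) ** M" for M :: mat2
  by (simp add: vec_eq_iff mat_mult_entries)

lemma det_mat_2: "det (mat c :: mat2) = c\<^sup>2"
  by (simp add: det_2 mat_def power2_eq_square)

lemma det_mat_mult: "det (mat c ** M) = c\<^sup>2 * det M" for M :: mat2
  by (simp add: det_mul det_mat_2)

lemma trace_mat_mult: "trace (mat c ** M) = c * trace M" for M :: mat2
  by (simp add: trace_def sum_2 mat_mult_entries algebra_simps)

lemma mat_eq_iff: "(mat c :: mat2) = mat d \<longleftrightarrow> c = d"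
  by (auto simp: vec_eq_iff mat_def)

lemma uminus_mat_1: "- mat 1 = (mat (- 1) :: mat2)"
  by (simp add: vec_eq_iff mat_def)

lemma mat_mult_eq_mat_iff:
  fixes M :: mat2
  assumes "c \<noteq> 0"
  shows "mat c ** M = mat 1 \<longleftrightarrow> M = mat (inverse c)"
proof
  assume "mat c ** M = mat 1"
  then have "mat (inverse c) ** (mat c ** M) = mat (inverse c)" by simp
  then show "M = mat (inverse c)" using assms by (simp add: mat_mult_mat_assoc)
qed (use assms in \<open>simp add: mat_mult_mat\<close>)

lemma matrix_inv_matrix_mult:
  "invertible A \<Longrightarrow> invertible B \<Longrightarrow> matrix_inv (A ** B) = matrix_inv B ** matrix_inv A"
  for A B :: mat2
proof (rule matrix_inv_unique2)
  assume A: "invertible A" and B: "invertible B"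
  have "A ** B ** (matrix_inv B ** matrix_inv A) = A ** (B ** matrix_inv B) ** matrix_inv A"
    by (simp add: matrix_mul_assoc)
  then show "A ** B ** (matrix_inv B ** matrix_inv A) = mat 1"
    by (simp add: matrix_inv_mult A B)
qed

lemma matrix_inv_mat: "u \<noteq> 0 \<Longrightarrow> matrix_inv (mat u :: mat2) = mat (inverse u)"
  by (rule matrix_inv_unique2) (simp add: mat_mult_mat)

lemma det_matrix_inv: "invertible M \<Longrightarrow> det (matrix_inv M) = inverse (det M)" for M :: mat2
  by (metis det_I det_mul inverse_unique matrix_inv_mult(1))

lemma conjugate_GL2: "invertible h \<Longrightarrow> conjugate GL2 h M = h ** M ** matrix_inv h"
  by (simp add: conjugate_def inv_GL2)

lemma conjugate_mat_mult:
  "h ** (mat c ** M) ** h' = mat c ** (h ** M ** h')" for h M h' :: mat2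
  by (simp add: mult_mat_mult flip: matrix_mul_assoc)

lemma conjugate_by_mat: "u \<noteq> 0 \<Longrightarrow> conjugate GL2 (mat u) M = M"
proof -
  assume u: "u \<noteq> 0"
  then have i: "invertible (mat u :: mat2)" by (simp add: invertible_det_nz det_mat_2)
  have "conjugate GL2 (mat u) M = M ** mat u ** matrix_inv (mat u)"
    by (simp add: conjugate_GL2[OF i] mat_commute)
  then show ?thesis using matrix_inv_mult(1)[OF i] by (simp add: matrix_mul_assoc[symmetric])
qed

lemma det_conjugate: "invertible h \<Longrightarrow> det (h ** M ** matrix_inv h) = det M" for h M :: mat2
  by (simp add: det_mul det_matrix_inv invertible_det_nz field_simps)

lemma trace_conjugate: "invertible h \<Longrightarrow> trace (h ** M ** matrix_inv h) = trace M" for h M :: mat2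
  by (subst trace_mul_sym) (simp add: matrix_mul_assoc matrix_inv_mult(2))

lemma det_commutator_GL2:
  "invertible A \<Longrightarrow> invertible B \<Longrightarrow> det (commutator GL2 A B) = 1"
  by (simp add: commutator_def inv_GL2 det_mul det_matrix_inv invertible_det_nz field_simps)

text \<open>The involution divides by the determinant, here \<open>c\<^sup>2\<close>. It thus fixes
  \<open>SL2\<close> and inverts scalars, which is the origin of the alternating exponents in the
  relation.\<close>

lemma sigma_GL2_scaled_SL2:
  "c \<noteq> 0 \<Longrightarrow> det M = 1 \<Longrightarrow> sigma_GL2 (mat c ** M) = mat (inverse c) ** M"
  by (simp add: vec_eq_iff sigma_entries invertible_det_nz det_mat_mult mat_mult_entries
      power2_eq_square field_simps)

lemma inv_embed: "invertible h \<Longrightarrow> inv\<^bsub>GL2_sigma\<^esub> (embed h) = embed (matrix_inv h)"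
  by (rule group.inv_equality[OF group_GL2_sigma])
     (auto simp: embed_def matrix_inv_mult matrix_inv_invertible)

lemma sigma_matrix_inv: "invertible h \<Longrightarrow> sigma_GL2 (matrix_inv h) = mat (det h) ** matrix_inv h"
  by (simp add: vec_eq_iff sigma_entries matrix_inv_invertible mat_mult_entries det_matrix_inv
      invertible_det_nz field_simps)

text \<open>Moving \<sigma> past the inverse of \<open>h\<close> turns that inverse into
  \<open>sigma_GL2 (matrix_inv h)\<close>, which is \<open>det h\<close> times
  \<open>matrix_inv h\<close>.\<close>

lemma conjugate_GL2_sigma:
  "invertible h \<Longrightarrow> conjugate GL2_sigma (embed h) (M, True) =
     (mat (det h) ** (h ** M ** matrix_inv h), True)"
  unfolding conjugate_def inv_embed
  by (simp add: embed_def sigma_matrix_inv mult_mat_mult)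

lemma det_diag2: "det (diag2 x y) = x * y"
  by (simp add: diag2_def det_2)

lemma trace_diag2: "trace (diag2 x y) = x + y"
  by (simp add: diag2_def trace_def sum_2)

lemma diag2_commute: "diag2 x y ** diag2 u v = diag2 u v ** diag2 x y"
  by (simp add: diag2_def vec_eq_iff forall_2 matrix_matrix_mult_def sum_2)

text \<open>Over the complex numbers conjugation by \<open>GL2\<close> and by \<open>SL2\<close>
  give the same classes: dividing \<open>h\<close> by a square root of its determinant does not
  change the conjugation.\<close>

lemma class_SL2_eq:
  "class_SL2 a = {h ** diag2 a (inverse a) ** matrix_inv h |h. invertible h}"
proof (intro equalityI subsetI)
  fix Y :: mat2 assume "Y \<in> class_SL2 a"
  then obtain h where "det h = 1" "Y = conjugate GL2 h (diag2 a (inverse a))"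
    by (auto simp: class_SL2_def SL2_def)
  then show "Y \<in> {h ** diag2 a (inverse a) ** matrix_inv h |h. invertible h}"
    using conjugate_GL2[of h] by (auto simp: invertible_det_nz)
next
  fix Y :: mat2 assume "Y \<in> {h ** diag2 a (inverse a) ** matrix_inv h |h. invertible h}"
  then obtain h where h: "invertible h" and Y: "Y = h ** diag2 a (inverse a) ** matrix_inv h"
    by blast
  let ?u = "inverse (csqrt (det h))" and ?D = "diag2 a (inverse a)"
  have u: "?u \<noteq> 0" using h by (simp add: invertible_det_nz)
  have i: "invertible (mat ?u ** h)"
    using h u by (simp add: invertible_det_nz det_mat_mult)
  have "det (mat ?u ** h) = 1"
    using h by (simp add: det_mat_mult power_inverse invertible_det_nz)
  moreover have "conjugate GL2 (mat ?u ** h) ?D = Y"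
  proof -
    have "matrix_inv (mat ?u ** h) = matrix_inv h ** mat (inverse ?u)"
      using u h by (simp add: matrix_inv_matrix_mult matrix_inv_mat invertible_det_nz det_mat_2)
    then have "conjugate GL2 (mat ?u ** h) ?D = mat ?u ** (h ** ?D ** matrix_inv h ** mat (inverse ?u))"
      by (simp add: conjugate_GL2[OF i] matrix_mul_assoc)
    also have "\<dots> = Y"
      using u by (simp add: mat_commute mat_mult_mat_assoc Y del: inverse_inverse_eq)
    finally show ?thesis .
  qed
  ultimately show "Y \<in> class_SL2 a" by (auto simp: class_SL2_def SL2_def)
qed

lemma class_SL2_det: "a \<noteq> 0 \<Longrightarrow> Y \<in> class_SL2 a \<Longrightarrow> det Y = 1"
  by (auto simp: class_SL2_eq det_conjugate det_diag2)

lemma class_SL2_trace: "Y \<in> class_SL2 a \<Longrightarrow> trace Y = a + inverse a"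
  by (auto simp: class_SL2_eq trace_conjugate trace_diag2)

text \<open>
  The centralizer of \<open>diag(a, a\<^sup>-\<^sup>1)\<close> contains matrices of every nonzero determinant, so that
  conjugating \<open>diag(a, a\<^sup>-\<^sup>1) \<sigma>\<close> rescales it arbitrarily.
\<close>

lemma class_sigma_eq:
  "class_sigma a = {(mat c ** Y, True) |c Y. c \<noteq> 0 \<and> Y \<in> class_SL2 a}"
proof -
  let ?D = "diag2 a (inverse a)"
  have s: "embed ?D \<otimes>\<^bsub>GL2_sigma\<^esub> sigma_elt = (?D, True)"
    by (simp add: embed_def sigma_elt_def)
  have "class_sigma a = {(mat (det h) ** (h ** ?D ** matrix_inv h), True) |h. invertible h}"
    unfolding class_sigma_def s
    by (rule Collect_cong, rule ex_cong1) (auto simp: conjugate_GL2_sigma)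
  also have "\<dots> = {(mat c ** Y, True) |c Y. c \<noteq> 0 \<and> Y \<in> class_SL2 a}"
  proof (intro equalityI subsetI)
    fix X assume "X \<in> {(mat c ** Y, True) |c Y. c \<noteq> 0 \<and> Y \<in> class_SL2 a}"
    then obtain c h where c: "c \<noteq> 0" and h: "invertible h"
      and X: "X = (mat c ** (h ** ?D ** matrix_inv h), True)"
      by (auto simp: class_SL2_eq)
    \<comment> \<open>Commutes with \<open>?D\<close>, and its entry is chosen so that
      \<open>h ** ?t\<close> has determinant \<open>c\<close>.\<close>
    let ?t = "diag2 (c / det h) 1"
    have t: "invertible ?t" using c h by (simp add: invertible_det_nz det_diag2)
    have "h ** ?t ** ?D ** matrix_inv (h ** ?t) = h ** ?D ** matrix_inv h"
    proof -
      have "h ** ?t ** ?D ** matrix_inv (h ** ?t) =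
          h ** (?t ** ?D) ** matrix_inv ?t ** matrix_inv h"
        by (simp add: matrix_inv_matrix_mult h t matrix_mul_assoc)
      also have "\<dots> = h ** ?D ** (?t ** matrix_inv ?t) ** matrix_inv h"
        by (simp only: diag2_commute[of _ _ a]) (simp add: matrix_mul_assoc)
      finally show ?thesis by (simp add: matrix_inv_mult t)
    qed
    moreover have "det (h ** ?t) = c" using h by (simp add: det_mul det_diag2 invertible_det_nz)
    moreover have "invertible (h ** ?t)" by (rule invertible_mult[OF h t])
    ultimately show "X \<in> {(mat (det h) ** (h ** ?D ** matrix_inv h), True) |h. invertible h}"
      unfolding X by (intro CollectI exI[of _ "h ** ?t"]) simp
  qed (auto simp: class_SL2_eq invertible_det_nz)
  finally show ?thesis .
qed


section \<open>Words\<close>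

lemma (in group) conjugate_mult:
  "h \<in> carrier G \<Longrightarrow> x \<in> carrier G \<Longrightarrow> y \<in> carrier G \<Longrightarrow>
    conjugate G h (x \<otimes> y) = conjugate G h x \<otimes> conjugate G h y"
  unfolding conjugate_def by (simp add: m_assoc inv_solve_left)

lemma (in group) conjugate_closed:
  "h \<in> carrier G \<Longrightarrow> x \<in> carrier G \<Longrightarrow> conjugate G h x \<in> carrier G"
  by (simp add: conjugate_def)

lemma (in group) conjugate_inv:
  "h \<in> carrier G \<Longrightarrow> x \<in> carrier G \<Longrightarrow> conjugate G h (inv x) = inv (conjugate G h x)"
  by (simp add: conjugate_def inv_mult_group m_assoc)

lemma (in group) conjugate_commutator:
  "h \<in> carrier G \<Longrightarrow> x \<in> carrier G \<Longrightarrow> y \<in> carrier G \<Longrightarrow>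
    conjugate G h (commutator G x y) = commutator G (conjugate G h x) (conjugate G h y)"
  by (simp add: commutator_def conjugate_mult conjugate_inv[symmetric])

lemma (in group) commutator_closed:
  "x \<in> carrier G \<Longrightarrow> y \<in> carrier G \<Longrightarrow> commutator G x y \<in> carrier G"
  by (simp add: commutator_def)

lemma (in group) foldr_closed:
  "(\<And>i. i \<in> set l \<Longrightarrow> x i \<in> carrier G) \<Longrightarrow> foldr (\<lambda>i y. x i \<otimes> y) l \<one> \<in> carrier G"
  by (induction l) auto

lemma (in group) ordered_prod_closed:
  "(\<And>i. i \<in> {1..n} \<Longrightarrow> x i \<in> carrier G) \<Longrightarrow> ordered_prod G n x \<in> carrier G"
  unfolding ordered_prod_def by (rule foldr_closed) auto

lemma (in group) conjugate_foldr:
  "h \<in> carrier G \<Longrightarrow> (\<And>i. i \<in> set l \<Longrightarrow> x i \<in> carrier G) \<Longrightarrow>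
    conjugate G h (foldr (\<lambda>i y. x i \<otimes> y) l \<one>) = foldr (\<lambda>i y. conjugate G h (x i) \<otimes> y) l \<one>"
  by (induction l) (auto simp: conjugate_mult foldr_closed, simp add: conjugate_def)

lemma (in group) conjugate_ordered_prod:
  "h \<in> carrier G \<Longrightarrow> (\<And>i. i \<in> {1..n} \<Longrightarrow> x i \<in> carrier G) \<Longrightarrow>
    conjugate G h (ordered_prod G n x) = ordered_prod G n (\<lambda>i. conjugate G h (x i))"
  unfolding ordered_prod_def by (rule conjugate_foldr) auto

lemma ordered_prod_cong:
  "(\<And>i. i \<in> {1..n} \<Longrightarrow> x i = y i) \<Longrightarrow> ordered_prod H n x = ordered_prod H n y"
  unfolding ordered_prod_def by (rule foldr_cong) auto

text \<open>Conjugation is an automorphism, so it commutes with commutators and ordered products.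
  Keeping \<open>H\<close> and \<open>\<iota>\<close> general serves both \<open>GL2\<close> and
  \<open>GL2_sigma\<close>.\<close>

lemma simultaneous_conj_rep_points:
  assumes H: "group H" and \<iota>: "group_hom GL2 H \<iota>" and h: "h \<in> carrier GL2"
    and C: "\<And>j. j \<in> {1..n} \<Longrightarrow> C j \<subseteq> carrier H"
    and Ch: "\<And>j x. j \<in> {1..n} \<Longrightarrow> x \<in> C j \<Longrightarrow> conjugate H (\<iota> h) x \<in> C j"
    and z: "conjugate H (\<iota> h) z = z"
    and x: "x \<in> rep_points H \<iota> g n C z"
  shows "simultaneous_conj H \<iota> g n h x \<in> rep_points H \<iota> g n C z"
proof -
  interpret H: group H by (rule H)
  interpret GL2: group GL2 by (rule group_GL2)
  interpret \<iota>: group_hom GL2 H \<iota> by (rule \<iota>)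
  obtain A B X where x': "x = (A, B, X)" by (cases x)
  have A: "A \<in> {1..g} \<rightarrow>\<^sub>E carrier GL2" and B: "B \<in> {1..g} \<rightarrow>\<^sub>E carrier GL2"
    and X: "X \<in> (\<Pi>\<^sub>E j\<in>{1..n}. C j)"
    and eq: "ordered_prod H g (\<lambda>i. commutator H (\<iota> (A i)) (\<iota> (B i))) \<otimes>\<^bsub>H\<^esub> ordered_prod H n X = z"
    using x unfolding rep_points_def x' by auto
  have hH: "\<iota> h \<in> carrier H" by (rule \<iota>.hom_closed[OF h])
  have Ai: "A i \<in> carrier GL2" "B i \<in> carrier GL2" if "i \<in> {1..g}" for i
    using A B that by (auto simp del: GL2_simps)
  have Xj: "X j \<in> carrier H" if "j \<in> {1..n}" for j using PiE_mem[OF X that] C[OF that] by blast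
  have \<iota>c: "\<iota> (conjugate GL2 h M) = conjugate H (\<iota> h) (\<iota> M)" if "M \<in> carrier GL2" for M
    using h that by (simp add: conjugate_def del: GL2_simps)
  define K where "K = (\<lambda>i. commutator H (\<iota> (A i)) (\<iota> (B i)))"
  have K: "K i \<in> carrier H" if "i \<in> {1..g}" for i
    unfolding K_def by (intro H.commutator_closed \<iota>.hom_closed Ai that)
  have 1: "ordered_prod H g (\<lambda>i. commutator H (\<iota> ((\<lambda>i\<in>{1..g}. conjugate GL2 h (A i)) i))
        (\<iota> ((\<lambda>i\<in>{1..g}. conjugate GL2 h (B i)) i))) = conjugate H (\<iota> h) (ordered_prod H g K)"
  proof -
    have "conjugate H (\<iota> h) (ordered_prod H g K) = ordered_prod H g (\<lambda>i. conjugate H (\<iota> h) (K i))"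
      by (rule H.conjugate_ordered_prod[OF hH K])
    also have "\<dots> = ordered_prod H g (\<lambda>i. commutator H (\<iota> ((\<lambda>i\<in>{1..g}. conjugate GL2 h (A i)) i))
        (\<iota> ((\<lambda>i\<in>{1..g}. conjugate GL2 h (B i)) i)))"
      by (rule ordered_prod_cong)
         (simp add: \<iota>c Ai K_def H.conjugate_commutator hH \<iota>.hom_closed del: GL2_simps)
    finally show ?thesis by (rule sym)
  qed
  have 2: "ordered_prod H n (\<lambda>j\<in>{1..n}. conjugate H (\<iota> h) (X j)) = conjugate H (\<iota> h) (ordered_prod H n X)"
  proof -
    have "conjugate H (\<iota> h) (ordered_prod H n X) = ordered_prod H n (\<lambda>j. conjugate H (\<iota> h) (X j))"
      by (rule H.conjugate_ordered_prod[OF hH Xj])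
    also have "\<dots> = ordered_prod H n (\<lambda>j\<in>{1..n}. conjugate H (\<iota> h) (X j))"
      by (rule ordered_prod_cong) simp
    finally show ?thesis by (rule sym)
  qed
  have "conjugate H (\<iota> h) (ordered_prod H g K) \<otimes>\<^bsub>H\<^esub> conjugate H (\<iota> h) (ordered_prod H n X) = z"
  proof -
    have "conjugate H (\<iota> h) (ordered_prod H g K \<otimes>\<^bsub>H\<^esub> ordered_prod H n X) = z"
      using eq z by (simp add: K_def)
    moreover have "ordered_prod H g K \<in> carrier H" "ordered_prod H n X \<in> carrier H"
      by (rule H.ordered_prod_closed; fact K Xj)+
    ultimately show ?thesis by (simp add: H.conjugate_mult hH)
  qed
  moreover have "conjugate GL2 h M \<in> carrier GL2" if "M \<in> carrier GL2" for M
    by (rule GL2.conjugate_closed[OF h that])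
  ultimately show ?thesis
    unfolding x' simultaneous_conj_def prod.case rep_points_def mem_Collect_eq 1 2
    using Ai Ch[OF _ PiE_mem[OF X]] by (auto simp del: GL2_simps)
qed

text \<open>The leading \<sigma> acts on the remaining product, whose matrix part has determinant 1,
  and inverts its scalar. Exponents follow the parity of the absolute index \<open>i\<close>, so a
  block starting at an even \<open>m\<close> gives the inverse. The start \<open>m\<close> is
  general because the induction passes to \<open>Suc m\<close>.\<close>

lemma foldr_sigma_elements:
  fixes c :: "nat \<Rightarrow> complex"
  assumes "\<And>i. m \<le> i \<Longrightarrow> i < m + d \<Longrightarrow> c i \<noteq> 0 \<and> det (Y i) = 1"
  shows "foldr (\<lambda>i y. (mat (c i) ** Y i, True) \<otimes>\<^bsub>GL2_sigma\<^esub> y) [m..<m + d] (mat 1, False) =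
    (mat ((if odd m then id else inverse) (\<Prod>i\<in>{m..<m + d}. if odd i then c i else inverse (c i)))
       ** foldr (\<lambda>i y. Y i ** y) [m..<m + d] (mat 1), odd d)"
  using assms
proof (induction d arbitrary: m)
  case 0
  show ?case by simp
next
  case (Suc d)
  let ?\<chi> = "\<lambda>i. if odd i then c i else inverse (c i)"
  define P where "P = (\<Prod>i\<in>{Suc m..<Suc m + d}. ?\<chi> i)"
  define Q where "Q = foldr (\<lambda>i y. Y i ** y) [Suc m..<Suc m + d] (mat 1)"
  have "det (foldr (\<lambda>i y. Y i ** y) l (mat 1)) = 1" if "\<forall>i\<in>set l. det (Y i) = 1" for l
    using that by (induction l) (auto simp: det_mul)
  then have Q: "det Q = 1" unfolding Q_def using Suc.prems by (auto simp del: upt_Suc)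
  have P: "P \<noteq> 0" unfolding P_def using Suc.prems by auto
  have upt: "[m..<m + Suc d] = m # [Suc m..<Suc m + d]"
    by (simp add: upt_conv_Cons)
  have ivl: "{m..<m + Suc d} = insert m {Suc m..<Suc m + d}" by auto
  have prod: "(\<Prod>i\<in>{m..<m + Suc d}. ?\<chi> i) = ?\<chi> m * P"
    unfolding ivl P_def by (subst prod.insert) auto
  have IH: "foldr (\<lambda>i y. (mat (c i) ** Y i, True) \<otimes>\<^bsub>GL2_sigma\<^esub> y) [Suc m..<Suc m + d] (mat 1, False) =
      (mat ((if odd (Suc m) then id else inverse) P) ** Q, odd d)"
    unfolding P_def Q_def by (rule Suc.IH) (use Suc.prems in auto)
  have "mat (c m) ** Y m ** (mat r ** Q) = mat (c m * r) ** (Y m ** Q)" for r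
    by (simp only: matrix_mul_assoc[symmetric] mult_mat_mult[of "Y m"] mat_mult_mat_assoc)
  then show ?case
    unfolding prod upt foldr.simps comp_def IH Q_def[symmetric]
    using P Q by (auto simp: sigma_GL2_scaled_SL2)
qed

lemma ordered_prod_embed:
  "ordered_prod GL2_sigma n (\<lambda>i. embed (M i)) = embed (ordered_prod GL2 n M)"
proof -
  have "foldr (\<lambda>i y. embed (M i) \<otimes>\<^bsub>GL2_sigma\<^esub> y) l (mat 1, False) =
      embed (foldr (\<lambda>i y. M i ** y) l (mat 1))" for l
    by (induction l) (auto simp: embed_def)
  then show ?thesis by (simp add: ordered_prod_def)
qed

lemma commutator_embed:
  "invertible A \<Longrightarrow> invertible B \<Longrightarrow>
    commutator GL2_sigma (embed A) (embed B) = embed (commutator GL2 A B)"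
  by (simp add: commutator_def inv_embed inv_GL2) (simp add: embed_def)

definition word :: "nat \<Rightarrow> nat \<Rightarrow> mat2 tuple \<Rightarrow> mat2" where
  "word g n = (\<lambda>(A, B, Y).
     ordered_prod GL2 g (\<lambda>i. commutator GL2 (A i) (B i)) ** ordered_prod GL2 n Y)"

text \<open>Commutators have determinant 1. Consequently a scalar multiple of the word can equal the
  identity only if the scalar squares to 1.\<close>

lemma det_word:
  assumes "\<And>i. i \<in> {1..g} \<Longrightarrow> invertible (A i) \<and> invertible (B i)"
    and "\<And>j. j \<in> {1..n} \<Longrightarrow> det (Y j) = 1"
  shows "det (word g n (A, B, Y)) = 1"
proof -
  have det1: "det (foldr (\<lambda>i y. M i ** y) l (mat 1)) = 1" if "\<forall>i\<in>set l. det (M i :: mat2) = 1" for M l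
    using that by (induction l) (auto simp: det_mul)
  have "det (ordered_prod GL2 g (\<lambda>i. commutator GL2 (A i) (B i))) = 1"
    unfolding ordered_prod_def GL2_simps
    by (rule det1) (use assms(1) in \<open>auto simp: det_commutator_GL2 simp del: upt_Suc\<close>)
  moreover have "det (ordered_prod GL2 n Y) = 1"
    unfolding ordered_prod_def GL2_simps
    by (rule det1) (use assms(2) in \<open>auto simp del: upt_Suc\<close>)
  ultimately show ?thesis by (simp add: word_def det_mul)
qed

text \<open>Indices start at 1, so the exponents run +1, -1, +1 and so on. For even \<open>n\<close>
  the \<sigma> component is trivial and the relation becomes one equation in
  \<open>GL2\<close>.\<close>

lemma sigma_word:
  fixes c :: "nat \<Rightarrow> complex"
  assumes A: "\<And>i. i \<in> {1..g} \<Longrightarrow> invertible (A i) \<and> invertible (B i)"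
    and Y: "\<And>j. j \<in> {1..n} \<Longrightarrow> c j \<noteq> 0 \<and> det (Y j) = 1 \<and> X j = (mat (c j) ** Y j, True)"
  shows "ordered_prod GL2_sigma g (\<lambda>i. commutator GL2_sigma (embed (A i)) (embed (B i)))
      \<otimes>\<^bsub>GL2_sigma\<^esub> ordered_prod GL2_sigma n X =
    (mat (\<Prod>i\<in>{1..n}. if odd i then c i else inverse (c i)) ** word g n (A, B, Y), odd n)"
proof -
  let ?P = "\<Prod>i\<in>{1..n}. if odd i then c i else inverse (c i)"
  have "ordered_prod GL2_sigma n X = ordered_prod GL2_sigma n (\<lambda>i. (mat (c i) ** Y i, True))"
    by (rule ordered_prod_cong) (use Y in simp)
  also have "\<dots> = (mat ?P ** ordered_prod GL2 n Y, odd n)"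
    using foldr_sigma_elements[of 1 n c Y] Y
    by (simp add: ordered_prod_def atLeastLessThanSuc_atLeastAtMost)
  finally have 1: "ordered_prod GL2_sigma n X = (mat ?P ** ordered_prod GL2 n Y, odd n)" .
  have 2: "ordered_prod GL2_sigma g (\<lambda>i. commutator GL2_sigma (embed (A i)) (embed (B i))) =
      embed (ordered_prod GL2 g (\<lambda>i. commutator GL2 (A i) (B i)))"
    unfolding ordered_prod_embed[symmetric]
    by (rule ordered_prod_cong) (use A in \<open>simp add: commutator_embed\<close>)
  show ?thesis
    unfolding 1 2 word_def prod.case
    by (simp add: embed_def mult_mat_mult)
qed

section \<open>Regular functions on tuples of matrices\<close>

lemma regular_tuple_coords:
  assumes "c \<in> coords_GL2"
  shows "i \<in> {1..g} \<Longrightarrow> (\<lambda>x\<in>X. c (fst x i)) \<in> regular (variety_on X (tuple_coords S g n))"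
    and "i \<in> {1..g} \<Longrightarrow> (\<lambda>x\<in>X. c (fst (snd x) i)) \<in> regular (variety_on X (tuple_coords S g n))"
  using assms
  by (auto intro!: regular_variety_on generated_algebra.gen simp: tuple_coords_def case_prod_unfold)

lemma regular_tuple_coords_class:
  "c \<in> S \<Longrightarrow> j \<in> {1..n} \<Longrightarrow>
    (\<lambda>x\<in>X. c (snd (snd x) j)) \<in> regular (variety_on X (tuple_coords S g n))"
  by (auto intro!: regular_variety_on generated_algebra.gen simp: tuple_coords_def case_prod_unfold)

lemma tuple_coordsE:
  assumes "f \<in> tuple_coords S g n"
  obtains c i where "c \<in> coords_GL2" "i \<in> {1..g}" "f = (\<lambda>x. c (fst x i))"
  | c i where "c \<in> coords_GL2" "i \<in> {1..g}" "f = (\<lambda>x. c (fst (snd x) i))"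
  | c j where "c \<in> S" "j \<in> {1..n}" "f = (\<lambda>x. c (snd (snd x) j))"
  using assms unfolding tuple_coords_def case_prod_unfold by blast

lemma coords_GL2_entry: "(\<lambda>M. M $ r $ s) \<in> coords_GL2"
  and coords_GL2_inverse_det: "(\<lambda>M. inverse (det M)) \<in> coords_GL2"
  by (auto simp: coords_GL2_def)

lemma coords_GL2E:
  assumes "c \<in> coords_GL2"
  obtains r s where "c = (\<lambda>M. M $ r $ s)" | "c = (\<lambda>M. inverse (det M))"
  using assms by (auto simp: coords_GL2_def)

lemma coords_GL2_sigma_fst: "c \<in> coords_GL2 \<Longrightarrow> (\<lambda>x. c (fst x)) \<in> coords_GL2_sigma"
  by (auto simp: coords_GL2_sigma_def comp_def)

lemma coords_GL2_sigmaE: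
  assumes "c \<in> coords_GL2_sigma"
  obtains d where "d \<in> coords_GL2" "c = (\<lambda>x. d (fst x))" | "c = (\<lambda>x. of_bool (snd x))"
  using assms by (auto simp: coords_GL2_sigma_def comp_def)

definition regular_matrix :: "'a variety \<Rightarrow> ('a \<Rightarrow> mat2) \<Rightarrow> bool" where
  "regular_matrix V M \<longleftrightarrow> (\<forall>r s. (\<lambda>x\<in>points V. M x $ r $ s) \<in> regular V)"

lemma regular_matrix_const: "variety_algebra V \<Longrightarrow> regular_matrix V (\<lambda>_. M)"
  by (simp add: regular_matrix_def function_algebra_const)

lemma regular_matrix_mult:
  "variety_algebra V \<Longrightarrow> regular_matrix V M \<Longrightarrow> regular_matrix V N \<Longrightarrow>
    regular_matrix V (\<lambda>x. M x ** N x)"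
  unfolding regular_matrix_def matrix_matrix_mult_def sum_2
  by (simp add: function_algebra_add function_algebra_mult)

text \<open>By the adjugate formula the entries of the inverse are, up to sign, entries times the
  inverse determinant.\<close>

lemma regular_matrix_inv:
  assumes V: "variety_algebra V" and M: "regular_matrix V M"
    and det: "(\<lambda>x\<in>points V. inverse (det (M x))) \<in> regular V"
    and inv: "\<And>x. x \<in> points V \<Longrightarrow> invertible (M x)"
  shows "regular_matrix V (\<lambda>x. matrix_inv (M x))"
proof -
  have e: "(\<lambda>x\<in>points V. M x $ r $ s) \<in> regular V" for r s
    using M by (simp add: regular_matrix_def)
  have reg: "(\<lambda>x\<in>points V. M x $ r $ s * inverse (det (M x))) \<in> regular V"
    "(\<lambda>x\<in>points V. - (M x $ r $ s * inverse (det (M x)))) \<in> regular V" for r s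
    by (intro function_algebra_uminus[OF V] function_algebra_mult[OF V] e det)+
  have "(\<lambda>x\<in>points V. matrix_inv (M x) $ 1 $ 1) = (\<lambda>x\<in>points V. M x $ 2 $ 2 * inverse (det (M x)))"
    "(\<lambda>x\<in>points V. matrix_inv (M x) $ 1 $ 2) = (\<lambda>x\<in>points V. - (M x $ 1 $ 2 * inverse (det (M x))))"
    "(\<lambda>x\<in>points V. matrix_inv (M x) $ 2 $ 1) = (\<lambda>x\<in>points V. - (M x $ 2 $ 1 * inverse (det (M x))))"
    "(\<lambda>x\<in>points V. matrix_inv (M x) $ 2 $ 2) = (\<lambda>x\<in>points V. M x $ 1 $ 1 * inverse (det (M x)))"
    by (rule restrict_ext, simp add: matrix_inv_2[OF inv] divide_inverse)+
  then have "\<forall>r s. (\<lambda>x\<in>points V. matrix_inv (M x) $ r $ s) \<in> regular V"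
    unfolding forall_2 by (simp only: reg)
  then show ?thesis by (simp add: regular_matrix_def)
qed

lemma regular_matrix_ordered_prod:
  assumes "variety_algebra V" "\<And>i. i \<in> {1..n} \<Longrightarrow> regular_matrix V (\<lambda>x. M x i)"
  shows "regular_matrix V (\<lambda>x. ordered_prod GL2 n (M x))"
proof -
  have "regular_matrix V (\<lambda>x. foldr (\<lambda>i y. M x i ** y) l (mat 1))" if "set l \<subseteq> {1..n}" for l
    using that
    by (induction l) (auto intro!: regular_matrix_const regular_matrix_mult assms)
  from this[of "[1..<Suc n]"] show ?thesis
    by (simp add: ordered_prod_def atLeastLessThanSuc_atLeastAtMost del: upt_Suc)
qed

text \<open>Needed for a single entry of the word, which on the union of both sign components is the
  regular function telling them apart.\<close>

lemma regular_matrix_word: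
  assumes "\<And>x i. x \<in> X \<Longrightarrow> i \<in> {1..g} \<Longrightarrow> invertible (fst x i) \<and> invertible (fst (snd x) i)"
  shows "regular_matrix (variety_on X (tuple_coords coords_GL2 g n)) (word g n)"
proof -
  let ?V = "variety_on X (tuple_coords coords_GL2 g n)"
  note V = variety_algebra_variety_on[of X "tuple_coords coords_GL2 g n"]
  have AB: "regular_matrix ?V (\<lambda>x. fst x i)" "regular_matrix ?V (\<lambda>x. fst (snd x) i)"
    if "i \<in> {1..g}" for i
    using regular_tuple_coords[OF coords_GL2_entry that] by (auto simp: regular_matrix_def)
  have Y: "regular_matrix ?V (\<lambda>x. snd (snd x) j)" if "j \<in> {1..n}" for j
    using regular_tuple_coords_class[OF coords_GL2_entry that] by (auto simp: regular_matrix_def)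
  have inv: "regular_matrix ?V (\<lambda>x. matrix_inv (fst x i))"
    "regular_matrix ?V (\<lambda>x. matrix_inv (fst (snd x) i))" if "i \<in> {1..g}" for i
    using regular_tuple_coords[OF coords_GL2_inverse_det that, of X coords_GL2 n]
      assms[OF _ that] AB[OF that]
    by (auto intro!: regular_matrix_inv[OF V])
  have "regular_matrix ?V (\<lambda>x. commutator GL2 (fst x i) (fst (snd x) i))" if i: "i \<in> {1..g}" for i
  proof -
    have "regular_matrix ?V (\<lambda>x. fst x i ** fst (snd x) i ** matrix_inv (fst x i) ** matrix_inv (fst (snd x) i))"
      by (intro regular_matrix_mult[OF V] AB inv i)
    moreover have "(\<lambda>x\<in>X. commutator GL2 (fst x i) (fst (snd x) i) $ r $ s) =
      (\<lambda>x\<in>X. (fst x i ** fst (snd x) i ** matrix_inv (fst x i) ** matrix_inv (fst (snd x) i)) $ r $ s)" for r s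
      using assms i by (intro restrict_ext) (simp add: commutator_def inv_GL2)
    ultimately show ?thesis by (simp add: regular_matrix_def)
  qed
  then show ?thesis
    unfolding word_def case_prod_unfold
    by (intro regular_matrix_mult[OF V] regular_matrix_ordered_prod[OF V] Y)
qed

section \<open>Conjugation on the classes\<close>

lemma class_SL2_conjugate:
  "invertible h \<Longrightarrow> Y \<in> class_SL2 a \<Longrightarrow> conjugate GL2 h Y \<in> class_SL2 a"
proof -
  assume h: "invertible h" and "Y \<in> class_SL2 a"
  then obtain h0 where h0: "invertible h0" "Y = h0 ** diag2 a (inverse a) ** matrix_inv h0"
    by (auto simp: class_SL2_eq)
  have "conjugate GL2 h Y = (h ** h0) ** diag2 a (inverse a) ** matrix_inv (h ** h0)"
    by (simp add: conjugate_GL2 h h0 matrix_inv_matrix_mult matrix_mul_assoc)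
  then show ?thesis using invertible_mult[OF h h0(1)] by (auto simp: class_SL2_eq)
qed

text \<open>Scalar and matrix part transform independently, by \<open>det h\<close> and by ordinary
  conjugation. This makes \<open>proj\<close> equivariant and the ratios of scalars
  invariant.\<close>

lemma conjugate_sigma_scaled:
  "invertible h \<Longrightarrow> conjugate GL2_sigma (embed h) (mat c ** Y, True) =
    (mat (det h * c) ** conjugate GL2 h Y, True)"
  by (simp add: conjugate_GL2_sigma conjugate_GL2 conjugate_mat_mult mat_mult_mat_assoc)

lemma class_sigma_conjugate:
  "invertible h \<Longrightarrow> X \<in> class_sigma a \<Longrightarrow> conjugate GL2_sigma (embed h) X \<in> class_sigma a"
  by (auto simp: class_sigma_eq conjugate_sigma_scaled invertible_det_nz intro!: class_SL2_conjugate)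
     (metis class_SL2_conjugate invertible_det_nz mult_eq_0_iff)

lemma conjugate_GL2_mat: "invertible h \<Longrightarrow> conjugate GL2 h (mat c) = mat c"
proof -
  assume h: "invertible h"
  have "conjugate GL2 h (mat c) = mat c ** (h ** matrix_inv h)"
    by (simp add: conjugate_GL2 h mat_commute[of h] matrix_mul_assoc)
  then show ?thesis by (simp add: matrix_inv_mult h)
qed


section \<open>The two representation varieties\<close>

locale class_data =
  fixes g k :: nat and a :: "nat \<Rightarrow> complex"
  assumes k: "k \<ge> 1"
    and a: "\<And>j. j \<in> {1..2 * k} \<Longrightarrow> a j \<noteq> 0"
    and a2: "\<And>j. j \<in> {1..2 * k} \<Longrightarrow> (a j)\<^sup>2 \<noteq> -1"
begin

definition V_points :: "(mat2 \<times> bool) tuple set" where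
  "V_points = rep_points GL2_sigma embed g (2 * k) (\<lambda>j. class_sigma (a j)) \<one>\<^bsub>GL2_sigma\<^esub>"

definition W_points :: "mat2 \<Rightarrow> mat2 tuple set" where
  "W_points = rep_points GL2 (\<lambda>M. M) g (2 * k) (\<lambda>j. class_SL2 (a j))"

definition V :: "(mat2 \<times> bool) tuple variety" where
  "V = variety_on V_points (tuple_coords coords_GL2_sigma g (2 * k))"

text \<open>Both signs are kept in one variety, so that \<open>proj\<close> is a single map from
  \<open>V\<close> and the sign is a regular function that \<open>lift\<close> can use for the last
  scalar.\<close>

definition W :: "mat2 tuple variety" where
  "W = variety_on (W_points (mat 1) \<union> W_points (- mat 1)) (tuple_coords coords_GL2 g (2 * k))"

abbreviation actV :: "mat2 \<Rightarrow> (mat2 \<times> bool) tuple \<Rightarrow> (mat2 \<times> bool) tuple" where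
  "actV \<equiv> simultaneous_conj GL2_sigma embed g (2 * k)"

abbreviation actW :: "mat2 \<Rightarrow> mat2 tuple \<Rightarrow> mat2 tuple" where
  "actW \<equiv> simultaneous_conj GL2 (\<lambda>M. M) g (2 * k)"

definition scalar_part :: "nat \<Rightarrow> mat2 \<times> bool \<Rightarrow> complex" where
  "scalar_part j x = trace (fst x) / (a j + inverse (a j))"

definition SL2_part :: "nat \<Rightarrow> mat2 \<times> bool \<Rightarrow> mat2" where
  "SL2_part j x = mat (inverse (scalar_part j x)) ** fst x"

text \<open>On \<open>W\<close> the word is a scalar matrix 1 or -1, so one diagonal entry is the
  sign, and as an entry it is visibly regular.\<close>

definition sign :: "mat2 tuple \<Rightarrow> complex" where
  "sign w = word g (2 * k) w $ 1 $ 1"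

definition proj :: "(mat2 \<times> bool) tuple \<Rightarrow> mat2 tuple" where
  "proj x = (fst x, fst (snd x), \<lambda>j\<in>{1..2 * k}. SL2_part j (snd (snd x) j))"

definition ratios :: "(mat2 \<times> bool) tuple \<Rightarrow> nat \<Rightarrow> complex" where
  "ratios x = (\<lambda>i\<in>{1..2 * k - 2}.
     scalar_part (i + 1) (snd (snd x) (i + 1)) * inverse (scalar_part 1 (snd (snd x) 1)))"

text \<open>
  The scalars \<open>\<lambda>\<^sub>1 = 1, \<lambda>\<^sub>2 = z\<^sub>1, \<dots>, \<lambda>\<^sub>2\<^sub>k\<^sub>-\<^sub>1 = z\<^sub>2\<^sub>k\<^sub>-\<^sub>2\<close>; the last one, \<open>\<lambda>\<^sub>2\<^sub>k\<close>, is forced by the relation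
  \<open>\<lambda>\<^sub>1 \<lambda>\<^sub>2\<^sup>-\<^sup>1 \<lambda>\<^sub>3 \<cdots> \<lambda>\<^sub>2\<^sub>k\<^sup>-\<^sup>1 = \<plusminus>1\<close>.
\<close>

definition free_scalar :: "(nat \<Rightarrow> complex) \<Rightarrow> nat \<Rightarrow> complex" where
  "free_scalar z i = (if i = 1 then 1 else z (i - 1))"

text \<open>With Q the alternating product of the free scalars, the relation reads
  \<open>Q * inverse \<lambda>\<^sub>2\<^sub>k * e = 1\<close>, because 2k is even; hence
  \<open>\<lambda>\<^sub>2\<^sub>k = e * Q\<close>.\<close>

definition scalars :: "complex \<Rightarrow> (nat \<Rightarrow> complex) \<Rightarrow> nat \<Rightarrow> complex" where
  "scalars e z j = (if j < 2 * k then free_scalar z j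
     else e * (\<Prod>i\<in>{1..<2 * k}. if odd i then free_scalar z i else inverse (free_scalar z i)))"

definition lift :: "mat2 tuple \<times> (nat \<Rightarrow> complex) \<Rightarrow> (mat2 \<times> bool) tuple" where
  "lift p = (fst (fst p), fst (snd (fst p)),
     \<lambda>j\<in>{1..2 * k}. (mat (scalars (sign (fst p)) (snd p) j) ** snd (snd (fst p)) j, True))"

section \<open>Points: splitting off the scalars, projection and lift\<close>

text \<open>The product of \<open>a j\<close> with this trace is \<open>(a j)\<^sup>2 + 1\<close>;
  this is where the exclusion of -1 enters.\<close>

lemma trace_nonzero:
  assumes "j \<in> {1..2 * k}"
  shows "a j + inverse (a j) \<noteq> 0"
proof
  assume "a j + inverse (a j) = 0"
  then have "a j * (a j + inverse (a j)) = 0" by simp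
  then have "(a j)\<^sup>2 + 1 = 0" using a[OF assms] by (simp add: algebra_simps power2_eq_square)
  then show False using a2[OF assms] by (simp add: add_eq_0_iff2)
qed

lemma scalar_part_eq:
  "j \<in> {1..2 * k} \<Longrightarrow> Y \<in> class_SL2 (a j) \<Longrightarrow> scalar_part j (mat c ** Y, True) = c"
  using trace_nonzero[of j] by (simp add: scalar_part_def trace_mat_mult class_SL2_trace)

lemma SL2_part_eq:
  "j \<in> {1..2 * k} \<Longrightarrow> Y \<in> class_SL2 (a j) \<Longrightarrow> c \<noteq> 0 \<Longrightarrow> SL2_part j (mat c ** Y, True) = Y"
  by (simp add: SL2_part_def scalar_part_eq mat_mult_mat_assoc)

lemma class_sigma_parts:
  assumes j: "j \<in> {1..2 * k}" and x: "x \<in> class_sigma (a j)"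
  shows "scalar_part j x \<noteq> 0" "SL2_part j x \<in> class_SL2 (a j)"
    "x = (mat (scalar_part j x) ** SL2_part j x, True)"
    "det (fst x) = (scalar_part j x)\<^sup>2"
proof -
  obtain c Y where x: "x = (mat c ** Y, True)" "c \<noteq> 0" "Y \<in> class_SL2 (a j)"
    using x by (auto simp: class_sigma_eq)
  show "scalar_part j x \<noteq> 0" "SL2_part j x \<in> class_SL2 (a j)"
    "x = (mat (scalar_part j x) ** SL2_part j x, True)"
    "det (fst x) = (scalar_part j x)\<^sup>2"
    using j x a[OF j] by (simp_all add: scalar_part_eq SL2_part_eq det_mat_mult class_SL2_det)
qed

lemma det_class: "j \<in> {1..2 * k} \<Longrightarrow> Y \<in> class_SL2 (a j) \<Longrightarrow> det Y = 1"
  using a class_SL2_det by blast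

lemma points_W: "points W = W_points (mat 1) \<union> W_points (- mat 1)"
  and points_V: "points V = V_points"
  by (simp_all add: W_def V_def)

lemma variety_algebra_W: "variety_algebra W" and variety_algebra_V: "variety_algebra V"
  unfolding W_def V_def by (rule variety_algebra_variety_on)+

lemma points_W_iff:
  "(A, B, Y) \<in> points W \<longleftrightarrow>
    A \<in> {1..g} \<rightarrow>\<^sub>E carrier GL2 \<and> B \<in> {1..g} \<rightarrow>\<^sub>E carrier GL2 \<and>
    Y \<in> (\<Pi>\<^sub>E j\<in>{1..2 * k}. class_SL2 (a j)) \<and>
    (word g (2 * k) (A, B, Y) = mat 1 \<or> word g (2 * k) (A, B, Y) = mat (-1))"
  unfolding points_W W_points_def rep_points_def word_def uminus_mat_1 by auto

lemma sign_W:
  assumes "w \<in> points W"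
  shows "word g (2 * k) w = mat (sign w)" "sign w = 1 \<or> sign w = -1"
    "w \<in> W_points (mat 1) \<longleftrightarrow> sign w = 1"
proof -
  obtain A B Y where w: "w = (A, B, Y)" by (cases w)
  have *: "word g (2 * k) w = mat 1 \<or> word g (2 * k) w = mat (-1)"
    using assms points_W_iff by (simp add: w)
  moreover have "(mat c :: mat2) $ 1 $ 1 = c" for c by (simp add: mat_def)
  ultimately show 1: "word g (2 * k) w = mat (sign w)" and 2: "sign w = 1 \<or> sign w = -1"
    unfolding sign_def by auto
  have "w \<in> W_points (mat 1) \<longleftrightarrow> word g (2 * k) w = mat 1"
    using assms unfolding points_W W_points_def rep_points_def word_def w by auto
  then show "w \<in> W_points (mat 1) \<longleftrightarrow> sign w = 1"
    by (simp add: 1 mat_eq_iff)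
qed

text \<open>In terms of scalars and \<open>SL2\<close> parts the relation is an equation in
  \<open>GL2\<close>. It is used both to read the relation off a given point and to show that lifts
  are points.\<close>

lemma points_V_iff:
  assumes "\<And>j. j \<in> {1..2 * k} \<Longrightarrow> c j \<noteq> 0 \<and> Y j \<in> class_SL2 (a j)"
  shows "(A, B, \<lambda>j\<in>{1..2 * k}. (mat (c j) ** Y j, True)) \<in> points V \<longleftrightarrow>
    A \<in> {1..g} \<rightarrow>\<^sub>E carrier GL2 \<and> B \<in> {1..g} \<rightarrow>\<^sub>E carrier GL2 \<and>
    mat (\<Prod>i\<in>{1..2 * k}. if odd i then c i else inverse (c i)) ** word g (2 * k) (A, B, Y) = mat 1"
    (is "(A, B, ?X) \<in> _ \<longleftrightarrow> _ \<and> _ \<and> ?rel")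
proof -
  have X: "?X \<in> (\<Pi>\<^sub>E j\<in>{1..2 * k}. class_sigma (a j))"
  proof (rule PiE_I)
    fix j assume j: "j \<in> {1..2 * k}"
    then show "?X j \<in> class_sigma (a j)"
      using assms[OF j] by (simp add: class_sigma_eq) blast
  qed auto
  have "ordered_prod GL2_sigma g (\<lambda>i. commutator GL2_sigma (embed (A i)) (embed (B i)))
      \<otimes>\<^bsub>GL2_sigma\<^esub> ordered_prod GL2_sigma (2 * k) ?X = \<one>\<^bsub>GL2_sigma\<^esub> \<longleftrightarrow> ?rel"
    if "A \<in> {1..g} \<rightarrow>\<^sub>E carrier GL2" "B \<in> {1..g} \<rightarrow>\<^sub>E carrier GL2"
    by (subst sigma_word[where c = c and Y = Y]) (use that assms det_class in auto)
  then show ?thesis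
    unfolding points_V V_points_def rep_points_def using X by blast
qed

lemma V_pointE:
  assumes "x \<in> points V"
  obtains A B X where "x = (A, B, X)"
    "A \<in> {1..g} \<rightarrow>\<^sub>E carrier GL2" "B \<in> {1..g} \<rightarrow>\<^sub>E carrier GL2"
    "X \<in> (\<Pi>\<^sub>E j\<in>{1..2 * k}. class_sigma (a j))"
  using assms unfolding points_V V_points_def rep_points_def by auto

lemma V_point_class: "x \<in> points V \<Longrightarrow> j \<in> {1..2 * k} \<Longrightarrow> snd (snd x) j \<in> class_sigma (a j)"
  by (elim V_pointE) auto

lemma word_cong:
  "(\<And>j. j \<in> {1..n} \<Longrightarrow> Y j = Y' j) \<Longrightarrow> word g n (A, B, Y) = word g n (A, B, Y')"
  using ordered_prod_cong[of n Y Y' GL2] by (simp add: word_def)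

lemma V_point_relation:
  assumes "x \<in> points V"
  defines "c \<equiv> \<lambda>j. scalar_part j (snd (snd x) j)"
  shows "mat (\<Prod>i\<in>{1..2 * k}. if odd i then c i else inverse (c i)) ** word g (2 * k) (proj x) = mat 1"
proof -
  obtain A B X where x: "x = (A, B, X)" "X \<in> (\<Pi>\<^sub>E j\<in>{1..2 * k}. class_sigma (a j))"
    using assms(1) by (rule V_pointE) blast
  define Y where "Y = (\<lambda>j. SL2_part j (X j))"
  have cl: "X j \<in> class_sigma (a j)" if "j \<in> {1..2 * k}" for j using x(2) that by auto
  have "X = (\<lambda>j\<in>{1..2 * k}. X j)" using x(2) by (auto simp: PiE_restrict)
  also have "\<dots> = (\<lambda>j\<in>{1..2 * k}. (mat (c j) ** Y j, True))"
    using class_sigma_parts(3)[OF _ cl] by (intro restrict_ext) (simp add: c_def Y_def x(1))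
  finally have X: "X = \<dots>" .
  have "(A, B, \<lambda>j\<in>{1..2 * k}. (mat (c j) ** Y j, True)) \<in> points V"
    using assms(1) unfolding x(1) by (subst (asm) X)
  then have "mat (\<Prod>i\<in>{1..2 * k}. if odd i then c i else inverse (c i)) ** word g (2 * k) (A, B, Y) = mat 1"
    by (subst (asm) points_V_iff)
       (use class_sigma_parts[OF _ cl] in \<open>simp_all add: c_def Y_def x(1)\<close>)
  also have "word g (2 * k) (A, B, Y) = word g (2 * k) (proj x)"
    unfolding proj_def x(1) fst_conv snd_conv by (rule word_cong) (simp add: Y_def)
  finally show ?thesis .
qed

lemma proj_points: "x \<in> points V \<Longrightarrow> proj x \<in> points W"
proof -
  assume x: "x \<in> points V"
  then obtain A B X where x': "x = (A, B, X)"
    "A \<in> {1..g} \<rightarrow>\<^sub>E carrier GL2" "B \<in> {1..g} \<rightarrow>\<^sub>E carrier GL2"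
    "X \<in> (\<Pi>\<^sub>E j\<in>{1..2 * k}. class_sigma (a j))" by (rule V_pointE)
  define Y where "Y = (\<lambda>j\<in>{1..2 * k}. SL2_part j (X j))"
  have Y: "Y \<in> (\<Pi>\<^sub>E j\<in>{1..2 * k}. class_SL2 (a j))"
    using class_sigma_parts(2)[OF _ PiE_mem[OF x'(4)]] by (auto simp: Y_def)
  have p: "proj x = (A, B, Y)" by (simp add: proj_def x'(1) Y_def)
  have AB: "invertible (A i) \<and> invertible (B i)" if "i \<in> {1..g}" for i
    using x'(2,3) that by auto
  define P where "P = (\<Prod>i\<in>{1..2 * k}. if odd i then scalar_part i (X i) else inverse (scalar_part i (X i)))"
  have rel: "mat P ** word g (2 * k) (A, B, Y) = mat 1"
    using V_point_relation[OF x, unfolded p] unfolding P_def x'(1) fst_conv snd_conv .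
  have det: "det (word g (2 * k) (A, B, Y)) = 1"
    by (rule det_word) (use AB det_class[OF _ PiE_mem[OF Y]] in auto)
  have "det (mat P ** word g (2 * k) (A, B, Y)) = 1" by (simp add: rel)
  then have P: "P = 1 \<or> P = -1" by (simp add: det_mat_mult det power2_eq_1_iff)
  then have "P \<noteq> 0" by auto
  then have "word g (2 * k) (A, B, Y) = mat (inverse P)"
    using rel mat_mult_eq_mat_iff by blast
  with P show ?thesis unfolding p points_W_iff using x' Y by auto
qed

lemma lift_points:
  assumes w: "w \<in> points W" and z: "z \<in> points (torus (2 * k - 2))"
  shows "lift (w, z) \<in> points V"
    and "\<And>j. j \<in> {1..2 * k} \<Longrightarrow> scalars (sign w) z j \<noteq> 0"
proof -
  obtain A B Y where w': "w = (A, B, Y)" by (cases w)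
  have Y: "Y j \<in> class_SL2 (a j)" if "j \<in> {1..2 * k}" for j
    using w that unfolding w' points_W_iff by (blast intro: PiE_mem)
  have free: "free_scalar z i \<noteq> 0" if "i \<in> {1..<2 * k}" for i
  proof (cases "i = 1")
    case False
    then have "i - 1 \<in> {1..2 * k - 2}" using that by auto
    then have "z (i - 1) \<noteq> 0" using z by (auto simp: torus_def)
    then show ?thesis using False by (simp add: free_scalar_def)
  qed (simp add: free_scalar_def)
  define Q where "Q = (\<Prod>i\<in>{1..<2 * k}. if odd i then free_scalar z i else inverse (free_scalar z i))"
  have Q: "Q \<noteq> 0" using free by (simp add: Q_def)
  have s: "sign w = 1 \<or> sign w = -1" by (rule sign_W(2)[OF w])
  show nz: "scalars (sign w) z j \<noteq> 0" if "j \<in> {1..2 * k}" for j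
    using free that Q s by (auto simp: scalars_def Q_def[symmetric])
  \<comment> \<open>The top index is even, so its scalar enters inverted. It contains the factor
    \<open>Q\<close>, which cancels against the rest and leaves the inverse of the sign, which is
    the sign.\<close>
  have ivl: "{1..2 * k} = insert (2 * k) {1..<2 * k}" using k by auto
  have "(\<Prod>i\<in>{1..2 * k}. if odd i then scalars (sign w) z i else inverse (scalars (sign w) z i)) =
      inverse (scalars (sign w) z (2 * k)) * Q"
    unfolding ivl Q_def by (subst prod.insert) (auto simp: scalars_def intro!: prod.cong)
  also have "scalars (sign w) z (2 * k) = sign w * Q"
    by (simp only: scalars_def Q_def less_irrefl if_False)
  also have "inverse (sign w * Q) * Q = sign w"
    using s Q by auto
  finally have P: "(\<Prod>i\<in>{1..2 * k}. if odd i then scalars (sign w) z i else inverse (scalars (sign w) z i)) = sign w" .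
  have "(A, B, \<lambda>j\<in>{1..2 * k}. (mat (scalars (sign w) z j) ** Y j, True)) \<in> points V"
  proof (subst points_V_iff, goal_cases)
    case (1 j)
    then show ?case using nz Y by blast
  next
    case 2
    have "mat (sign w) ** word g (2 * k) (A, B, Y) = mat 1"
      using sign_W(1)[OF w] s by (auto simp: w' mat_mult_mat)
    then show ?case using w unfolding P[unfolded w'] w' points_W_iff by blast
  qed
  then show "lift (w, z) \<in> points V" by (simp add: lift_def w')
qed

lemma proj_lift:
  assumes w: "w \<in> points W" and z: "z \<in> points (torus (2 * k - 2))"
  shows "proj (lift (w, z)) = w"
proof -
  obtain A B Y where w': "w = (A, B, Y)" by (cases w)
  have Y: "Y \<in> (\<Pi>\<^sub>E j\<in>{1..2 * k}. class_SL2 (a j))"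
    using w by (simp only: w' points_W_iff)
  have "(\<lambda>j\<in>{1..2 * k}. SL2_part j (mat (scalars (sign w) z j) ** Y j, True)) = (\<lambda>j\<in>{1..2 * k}. Y j)"
    by (rule restrict_ext) (rule SL2_part_eq[OF _ PiE_mem[OF Y] lift_points(2)[OF w z]])
  also have "\<dots> = Y" by (rule PiE_restrict[OF Y])
  finally have *: "(\<lambda>j\<in>{1..2 * k}. SL2_part j (mat (scalars (sign w) z j) ** Y j, True)) = Y" .
  have "proj (lift (w, z)) =
      (A, B, \<lambda>j\<in>{1..2 * k}. SL2_part j (mat (scalars (sign w) z j) ** Y j, True))"
    by (simp add: proj_def lift_def w' cong: restrict_cong)
  then show ?thesis unfolding * by (simp add: w')
qed

lemma scalar_part_lift:
  assumes w: "w \<in> points W" and j: "j \<in> {1..2 * k}"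
  shows "scalar_part j (snd (snd (lift (w, z))) j) = scalars (sign w) z j"
proof -
  obtain A B Y where w': "w = (A, B, Y)" by (cases w)
  have Y: "Y \<in> (\<Pi>\<^sub>E j\<in>{1..2 * k}. class_SL2 (a j))"
    using w by (simp only: w' points_W_iff)
  show ?thesis
    using scalar_part_eq[OF j PiE_mem[OF Y j]] j by (simp add: lift_def w')
qed

lemma ratios_lift:
  assumes w: "w \<in> points W" and z: "z \<in> points (torus (2 * k - 2))"
  shows "ratios (lift (w, z)) = z"
proof (rule extensionalityI[of _ "{1..2 * k - 2}"])
  show "ratios (lift (w, z)) \<in> extensional {1..2 * k - 2}" by (simp add: ratios_def)
  show "z \<in> extensional {1..2 * k - 2}" using z by (simp add: torus_def PiE_def)
  fix i assume i: "i \<in> {1..2 * k - 2}"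
  \<comment> \<open>\<open>i + 1\<close> stays below \<open>2 * k\<close>, so only free scalars
    occur and the dependent one never appears among the ratios.\<close>
  then have "i + 1 \<in> {1..2 * k}" "1 \<in> {1..2 * k}" "i + 1 < 2 * k" "1 < 2 * k" by auto
  with i show "ratios (lift (w, z)) i = z i"
    by (simp only: ratios_def restrict_apply if_True scalar_part_lift[OF w])
       (simp add: scalars_def free_scalar_def)
qed

section \<open>Equivariance and orbits\<close>

lemma actW_points:
  assumes h: "h \<in> carrier GL2" and c: "c = mat 1 \<or> c = - mat 1" and w: "w \<in> W_points c"
  shows "actW h w \<in> W_points c"
  unfolding W_points_def
proof (rule simultaneous_conj_rep_points[OF group_GL2 _ h])
  show "group_hom GL2 GL2 (\<lambda>M. M)"
    by (auto simp: group_hom_def group_hom_axioms_def group_GL2 hom_def)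
  show "conjugate GL2 h c = c"
    using c h by (auto simp: uminus_mat_1 conjugate_GL2_mat)
  show "w \<in> rep_points GL2 (\<lambda>M. M) g (2 * k) (\<lambda>j. class_SL2 (a j)) c"
    using w by (simp add: W_points_def)
  fix j assume j: "j \<in> {1..2 * k}"
  show "class_SL2 (a j) \<subseteq> carrier GL2"
    using det_class[OF j] by (auto simp: invertible_det_nz)
  fix Y assume "Y \<in> class_SL2 (a j)"
  then show "conjugate GL2 h Y \<in> class_SL2 (a j)" using h by (simp add: class_SL2_conjugate)
qed

lemma actV_points:
  assumes h: "h \<in> carrier GL2" and x: "x \<in> points V"
  shows "actV h x \<in> points V"
  unfolding points_V V_points_def
proof (rule simultaneous_conj_rep_points[OF group_GL2_sigma _ h])
  show "group_hom GL2 GL2_sigma embed"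
    by (simp add: group_hom_def group_hom_axioms_def group_GL2 group_GL2_sigma embed_hom)
  interpret group GL2_sigma by (rule group_GL2_sigma)
  have "embed h \<in> carrier GL2_sigma" using h by (simp add: embed_def)
  then show "conjugate GL2_sigma (embed h) \<one>\<^bsub>GL2_sigma\<^esub> = \<one>\<^bsub>GL2_sigma\<^esub>"
    by (simp add: conjugate_def del: GL2_sigma_simps)
  show "x \<in> rep_points GL2_sigma embed g (2 * k) (\<lambda>j. class_sigma (a j)) \<one>\<^bsub>GL2_sigma\<^esub>"
    using x by (simp only: points_V V_points_def)
  fix j assume j: "j \<in> {1..2 * k}"
  show "class_sigma (a j) \<subseteq> carrier GL2_sigma"
    using det_class[OF j] by (auto simp: class_sigma_eq invertible_det_nz det_mat_mult)
  fix X assume "X \<in> class_sigma (a j)"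
  then show "conjugate GL2_sigma (embed h) X \<in> class_sigma (a j)"
    using h by (simp add: class_sigma_conjugate)
qed

lemma parts_conjugate:
  assumes h: "invertible h" and j: "j \<in> {1..2 * k}" and X: "X \<in> class_sigma (a j)"
  shows "scalar_part j (conjugate GL2_sigma (embed h) X) = det h * scalar_part j X"
    and "SL2_part j (conjugate GL2_sigma (embed h) X) = conjugate GL2 h (SL2_part j X)"
proof -
  obtain c Y where X: "X = (mat c ** Y, True)" "c \<noteq> 0" "Y \<in> class_SL2 (a j)"
    using X by (auto simp: class_sigma_eq)
  have d: "det h \<noteq> 0" using h by (simp add: invertible_det_nz)
  show "scalar_part j (conjugate GL2_sigma (embed h) X) = det h * scalar_part j X"
    "SL2_part j (conjugate GL2_sigma (embed h) X) = conjugate GL2 h (SL2_part j X)"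
    using d X class_SL2_conjugate[OF h X(3)]
    by (simp_all add: conjugate_sigma_scaled h scalar_part_eq[OF j] SL2_part_eq[OF j])
qed

lemma proj_actV:
  assumes h: "h \<in> carrier GL2" and x: "x \<in> points V"
  shows "proj (actV h x) = actW h (proj x)"
proof -
  have "(\<lambda>j\<in>{1..2 * k}. SL2_part j (conjugate GL2_sigma (embed h) (snd (snd x) j))) =
      (\<lambda>j\<in>{1..2 * k}. conjugate GL2 h (SL2_part j (snd (snd x) j)))"
    using h by (intro restrict_ext parts_conjugate V_point_class[OF x]) simp
  then show ?thesis
    unfolding proj_def simultaneous_conj_def case_prod_unfold fst_conv snd_conv
    by (simp cong: restrict_cong)
qed

text \<open>All scalars are multiplied by the same \<open>det h\<close>, which cancels against the
  one in \<open>\<lambda>\<^sub>1\<close>.\<close>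

lemma ratios_actV:
  assumes h: "h \<in> carrier GL2" and x: "x \<in> points V"
  shows "ratios (actV h x) = ratios x"
proof -
  have d: "det h \<noteq> 0" using h by (simp add: invertible_det_nz)
  have s: "scalar_part j (snd (snd (actV h x)) j) = det h * scalar_part j (snd (snd x) j)"
    if j: "j \<in> {1..2 * k}" for j
    using parts_conjugate(1)[OF _ j V_point_class[OF x j]] h j
    by (simp add: simultaneous_conj_def case_prod_unfold)
  show ?thesis
    unfolding ratios_def
  proof (rule restrict_ext)
    fix i assume i: "i \<in> {1..2 * k - 2}"
    then have "i + 1 \<in> {1..2 * k}" "1 \<in> {1..2 * k}" by auto
    then show "scalar_part (i + 1) (snd (snd (actV h x)) (i + 1)) *
        inverse (scalar_part 1 (snd (snd (actV h x)) 1)) =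
      scalar_part (i + 1) (snd (snd x) (i + 1)) * inverse (scalar_part 1 (snd (snd x) 1))"
      using d by (simp only: s inverse_mult_distrib) simp
  qed
qed

text \<open>
  Conjugation by the scalar matrix \<open>u\<close> multiplies every \<open>\<lambda>\<^sub>j\<close> by \<open>u\<^sup>2\<close> and fixes everything else, so
  each orbit meets the slice \<open>\<lambda>\<^sub>1 = 1\<close>.
\<close>

lemma lift_in_orbit:
  assumes x: "x \<in> points V"
  shows "\<exists>h\<in>carrier GL2. actV h x = lift (proj x, ratios x)"
proof -
  define c where "c = (\<lambda>j. scalar_part j (snd (snd x) j))"
  define Y where "Y = (\<lambda>j. SL2_part j (snd (snd x) j))"
  \<comment> \<open>The matrix \<open>mat u\<close> has determinant \<open>u\<^sup>2\<close>, hence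
    the square root. It is chosen for each point separately.\<close>
  define u where "u = csqrt (inverse (c 1))"
  have cl: "snd (snd x) j \<in> class_sigma (a j)" if "j \<in> {1..2 * k}" for j
    by (rule V_point_class[OF x that])
  have c: "c j \<noteq> 0" if "j \<in> {1..2 * k}" for j
    using class_sigma_parts(1)[OF that cl[OF that]] by (simp add: c_def)
  have c1: "c 1 \<noteq> 0" using c[of 1] k by simp
  have u: "u \<noteq> 0" "u\<^sup>2 = inverse (c 1)" using c1 by (simp_all add: u_def)
  have h: "mat u \<in> carrier GL2" using u(1) by (simp add: invertible_det_nz det_mat_2)
  let ?y = "actV (mat u) x"
  have cy: "scalar_part j (snd (snd ?y) j) = c j * inverse (c 1)" if j: "j \<in> {1..2 * k}" for j
    using parts_conjugate(1)[OF _ j cl[OF j]] h j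
    by (simp add: simultaneous_conj_def case_prod_unfold c_def det_mat_2 u(2)[unfolded c_def])
  have pw: "proj x \<in> points W" by (rule proj_points[OF x])
  have py: "proj ?y = proj x"
  proof -
    have "actW (mat u) w = w" if "w \<in> points W" for w
    proof -
      obtain A B Z where w: "w = (A, B, Z)" by (cases w)
      then have "A \<in> {1..g} \<rightarrow>\<^sub>E carrier GL2" "B \<in> {1..g} \<rightarrow>\<^sub>E carrier GL2"
        "Z \<in> (\<Pi>\<^sub>E j\<in>{1..2 * k}. class_SL2 (a j))"
        using that points_W_iff by blast+
      then show ?thesis
        by (simp only: w simultaneous_conj_def prod.case conjugate_by_mat[OF u(1)] PiE_restrict)
    qed
    then show ?thesis using proj_actV[OF h x] pw by simp
  qed
  have sc: "c j * inverse (c 1) = scalars (sign (proj x)) (ratios x) j" if j: "j \<in> {1..2 * k}" for j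
  proof -
    have free: "free_scalar (ratios x) i = c i * inverse (c 1)" if i: "i \<in> {1..<2 * k}" for i
    proof (cases "i = 1")
      case False
      then have "i - 1 \<in> {1..2 * k - 2}" "i - 1 + 1 = i" using i by auto
      then show ?thesis using False by (simp only: free_scalar_def ratios_def c_def restrict_apply if_True if_False)
    qed (use c1 in \<open>simp add: free_scalar_def\<close>)
    show ?thesis
    proof (cases "j < 2 * k")
      case True
      then show ?thesis using free[of j] j by (simp add: scalars_def)
    next
      case False
      then have j2: "j = 2 * k" using j by auto
      define Q where "Q = (\<Prod>i\<in>{1..<2 * k}. if odd i then free_scalar (ratios x) i
        else inverse (free_scalar (ratios x) i))"
      \<comment> \<open>The relation is applied to the normalized point \<open>?y\<close>. Its word
        is still \<open>sign (proj x)\<close> since \<open>proj ?y = proj x\<close>, and all its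
        other scalars are known, so the last one is determined.\<close>
      let ?d = "\<lambda>i. scalar_part i (snd (snd ?y) i)"
      have ivl: "{1..2 * k} = insert (2 * k) {1..<2 * k}" using k by auto
      have "(\<Prod>i\<in>{1..2 * k}. if odd i then ?d i else inverse (?d i)) =
          inverse (?d (2 * k)) * (\<Prod>i\<in>{1..<2 * k}. if odd i then ?d i else inverse (?d i))"
        unfolding ivl by (subst prod.insert) auto
      also have "(\<Prod>i\<in>{1..<2 * k}. if odd i then ?d i else inverse (?d i)) = Q"
        unfolding Q_def by (rule prod.cong[OF refl]) (simp add: cy free)
      also have "?d (2 * k) = c j * inverse (c 1)" using cy j j2 by simp
      finally have "mat (inverse (c j * inverse (c 1)) * Q) ** mat (sign (proj x)) = (mat 1 :: mat2)"
        using V_point_relation[OF actV_points[OF h x]] by (simp only: py sign_W(1)[OF pw])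
      then have "inverse (c j * inverse (c 1)) * Q * sign (proj x) = 1"
        by (simp only: mat_mult_mat mat_eq_iff)
      then have "sign (proj x) * Q = c j * inverse (c 1)"
        using c[OF j] c1 by (simp add: field_simps)
      then show ?thesis by (simp only: scalars_def j2 less_irrefl if_False Q_def)
    qed
  qed
  have ypt: "?y \<in> points V" by (rule actV_points[OF h x])
  have "snd (snd ?y) = (\<lambda>j\<in>{1..2 * k}. snd (snd ?y) j)"
    by (rule extensional_restrict[symmetric]) (simp add: simultaneous_conj_def case_prod_unfold)
  also have "\<dots> = (\<lambda>j\<in>{1..2 * k}. (mat (scalars (sign (proj x)) (ratios x) j) ** snd (snd (proj x)) j, True))"
  proof (rule restrict_ext)
    fix j assume j: "j \<in> {1..2 * k}"
    have "snd (snd ?y) j = (mat (scalar_part j (snd (snd ?y) j)) ** SL2_part j (snd (snd ?y) j), True)"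
      by (rule class_sigma_parts(3)[OF j V_point_class[OF ypt j]])
    also have "scalar_part j (snd (snd ?y) j) = scalars (sign (proj x)) (ratios x) j"
      by (simp only: cy[OF j] sc[OF j])
    also have "SL2_part j (snd (snd ?y) j) = snd (snd (proj ?y)) j"
      using j by (simp add: proj_def)
    finally show "snd (snd ?y) j = (mat (scalars (sign (proj x)) (ratios x) j) ** snd (snd (proj x)) j, True)"
      by (simp only: py)
  qed
  finally have "snd (snd ?y) = snd (snd (lift (proj x, ratios x)))" by (simp add: lift_def)
  moreover have "fst ?y = fst (proj ?y)" "fst (snd ?y) = fst (snd (proj ?y))"
    by (simp_all add: proj_def)
  ultimately have "?y = lift (proj x, ratios x)"
    by (simp add: prod_eq_iff py lift_def)
  then show ?thesis using h by blast
qed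

section \<open>Regularity of projection, ratios and lift\<close>

lemma regular_coords_V:
  assumes "c \<in> coords_GL2"
  shows "i \<in> {1..g} \<Longrightarrow> (\<lambda>x\<in>points V. c (fst x i)) \<in> regular V"
    and "i \<in> {1..g} \<Longrightarrow> (\<lambda>x\<in>points V. c (fst (snd x) i)) \<in> regular V"
    and "j \<in> {1..2 * k} \<Longrightarrow> (\<lambda>x\<in>points V. c (fst (snd (snd x) j))) \<in> regular V"
  unfolding V_def points_variety_on
  by (rule regular_tuple_coords[OF assms] regular_tuple_coords_class[OF coords_GL2_sigma_fst[OF assms]];
      assumption)+

lemma regular_coords_W:
  assumes "c \<in> coords_GL2"
  shows "i \<in> {1..g} \<Longrightarrow> (\<lambda>w\<in>points W. c (fst w i)) \<in> regular W"
    and "i \<in> {1..g} \<Longrightarrow> (\<lambda>w\<in>points W. c (fst (snd w) i)) \<in> regular W"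
    and "j \<in> {1..2 * k} \<Longrightarrow> (\<lambda>w\<in>points W. c (snd (snd w) j)) \<in> regular W"
  unfolding W_def points_variety_on
  by (rule regular_tuple_coords[OF assms] regular_tuple_coords_class[OF assms]; assumption)+

text \<open>The scalar is a constant multiple of the trace. Its inverse is the scalar times the
  inverse determinant, because the determinant is the square of the scalar.\<close>

lemma regular_V_scalar:
  assumes j: "j \<in> {1..2 * k}"
  shows "(\<lambda>x\<in>points V. scalar_part j (snd (snd x) j)) \<in> regular V"
    and "(\<lambda>x\<in>points V. inverse (scalar_part j (snd (snd x) j))) \<in> regular V"
proof -
  note A = variety_algebra_V
  have c: "(\<lambda>x\<in>points V. d (fst (snd (snd x) j))) \<in> regular V" if "d \<in> coords_GL2" for d
    by (rule regular_coords_V(3)[OF that j])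
  have "(\<lambda>x\<in>points V. inverse (a j + inverse (a j)) *
      (fst (snd (snd x) j) $ 1 $ 1 + fst (snd (snd x) j) $ 2 $ 2)) \<in> regular V"
    by (intro function_algebra_scale[OF A] function_algebra_add[OF A] c coords_GL2_entry)
  also have "(\<lambda>x\<in>points V. inverse (a j + inverse (a j)) *
      (fst (snd (snd x) j) $ 1 $ 1 + fst (snd (snd x) j) $ 2 $ 2)) =
    (\<lambda>x\<in>points V. scalar_part j (snd (snd x) j))"
    by (rule restrict_ext) (simp add: scalar_part_def trace_def sum_2 divide_inverse mult.commute)
  finally show 1: "(\<lambda>x\<in>points V. scalar_part j (snd (snd x) j)) \<in> regular V" .
  have "(\<lambda>x\<in>points V. scalar_part j (snd (snd x) j) * inverse (det (fst (snd (snd x) j)))) \<in> regular V"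
    by (rule function_algebra_mult[OF A 1 c[OF coords_GL2_inverse_det]])
  also have "(\<lambda>x\<in>points V. scalar_part j (snd (snd x) j) * inverse (det (fst (snd (snd x) j)))) =
    (\<lambda>x\<in>points V. inverse (scalar_part j (snd (snd x) j)))"
  proof (rule restrict_ext)
    fix x assume "x \<in> points V"
    note p = class_sigma_parts[OF j V_point_class[OF this j]]
    show "scalar_part j (snd (snd x) j) * inverse (det (fst (snd (snd x) j))) =
        inverse (scalar_part j (snd (snd x) j))"
      using p(1) by (simp add: p(4) power2_eq_square)
  qed
  finally show "(\<lambda>x\<in>points V. inverse (scalar_part j (snd (snd x) j))) \<in> regular V" .
qed

lemma morphism_proj: "morphism V W proj"
  unfolding W_def
  unfolding points_W[symmetric]
proof (rule morphism_variety_onI[OF variety_algebra_V proj_points])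
  note A = variety_algebra_V
  fix f assume "f \<in> tuple_coords coords_GL2 g (2 * k)"
  then show "(\<lambda>x\<in>points V. f (proj x)) \<in> regular V"
  proof (cases rule: tuple_coordsE)
    case (1 c i)
    then show ?thesis
      using regular_coords_V(1)[OF 1(1,2)] by (simp add: proj_def)
  next
    case (2 c i)
    then show ?thesis
      using regular_coords_V(2)[OF 2(1,2)] by (simp add: proj_def)
  next
    case (3 c j)
    from 3(1) show ?thesis
    proof (cases rule: coords_GL2E)
      case (1 r s)
      have "(\<lambda>x\<in>points V. (fst (snd (snd x) j)) $ r $ s) \<in> regular V"
        by (rule regular_coords_V(3)[OF coords_GL2_entry 3(2)])
      then have "(\<lambda>x\<in>points V. inverse (scalar_part j (snd (snd x) j)) * (fst (snd (snd x) j)) $ r $ s) \<in> regular V"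
        by (rule function_algebra_mult[OF A regular_V_scalar(2)[OF 3(2)]])
      also have "(\<lambda>x\<in>points V. inverse (scalar_part j (snd (snd x) j)) * (fst (snd (snd x) j)) $ r $ s) =
          (\<lambda>x\<in>points V. f (proj x))"
        using 3(2) by (intro restrict_ext) (simp add: 3(3) 1 proj_def SL2_part_def mat_mult_entries)
      finally show ?thesis .
    next
      case 2
      \<comment> \<open>The inverse determinant pulls back to a constant because the projected
        matrices have determinant 1.\<close>
      have "(\<lambda>x\<in>points V. f (proj x)) = (\<lambda>x\<in>points V. 1)"
      proof (rule restrict_ext)
        fix x assume "x \<in> points V"
        then have "det (SL2_part j (snd (snd x) j)) = 1"
          using 3(2) by (intro det_class[OF 3(2)] class_sigma_parts V_point_class)
        then show "f (proj x) = 1" using 3(2) by (simp add: 3(3) 2 proj_def)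
      qed
      then show ?thesis by (simp only: function_algebra_const[OF A])
    qed
  qed
qed

lemma morphism_ratios: "morphism V (torus (2 * k - 2)) ratios"
  unfolding torus_def
proof (rule morphism_variety_onI[OF variety_algebra_V])
  have one: "1 \<in> {1..2 * k}" using k by simp
  fix x assume x: "x \<in> points V"
  have nz: "scalar_part j (snd (snd x) j) \<noteq> 0" if "j \<in> {1..2 * k}" for j
    by (rule class_sigma_parts(1)[OF that V_point_class[OF x that]])
  show "ratios x \<in> {1..2 * k - 2} \<rightarrow>\<^sub>E - {0}"
  proof (rule PiE_I)
    fix i assume i: "i \<in> {1..2 * k - 2}"
    then have "i + 1 \<in> {1..2 * k}" by auto
    then show "ratios x i \<in> - {0}" using i nz[of "i + 1"] nz[OF one] by (simp add: ratios_def)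
  qed (auto simp: ratios_def)
next
  note A = variety_algebra_V
  have one: "1 \<in> {1..2 * k}" using k by simp
  fix f :: "(nat \<Rightarrow> complex) \<Rightarrow> complex"
  assume "f \<in> {\<lambda>z. z i |i. i \<in> {1..2 * k - 2}} \<union> {\<lambda>z. inverse (z i) |i. i \<in> {1..2 * k - 2}}"
  then obtain i where i: "i \<in> {1..2 * k - 2}" and f: "f = (\<lambda>z. z i) \<or> f = (\<lambda>z. inverse (z i))"
    by blast
  have i1: "i + 1 \<in> {1..2 * k}" using i by auto
  from f show "(\<lambda>x\<in>points V. f (ratios x)) \<in> regular V"
  proof
    assume f: "f = (\<lambda>z. z i)"
    have "(\<lambda>x\<in>points V. f (ratios x)) = (\<lambda>x\<in>points V.
        scalar_part (i + 1) (snd (snd x) (i + 1)) * inverse (scalar_part 1 (snd (snd x) 1)))"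
      using i by (simp add: f ratios_def)
    also have "\<dots> \<in> regular V"
      by (rule function_algebra_mult[OF A regular_V_scalar(1)[OF i1] regular_V_scalar(2)[OF one]])
    finally show ?thesis .
  next
    assume f: "f = (\<lambda>z. inverse (z i))"
    have "(\<lambda>x\<in>points V. f (ratios x)) = (\<lambda>x\<in>points V.
        inverse (scalar_part (i + 1) (snd (snd x) (i + 1))) * scalar_part 1 (snd (snd x) 1))"
      using i by (simp add: f ratios_def)
    also have "\<dots> \<in> regular V"
      by (rule function_algebra_mult[OF A regular_V_scalar(2)[OF i1] regular_V_scalar(1)[OF one]])
    finally show ?thesis .
  qed
qed

lemma regular_sign: "(\<lambda>w\<in>points W. sign w) \<in> regular W"
proof -
  have "invertible (fst w i) \<and> invertible (fst (snd w) i)"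
    if w: "w \<in> points W" and i: "i \<in> {1..g}" for w i
  proof -
    have "fst w \<in> {1..g} \<rightarrow>\<^sub>E carrier GL2" "fst (snd w) \<in> {1..g} \<rightarrow>\<^sub>E carrier GL2"
      using w points_W_iff[of "fst w" "fst (snd w)" "snd (snd w)"] by simp_all
    then show ?thesis using i by auto
  qed
  then have "regular_matrix W (word g (2 * k))"
    using regular_matrix_word[of "points W" g "2 * k"] unfolding W_def points_variety_on by blast
  then show ?thesis by (simp add: regular_matrix_def sign_def)
qed

text \<open>The inverses are needed as well, since \<open>lift\<close> must pull the inverse
  determinant back to the inverse square of a scalar. They are regular because the torus has inverse
  coordinates among its generators and the sign is its own inverse.\<close>

lemma regular_scalars:
  assumes j: "j \<in> {1..2 * k}"
  defines "P \<equiv> product_variety W (torus (2 * k - 2))"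
  shows "(\<lambda>p\<in>points P. scalars (sign (fst p)) (snd p) j) \<in> regular P"
    and "(\<lambda>p\<in>points P. inverse (scalars (sign (fst p)) (snd p) j)) \<in> regular P"
proof -
  have A: "variety_algebra P" unfolding P_def by (rule variety_algebra_product)
  have sgn: "(\<lambda>p\<in>points P. sign (fst p)) \<in> regular P"
    using morphism_regular[OF morphism_fst regular_sign, of "torus (2 * k - 2)"]
    by (simp add: P_def mem_Times_iff cong: restrict_cong)
  have tor: "(\<lambda>p\<in>points P. snd p i) \<in> regular P" "(\<lambda>p\<in>points P. inverse (snd p i)) \<in> regular P"
    if i: "i \<in> {1..2 * k - 2}" for i
  proof -
    have "(\<lambda>z\<in>points (torus (2 * k - 2)). z i) \<in> regular (torus (2 * k - 2))"
      "(\<lambda>z\<in>points (torus (2 * k - 2)). inverse (z i)) \<in> regular (torus (2 * k - 2))"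
      using i by (auto simp: torus_def intro!: regular_variety_on generated_algebra.gen)
    from this[THEN morphism_regular[OF morphism_snd], of W]
    show "(\<lambda>p\<in>points P. snd p i) \<in> regular P" "(\<lambda>p\<in>points P. inverse (snd p i)) \<in> regular P"
      by (simp_all add: P_def mem_Times_iff cong: restrict_cong)
  qed
  have free: "(\<lambda>p\<in>points P. free_scalar (snd p) i) \<in> regular P \<and>
      (\<lambda>p\<in>points P. inverse (free_scalar (snd p) i)) \<in> regular P" if i: "i \<in> {1..<2 * k}" for i
  proof (cases "i = 1")
    case True
    then show ?thesis by (simp add: free_scalar_def function_algebra_const[OF A])
  next
    case False
    then have "i - 1 \<in> {1..2 * k - 2}" using i by auto
    from tor[OF this] False show ?thesis by (simp add: free_scalar_def)
  qed
  have prod: "(\<lambda>p\<in>points P. \<Prod>i\<in>{1..<2 * k}. if odd i then free_scalar (snd p) i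
      else inverse (free_scalar (snd p) i)) \<in> regular P"
    "(\<lambda>p\<in>points P. \<Prod>i\<in>{1..<2 * k}. if odd i then inverse (free_scalar (snd p) i)
      else free_scalar (snd p) i) \<in> regular P"
    by (rule function_algebra_prod[OF A], rename_tac i, case_tac "odd i"; use free in simp)+
  have "(\<lambda>p\<in>points P. scalars (sign (fst p)) (snd p) j) \<in> regular P \<and>
    (\<lambda>p\<in>points P. inverse (scalars (sign (fst p)) (snd p) j)) \<in> regular P"
  proof (cases "j < 2 * k")
    case True
    then show ?thesis using free[of j] j by (simp add: scalars_def)
  next
    case False
    \<comment> \<open>Inverting the alternating product exchanges the roles of odd and even indices,
      which brings it into the form of the second claim in \<open>prod\<close>.\<close>
    have "(\<lambda>p\<in>points P. inverse (scalars (sign (fst p)) (snd p) j)) =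
      (\<lambda>p\<in>points P. sign (fst p) * (\<Prod>i\<in>{1..<2 * k}. if odd i then inverse (free_scalar (snd p) i)
      else free_scalar (snd p) i))"
    proof (rule restrict_ext)
      fix p assume "p \<in> points P"
      then have "sign (fst p) = 1 \<or> sign (fst p) = -1"
        by (intro sign_W(2)) (auto simp: P_def)
      then have "inverse (sign (fst p)) = sign (fst p)" by auto
      moreover have "inverse (\<Prod>i\<in>{1..<2 * k}. if odd i then free_scalar (snd p) i
          else inverse (free_scalar (snd p) i)) =
        (\<Prod>i\<in>{1..<2 * k}. if odd i then inverse (free_scalar (snd p) i) else free_scalar (snd p) i)"
        unfolding prod_inversef[symmetric] comp_def by (rule prod.cong) auto
      ultimately show "inverse (scalars (sign (fst p)) (snd p) j) = sign (fst p) *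
        (\<Prod>i\<in>{1..<2 * k}. if odd i then inverse (free_scalar (snd p) i) else free_scalar (snd p) i)"
        using False by (simp only: scalars_def if_False inverse_mult_distrib)
    qed
    then show ?thesis
      using False function_algebra_mult[OF A sgn prod(1)] function_algebra_mult[OF A sgn prod(2)]
      by (simp only: scalars_def if_False simp_thms)
  qed
  then show "(\<lambda>p\<in>points P. scalars (sign (fst p)) (snd p) j) \<in> regular P"
    "(\<lambda>p\<in>points P. inverse (scalars (sign (fst p)) (snd p) j)) \<in> regular P" by blast+
qed

lemma morphism_lift: "morphism (product_variety W (torus (2 * k - 2))) V lift"
proof -
  let ?P = "product_variety W (torus (2 * k - 2))"
  note A = variety_algebra_product[of W "torus (2 * k - 2)"]
  have fst: "(\<lambda>p\<in>points ?P. f (fst p)) \<in> regular ?P" if "restrict f (points W) \<in> regular W" for f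
    using morphism_regular[OF morphism_fst that, of "torus (2 * k - 2)"]
    by (simp add: mem_Times_iff cong: restrict_cong)
  show ?thesis
    unfolding V_def
    unfolding points_V[symmetric]
  proof (rule morphism_variety_onI[OF A])
    fix p assume "p \<in> points ?P"
    then show "lift p \<in> points V" by (cases p) (auto intro: lift_points(1))
  next
    fix f assume "f \<in> tuple_coords coords_GL2_sigma g (2 * k)"
    then show "(\<lambda>p\<in>points ?P. f (lift p)) \<in> regular ?P"
    proof (cases rule: tuple_coordsE)
      case (1 c i)
      have "(\<lambda>w\<in>points W. c (fst w i)) \<in> regular W"
        by (rule regular_coords_W(1)[OF 1(1,2)])
      from fst[OF this] show ?thesis by (simp only: 1(3) lift_def fst_conv)
    next
      case (2 c i)
      have "(\<lambda>w\<in>points W. c (fst (snd w) i)) \<in> regular W"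
        by (rule regular_coords_W(2)[OF 2(1,2)])
      from fst[OF this] show ?thesis by (simp only: 2(3) lift_def fst_conv snd_conv)
    next
      case (3 c j)
      note sc = regular_scalars[OF 3(2)]
      from 3(1) show ?thesis
      proof (cases rule: coords_GL2_sigmaE)
        case (1 d)
        from 1(1) show ?thesis
        proof (cases rule: coords_GL2E)
          fix r s assume d: "d = (\<lambda>M. M $ r $ s)"
          have "(\<lambda>w\<in>points W. snd (snd w) j $ r $ s) \<in> regular W"
            by (rule regular_coords_W(3)[OF coords_GL2_entry 3(2)])
          from function_algebra_mult[OF A sc(1) fst[OF this]]
          show ?thesis using 3(2) by (simp add: 3(3) 1(2) d lift_def mat_mult_entries)
        next
          assume d: "d = (\<lambda>M. inverse (det M))"
          have "(\<lambda>p\<in>points ?P. inverse (scalars (sign (fst p)) (snd p) j) *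
              inverse (scalars (sign (fst p)) (snd p) j)) \<in> regular ?P"
            by (rule function_algebra_mult[OF A sc(2) sc(2)])
          also have "(\<lambda>p\<in>points ?P. inverse (scalars (sign (fst p)) (snd p) j) *
              inverse (scalars (sign (fst p)) (snd p) j)) = (\<lambda>p\<in>points ?P. f (lift p))"
          proof (rule restrict_ext)
            fix p assume "p \<in> points ?P"
            then have "fst p \<in> points W" by auto
            then have "snd (snd (fst p)) \<in> (\<Pi>\<^sub>E j\<in>{1..2 * k}. class_SL2 (a j))"
              using points_W_iff[of "fst (fst p)" "fst (snd (fst p))" "snd (snd (fst p))"] by simp
            then have "det (snd (snd (fst p)) j) = 1"
              using det_class[OF 3(2)] PiE_mem 3(2) by blast
            then show "inverse (scalars (sign (fst p)) (snd p) j) *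
                inverse (scalars (sign (fst p)) (snd p) j) = f (lift p)"
              using 3(2) by (simp add: 3(3) 1(2) d lift_def det_mat_mult power2_eq_square)
          qed
          finally show ?thesis .
        qed
      next
        case 2
        \<comment> \<open>All lifted elements lie in the component containing \<sigma>, where the
          component coordinate is constantly 1.\<close>
        have "(\<lambda>p\<in>points ?P. f (lift p)) = (\<lambda>p\<in>points ?P. 1)"
          using 3(2) by (intro restrict_ext) (simp add: 3(3) 2 lift_def)
        then show ?thesis by (simp only: function_algebra_const[OF A])
      qed
    qed
  qed
qed

section \<open>Assembling the isomorphism\<close>

lemma quotient_W:
  "isomorphic_varieties
    (disjoint_union (Ch_plus g k (\<lambda>j. class_SL2 (a j))) (Ch_minus g k (\<lambda>j. class_SL2 (a j))))
    (git_quotient (carrier GL2) actW W)"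
proof -
  let ?X1 = "W_points (mat 1)" and ?X2 = "W_points (- mat 1)"
  note A = variety_algebra_W
  \<comment> \<open>As the sign takes only the values 1 and -1, this combination is the indicator of
    the plus component, so both components are open and closed.\<close>
  have "(\<lambda>w\<in>points W. (1/2) * (1 + sign w)) \<in> regular W"
    by (intro function_algebra_scale[OF A] function_algebra_add[OF A] function_algebra_const[OF A]
        regular_sign)
  also have "(\<lambda>w\<in>points W. (1/2) * (1 + sign w)) = (\<lambda>w\<in>points W. of_bool (w \<in> ?X1))"
    using sign_W(2,3) by (intro restrict_ext) fastforce
  finally have e: "(\<lambda>w\<in>points W. of_bool (w \<in> ?X1)) \<in> regular W" .
  have "?X1 \<inter> ?X2 = {}"
    by (auto simp: W_points_def rep_points_def uminus_mat_1 mat_eq_iff)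
  then show ?thesis
    unfolding Ch_plus_def Ch_minus_def char_variety_def W_points_def[symmetric] W_def
    by (intro git_quotient_clopen_decomposition)
       (use actW_points e in \<open>auto simp: W_def\<close>)
qed

lemma quotient_V:
  "isomorphic_varieties
    (product_variety (git_quotient (carrier GL2) actW W) (torus (2 * k - 2)))
    (Ch g k (\<lambda>j. class_sigma (a j)))"
proof -
  have "isomorphic_varieties
    (product_variety (git_quotient (carrier GL2) actW W) (torus (2 * k - 2)))
    (git_quotient (carrier GL2) actV V)"
  proof (rule git_quotient_isomorphic_product[OF variety_algebra_V variety_algebra_W affine_torus
        actV_points _ morphism_proj morphism_ratios morphism_lift proj_lift ratios_lift
        proj_actV ratios_actV lift_in_orbit])
    fix h w assume "h \<in> carrier GL2" "w \<in> points W"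
    then show "actW h w \<in> points W" using actW_points unfolding points_W by blast
  qed
  then show ?thesis
    unfolding Ch_def char_variety_def V_def V_points_def .
qed

end

theorem mainTheorem3:
  fixes g k :: nat and a :: "nat \<Rightarrow> complex"
  assumes "k \<ge> 1"
    and "\<And>j. j \<in> {1..2 * k} \<Longrightarrow> a j \<noteq> 0"
    and "\<And>j. j \<in> {1..2 * k} \<Longrightarrow> (a j)\<^sup>2 \<noteq> -1"
  defines "C \<equiv> \<lambda>j. class_sigma (a j)"
    and "C' \<equiv> \<lambda>j. class_SL2 (a j)"
  shows "isomorphic_varieties
    (product_variety (disjoint_union (Ch_plus g k C') (Ch_minus g k C')) (torus (2 * k - 2)))
    (Ch g k C)"
proof -
  interpret class_data g k a by unfold_locales (rule assms; assumption)+
  show ?thesis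
    unfolding C_def C'_def
    by (rule isomorphic_varieties_trans[OF isomorphic_product_variety[OF quotient_W] quotient_V])
qed

end
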